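(* Let $b_0\in(0,1)$, $\gamma\in(0,1]$, and let $q_0\in F$ be the potential $q_0(x)=\gamma\chi_{(0,b_0)}(|x|)$ on the unit disk $\Omega\subset\mathbb{R}^2$. Then there exists a sequence $\{q_k\}_{k\ge1}\subset F$ such that $\|q_0-q_k\|_{L^\infty(\Omega)}=\gamma>0$ for all $k\ge1$, while $$\|\Lambda_{q_0}-\Lambda_{q_k}\|_{\mathcal{L}(H^{1/2}_{\#};H^{-1/2}_{\#})}\to0\quad\text{as } k\to\infty.$$
   Context: $\Omega=\{x\in\mathbb{R}^2:|x|<1\}$; $\chi_{(0,b)}$ is the characteristic function of $(0,b)$; $F=\{q\in L^\infty(\Omega): q(x)=\gamma\chi_{(0,b)}(|x|),\ b\in(0,1),\ \gamma\in[0,1]\}$. Functions on $\partial\Omega$ are identified with $2\pi$-periodic functions of the polar angle; $g=\sum_{n\in\mathbb{Z}}g_ne^{in\theta}$ with $g_n=\frac1{2\pi}\int_0^{2\pi}g(t)e^{-int}\,dt$. The space $H^\alpha_{\#}$ ($\alpha=\pm1/2$) has norm $\|g\|_\alpha^2=\sum_{n\in\mathbb{Z}}(1+n^2)^\alpha|g_n|^2$. For $q\in F$, the Dirichlet-to-Neumann map $\Lambda_q:H^{1/2}_{\#}\to H^{-1/2}_{\#}$ is $\Lambda_q g=\frac{\partial u}{\partial r}\big|_{r=1}$, where $u$ is the unique solution of $\Delta u+q(x)u=0$ in $\Omega$ with $u=g$ on $\partial\Omega$. $\|\cdot\|_{\mathcal{L}(H^{1/2}_{\#};H^{-1/2}_{\#})}$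 is the operator norm. *)

theory Defs
  imports "HOL-Analysis.Analysis" "HOL-Probability.Essential_Supremum"
begin

definition Omega :: "(real^2) set" where
  "Omega = ball 0 1"

definition L2 :: "'a measure \<Rightarrow> ('a \<Rightarrow> 'b::euclidean_space) set" where
  "L2 M = {f \<in> borel_measurable M. integrable M (\<lambda>x. (norm (f x))\<^sup>2)}"

text \<open>Meaningful only for members of \<open>L2\<close>: the Bochner integral of a non-integrable function is 0.\<close>

definition L2_norm :: "'a measure \<Rightarrow> ('a \<Rightarrow> 'b::euclidean_space) \<Rightarrow> real" where
  "L2_norm M f = sqrt (\<integral>x. (norm (f x))\<^sup>2 \<partial>M)"

definition Linf_norm :: "(real^2 \<Rightarrow> real) \<Rightarrow> ereal" where
  "Linf_norm f = esssup (lebesgue_on Omega) (\<lambda>x. ereal \<bar>f x\<bar>)"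

definition radial_potential :: "real \<Rightarrow> real \<Rightarrow> real^2 \<Rightarrow> real" where
  "radial_potential \<gamma> b = (\<lambda>x. \<gamma> * indicator {0<..<b} (norm x))"

definition F :: "(real^2 \<Rightarrow> real) set" where
  "F = {radial_potential \<gamma> b | \<gamma> b. b \<in> {0<..<1} \<and> \<gamma> \<in> {0..1}}"

definition fourier_mode :: "int \<Rightarrow> real \<Rightarrow> complex" where
  "fourier_mode n t = exp (\<i> * of_int n * of_real t)"

definition fourier_coeff :: "(real \<Rightarrow> complex) \<Rightarrow> int \<Rightarrow> complex" where
  "fourier_coeff g n =
     1 / (2 * of_real pi) * (\<integral>t. g t * fourier_mode (- n) t \<partial>lebesgue_on {0..2*pi})"

text \<open>
  The elements of the space of order \<open>\<alpha>\<close> are represented by their sequences of Fourier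
  coefficients, since for \<open>\<alpha> < 0\<close> they are in general distributions and not functions.
\<close>

definition H_per :: "real \<Rightarrow> (int \<Rightarrow> complex) set" where
  "H_per \<alpha> = {c. (\<lambda>n. (1 + (of_int n)\<^sup>2) powr \<alpha> * (cmod (c n))\<^sup>2) summable_on UNIV}"

definition H_per_norm :: "real \<Rightarrow> (int \<Rightarrow> complex) \<Rightarrow> real" where
  "H_per_norm \<alpha> c = sqrt (\<Sum>\<^sub>\<infinity>n. (1 + (of_int n)\<^sup>2) powr \<alpha> * (cmod (c n))\<^sup>2)"

text \<open>For \<open>\<alpha> = 1/2\<close> the elements are genuine square integrable functions of the polar angle.\<close>

definition H_half :: "(real \<Rightarrow> complex) set" where
  "H_half = {g. (\<forall>t. g (t + 2*pi) = g t) \<and> g \<in> L2 (lebesgue_on {0..2*pi}) \<and>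
                fourier_coeff g \<in> H_per (1/2)}"

text \<open>
  The norm of an operator from order \<open>1/2\<close> to order \<open>-1/2\<close> is the infimum of its admissible
  bounds; it is \<open>\<infinity>\<close> if the operator is unbounded or leaves the target space.
\<close>

definition op_norm :: "((real \<Rightarrow> complex) \<Rightarrow> int \<Rightarrow> complex) \<Rightarrow> ennreal" where
  "op_norm T = Inf {ennreal C | C. 0 \<le> C \<and>
     (\<forall>g\<in>H_half. T g \<in> H_per (-1/2) \<and>
        H_per_norm (-1/2) (T g) \<le> C * H_per_norm (1/2) (fourier_coeff g))}"

definition C1_gradient :: "(real^2 \<Rightarrow> complex) \<Rightarrow> (real^2 \<Rightarrow> complex^2) \<Rightarrow> bool" where
  "C1_gradient \<phi> d\<phi> \<longleftrightarrow>
     (\<forall>x. (\<phi> has_derivative (\<lambda>h. \<Sum>j\<in>UNIV. of_real (h $ j) * d\<phi> x $ j)) (at x)) \<and>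
     continuous_on UNIV d\<phi>"

definition weak_gradient :: "(real^2 \<Rightarrow> complex) \<Rightarrow> (real^2 \<Rightarrow> complex^2) \<Rightarrow> bool" where
  "weak_gradient u p \<longleftrightarrow>
     (\<forall>\<phi> d\<phi> K. C1_gradient \<phi> d\<phi> \<and> compact K \<and> K \<subseteq> Omega \<and> (\<forall>x. x \<notin> K \<longrightarrow> \<phi> x = 0) \<longrightarrow>
        (\<forall>j. (\<integral>x. u x * d\<phi> x $ j \<partial>lebesgue_on Omega)
           = - (\<integral>x. p x $ j * \<phi> x \<partial>lebesgue_on Omega)))"

text \<open>\<open>H1 u p\<close>: the function \<open>u\<close> belongs to the Sobolev space \<open>H^1\<close> of the disk, with gradient \<open>p\<close>.\<close>

definition H1 :: "(real^2 \<Rightarrow> complex) \<Rightarrow> (real^2 \<Rightarrow> complex^2) \<Rightarrow> bool" where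
  "H1 u p \<longleftrightarrow> u \<in> L2 (lebesgue_on Omega) \<and> p \<in> L2 (lebesgue_on Omega) \<and> weak_gradient u p"

definition circle_point :: "real \<Rightarrow> real^2" where
  "circle_point t = vector [cos t, sin t]"

text \<open>
  The trace operator is the continuous extension to \<open>H^1\<close>, with values in \<open>L^2\<close> of the circle,
  of the restriction of functions that are continuously differentiable up to the boundary;
  its graph is the closure of the graph of the restriction.
\<close>

definition H1_trace ::
    "(real^2 \<Rightarrow> complex) \<Rightarrow> (real^2 \<Rightarrow> complex^2) \<Rightarrow> (real \<Rightarrow> complex) \<Rightarrow> bool" where
  "H1_trace u p g \<longleftrightarrow> H1 u p \<and> g \<in> L2 (lebesgue_on {0..2*pi}) \<and>
     (\<exists>\<phi> d\<phi>. (\<forall>k::nat. C1_gradient (\<phi> k) (d\<phi> k)) \<and>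
        (\<lambda>k. L2_norm (lebesgue_on Omega) (\<lambda>x. \<phi> k x - u x)) \<longlonglongrightarrow> 0 \<and>
        (\<lambda>k. L2_norm (lebesgue_on Omega) (\<lambda>x. d\<phi> k x - p x)) \<longlonglongrightarrow> 0 \<and>
        (\<lambda>k. L2_norm (lebesgue_on {0..2*pi}) (\<lambda>t. \<phi> k (circle_point t) - g t)) \<longlonglongrightarrow> 0)"

definition energy ::
    "(real^2 \<Rightarrow> real) \<Rightarrow> (real^2 \<Rightarrow> complex) \<Rightarrow> (real^2 \<Rightarrow> complex^2) \<Rightarrow>
     (real^2 \<Rightarrow> complex) \<Rightarrow> (real^2 \<Rightarrow> complex^2) \<Rightarrow> complex" where
  "energy q u p v w =
     (\<integral>x. (\<Sum>j\<in>UNIV. p x $ j * w x $ j) - of_real (q x) * u x * v x \<partial>lebesgue_on Omega)"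

text \<open>
  Weak solutions of \<open>\<Delta>u + q u = 0\<close> with \<open>u = g\<close> on the boundary; the test functions are
  the \<open>H^1\<close> functions of zero trace.
\<close>

definition weak_solution ::
    "(real^2 \<Rightarrow> real) \<Rightarrow> (real \<Rightarrow> complex) \<Rightarrow> (real^2 \<Rightarrow> complex) \<Rightarrow> (real^2 \<Rightarrow> complex^2) \<Rightarrow> bool" where
  "weak_solution q g u p \<longleftrightarrow> H1_trace u p g \<and>
     (\<forall>v w. H1_trace v w (\<lambda>_. 0) \<longrightarrow> energy q u p v w = 0)"

text \<open>
  For a solution \<open>u\<close>, the normal derivative is the functional on boundary values \<open>h\<close> given by
  Green's formula: its value at \<open>h\<close> (the boundary integral of \<open>h\<close> times the normal
  derivative, without conjugation) is \<open>energy q u p v w\<close> for every \<open>v\<close> in \<open>H^1\<close> with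
  trace \<open>h\<close>. Its Fourier coefficient of index \<open>n\<close> is its value at \<open>h = fourier_mode (- n)\<close>
  divided by \<open>2\<pi>\<close>.
\<close>

definition normal_derivative ::
    "(real^2 \<Rightarrow> real) \<Rightarrow> (real^2 \<Rightarrow> complex) \<Rightarrow> (real^2 \<Rightarrow> complex^2) \<Rightarrow> (int \<Rightarrow> complex) \<Rightarrow> bool" where
  "normal_derivative q u p l \<longleftrightarrow>
     (\<forall>n v w. H1_trace v w (fourier_mode (- n)) \<longrightarrow>
        l n = 1 / (2 * of_real pi) * energy q u p v w)"

definition DtN :: "(real^2 \<Rightarrow> real) \<Rightarrow> (real \<Rightarrow> complex) \<Rightarrow> int \<Rightarrow> complex" where
  "DtN q g = (THE l. \<exists>u p. weak_solution q g u p \<and> normal_derivative q u p l)"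

end

theory Submission
  imports Defs
begin

text \<open>
  All maps are diagonal in the Fourier basis. For \<open>n \<in> \<int>\<close> the equation has a solution
  \<open>v\<^sub>n = z\<^bsup>|n|\<^esup> G\<^sub>n(|z|\<^sup>2)\<close> (conjugated for \<open>n < 0\<close>) with boundary values \<open>e\<^bsup>int\<^esup>\<close> and normal derivative
  \<open>\<lambda>\<^sub>n e\<^bsup>int\<^esup>\<close>, where \<open>G\<^sub>n\<close> is a Bessel type power series inside the support of the potential,
  and \<open>|v\<^sub>n| \<le> 2\<close> uniformly in \<open>n\<close> and in the radius of the support, because \<open>\<gamma> \<le> 1\<close> keeps the problem away from resonance.
  The series \<open>\<Sum> g\<^sub>n v\<^sub>n\<close> solves the Dirichlet problem for \<open>g\<close>. The energy form is symmetric, so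
  testing an arbitrary solution with \<open>v\<^sub>-\<^sub>n\<close> shows that its normal derivative has coefficients
  \<open>\<lambda>\<^sub>n g\<^sub>n\<close>; no coercivity is needed for uniqueness.
  For two radii \<open>b\<^sub>0 < b\<close>, testing the mode of one potential with a mode of the other gives
  \<open>2\<pi> (\<lambda>\<^sub>n - \<lambda>'\<^sub>n) = \<integral> (q' - q) v\<^sub>n v'\<^sub>-\<^sub>n\<close>, whose modulus is at most four times the area of the annulus between the radii.
  Hence the operators converge as \<open>b \<rightarrow> b\<^sub>0\<close>, although the potentials keep the distance \<open>\<gamma>\<close>.
\<close>

section \<open>Square integrable functions\<close>

text \<open>The closure in \<open>H1_trace\<close> runs over functions that are continuously
  differentiable on the whole plane. A mode must therefore be such a function across the circle
  where the potential jumps, although its second derivatives may jump there. This is why the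
  profiles are built from a continuous derivative in the variable s = |x|^2, and why Green's formula
  is obtained from polar coordinates and a one-dimensional fundamental theorem with one exceptional
  radius. The same closure asks for L^2 convergence on the circle of the Fourier sums of the
  boundary values, hence for completeness of the trigonometric system. Absence of resonance is
  quantitative: before normalisation a profile has value 1 at the origin and slope at most 1/3 in s,
  so its value at s = 1 is at least 2/3 and can be divided out. These numbers depend neither on the
  order of the mode nor on the radius of the support. A bound on the multipliers that is uniform in
  n already controls the norm from order 1/2 to order -1/2, so the eigenvalue differences are
  estimated without any decay in n.\<close>

lemma L2D:
  assumes "f \<in> L2 M"
  shows "f \<in> borel_measurable M" "integrable M (\<lambda>x. (norm (f x))\<^sup>2)"
  using assms by (auto simp: L2_def)

lemma L2I:
  "f \<in> borel_measurable M \<Longrightarrow> integrable M (\<lambda>x. (norm (f x))\<^sup>2) \<Longrightarrow> f \<in> L2 M"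
  by (auto simp: L2_def)

lemma L2_dominated:
  fixes f :: "'a \<Rightarrow> 'b::euclidean_space"
  assumes "f \<in> borel_measurable M" "integrable M g" "\<And>x. x \<in> space M \<Longrightarrow> (norm (f x))\<^sup>2 \<le> g x"
  shows "f \<in> L2 M"
proof (rule L2I)
  show "integrable M (\<lambda>x. (norm (f x))\<^sup>2)"
    by (rule Bochner_Integration.integrable_bound[OF assms(2)])
       (use assms in \<open>auto intro!: AE_I2 order_trans[OF assms(3)]\<close>)
qed fact

lemma norm_add_square_le:
  fixes a b :: "'a::real_normed_vector"
  shows "(norm (a + b))\<^sup>2 \<le> 2 * (norm a)\<^sup>2 + 2 * (norm b)\<^sup>2"
proof -
  have "(norm (a + b))\<^sup>2 \<le> (norm a + norm b)\<^sup>2"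
    by (intro power_mono norm_triangle_ineq) auto
  also have "\<dots> \<le> 2 * (norm a)\<^sup>2 + 2 * (norm b)\<^sup>2"
    using sum_squares_bound[of "norm a" "norm b"] by (simp add: power2_sum)
  finally show ?thesis .
qed

lemma L2_add:
  fixes f g :: "'a \<Rightarrow> 'b::euclidean_space"
  assumes "f \<in> L2 M" "g \<in> L2 M"
  shows "(\<lambda>x. f x + g x) \<in> L2 M"
  by (rule L2_dominated[where g="\<lambda>x. 2 * (norm (f x))\<^sup>2 + 2 * (norm (g x))\<^sup>2"])
     (use L2D[OF assms(1)] L2D[OF assms(2)] in \<open>auto simp: norm_add_square_le\<close>)

lemma L2_scale:
  fixes f :: "'a \<Rightarrow> complex"
  assumes "f \<in> L2 M"
  shows "(\<lambda>x. c * f x) \<in> L2 M"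
  by (rule L2_dominated[where g="\<lambda>x. (norm c)\<^sup>2 * (norm (f x))\<^sup>2"])
     (use L2D[OF assms(1)] in \<open>auto simp: norm_mult power_mult_distrib\<close>)

lemma L2_uminus:
  fixes f :: "'a \<Rightarrow> 'b::euclidean_space"
  assumes "f \<in> L2 M"
  shows "(\<lambda>x. - f x) \<in> L2 M"
  using assms by (auto simp: L2_def)

lemma L2_diff:
  fixes f g :: "'a \<Rightarrow> 'b::euclidean_space"
  assumes "f \<in> L2 M" "g \<in> L2 M"
  shows "(\<lambda>x. f x - g x) \<in> L2 M"
  using L2_add[OF assms(1) L2_uminus[OF assms(2)]] by simp

lemma L2_sum:
  fixes f :: "'i \<Rightarrow> 'a \<Rightarrow> 'b::euclidean_space"
  assumes "\<And>i. i \<in> A \<Longrightarrow> f i \<in> L2 M"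
  shows "(\<lambda>x. \<Sum>i\<in>A. f i x) \<in> L2 M"
  using assms
proof (induction A rule: infinite_finite_induct)
  case (insert a A)
  then show ?case by (simp add: L2_add)
qed (auto simp: L2_def)

lemma L2_bounded:
  fixes f :: "'a \<Rightarrow> 'b::euclidean_space"
  assumes "finite_measure M" "f \<in> borel_measurable M" "\<And>x. x \<in> space M \<Longrightarrow> norm (f x) \<le> B"
  shows "f \<in> L2 M"
proof -
  interpret finite_measure M by fact
  show ?thesis
    by (rule L2_dominated[where g="\<lambda>x. B\<^sup>2"]) (use assms in \<open>auto intro!: power_mono\<close>)
qed

lemma L2_mult_integrable:
  fixes f g :: "'a \<Rightarrow> complex"
  assumes f: "f \<in> L2 M" and g: "g \<in> L2 M"
  shows "integrable M (\<lambda>x. f x * g x)"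
proof (rule Bochner_Integration.integrable_bound[where f="\<lambda>x. (norm (f x))\<^sup>2 + (norm (g x))\<^sup>2"])
  have "norm (f x * g x) \<le> norm ((norm (f x))\<^sup>2 + (norm (g x))\<^sup>2)" for x
  proof -
    have "2 * norm (f x) * norm (g x) \<le> (norm (f x))\<^sup>2 + (norm (g x))\<^sup>2"
      by (rule sum_squares_bound)
    moreover have "0 \<le> norm (f x) * norm (g x)" by simp
    ultimately show ?thesis unfolding norm_mult real_norm_def by linarith
  qed
  then show "AE x in M. norm (f x * g x) \<le> norm ((norm (f x))\<^sup>2 + (norm (g x))\<^sup>2)"
    by simp
qed (use L2D[OF f] L2D[OF g] in auto)

lemma L2_norm_nonneg [simp]: "0 \<le> L2_norm M f"
  by (simp add: L2_norm_def)

lemma L2_norm_square: "(L2_norm M f)\<^sup>2 = (\<integral>x. (norm (f x))\<^sup>2 \<partial>M)"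
  by (simp add: L2_norm_def)

lemma L2_Cauchy_Schwarz:
  fixes f g :: "'a \<Rightarrow> complex"
  assumes f: "f \<in> L2 M" and g: "g \<in> L2 M"
  shows "norm (\<integral>x. f x * g x \<partial>M) \<le> L2_norm M f * L2_norm M g"
proof -
  have [measurable]: "f \<in> borel_measurable M" "g \<in> borel_measurable M"
    using L2D f g by auto
  let ?I = "\<integral>x. norm (f x * g x) \<partial>M"
  have I: "integrable M (\<lambda>x. norm (f x * g x))"
    using L2_mult_integrable[OF f g] by (rule integrable_norm)
  have eq: "ennreal ?I = (\<integral>\<^sup>+x. ennreal (norm (f x)) * ennreal (norm (g x)) \<partial>M)"
    by (subst nn_integral_eq_integral[OF I, symmetric]) (auto simp: norm_mult ennreal_mult)
  have sq: "(\<integral>\<^sup>+x. (ennreal (norm (h x)))\<^sup>2 \<partial>M) = ennreal ((L2_norm M h)\<^sup>2)"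
    if "h \<in> L2 M" for h :: "'a \<Rightarrow> complex"
    unfolding L2_norm_square
    by (subst nn_integral_eq_integral[OF L2D(2)[OF that], symmetric])
       (auto simp: ennreal_power)
  have "ennreal (?I\<^sup>2) = (ennreal ?I)\<^sup>2"
    by (simp add: ennreal_power)
  also have "\<dots> \<le> ennreal ((L2_norm M f)\<^sup>2) * ennreal ((L2_norm M g)\<^sup>2)"
    unfolding eq sq[OF f, symmetric] sq[OF g, symmetric]
    by (rule Cauchy_Schwarz_nn_integral) auto
  also have "\<dots> = ennreal ((L2_norm M f * L2_norm M g)\<^sup>2)"
    by (simp add: ennreal_mult power_mult_distrib)
  finally have "?I\<^sup>2 \<le> (L2_norm M f * L2_norm M g)\<^sup>2"
    by (simp add: ennreal_le_iff)
  then have "?I \<le> L2_norm M f * L2_norm M g"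
    by (rule power2_le_imp_le) simp
  then show ?thesis
    using integral_norm_bound[of M "\<lambda>x. f x * g x"] by linarith
qed

text \<open>Pairing with a fixed square integrable function is Lipschitz in the L^2 distance, by
  Cauchy-Schwarz. Every passage to the limit in energies and weak gradients rests on this.\<close>

lemma L2_tendsto_integral_mult:
  fixes f :: "nat \<Rightarrow> 'a \<Rightarrow> complex"
  assumes fk: "\<And>k. f k \<in> L2 M" and f: "f0 \<in> L2 M" and h: "h \<in> L2 M"
    and lim: "(\<lambda>k. L2_norm M (\<lambda>x. f k x - f0 x)) \<longlonglongrightarrow> 0"
  shows "(\<lambda>k. \<integral>x. f k x * h x \<partial>M) \<longlonglongrightarrow> (\<integral>x. f0 x * h x \<partial>M)"
proof (rule Lim_transform_bound[where g="\<lambda>k. L2_norm M (\<lambda>x. f k x - f0 x) * L2_norm M h", THEN LIM_zero_cancel])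
  have "norm ((\<integral>x. f k x * h x \<partial>M) - (\<integral>x. f0 x * h x \<partial>M)) 
      \<le> L2_norm M (\<lambda>x. f k x - f0 x) * L2_norm M h" for k
    using L2_Cauchy_Schwarz[OF L2_diff[OF fk f] h]
    by (simp add: L2_mult_integrable fk f h flip: Bochner_Integration.integral_diff left_diff_distrib)
  then show "\<forall>\<^sub>F k in sequentially. norm ((\<integral>x. f k x * h x \<partial>M) - (\<integral>x. f0 x * h x \<partial>M)) 
      \<le> norm (L2_norm M (\<lambda>x. f k x - f0 x) * L2_norm M h)"
    by (auto intro: order_trans)
  show "(\<lambda>k. L2_norm M (\<lambda>x. f k x - f0 x) * L2_norm M h) \<longlonglongrightarrow> 0"
    using tendsto_mult_left_zero[OF lim] .
qed

lemma L2_component: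
  fixes p :: "'a \<Rightarrow> complex^2"
  assumes "p \<in> L2 M"
  shows "(\<lambda>x. p x $ j) \<in> L2 M"
proof (rule L2_dominated[OF _ L2D(2)[OF assms]])
  show "(\<lambda>x. p x $ j) \<in> borel_measurable M"
    by (rule measurable_compose[OF L2D(1)[OF assms]]) (intro borel_measurable_continuous_onI continuous_intros)
  show "(norm (p x $ j))\<^sup>2 \<le> (norm (p x))\<^sup>2" for x
    by (intro power_mono Finite_Cartesian_Product.norm_nth_le) auto
qed

lemma L2_norm_component_le:
  fixes p :: "'a \<Rightarrow> complex^2"
  assumes "p \<in> L2 M"
  shows "L2_norm M (\<lambda>x. p x $ j) \<le> L2_norm M p"
  unfolding L2_norm_def
  by (intro real_sqrt_le_mono integral_mono L2D(2) L2_component assms power_mono) (auto simp: Finite_Cartesian_Product.norm_nth_le)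

lemma L2_tendsto_component:
  fixes p :: "nat \<Rightarrow> 'a \<Rightarrow> complex^2"
  assumes "\<And>k. p k \<in> L2 M" "p0 \<in> L2 M" "(\<lambda>k. L2_norm M (\<lambda>x. p k x - p0 x)) \<longlonglongrightarrow> 0"
  shows "(\<lambda>k. L2_norm M (\<lambda>x. p k x $ j - p0 x $ j)) \<longlonglongrightarrow> 0"
proof (rule tendsto_sandwich[OF _ _ tendsto_const assms(3)])
  show "\<forall>\<^sub>F k in sequentially. L2_norm M (\<lambda>x. p k x $ j - p0 x $ j) \<le> L2_norm M (\<lambda>x. p k x - p0 x)"
    using L2_norm_component_le[OF L2_diff[OF assms(1,2)]] by auto
qed auto

section \<open>The unit disk, the period interval and the energy form\<close>

lemma Omega_lebesgue [simp, measurable]: "Omega \<in> sets lebesgue" "Omega \<in> sets borel"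
  by (auto simp: Omega_def)

lemma Omega_lmeasurable [simp]: "Omega \<in> lmeasurable"
  by (simp add: Omega_def)

lemma finite_measure_Omega [simp]: "finite_measure (lebesgue_on Omega)"
  by (rule finite_measure_lebesgue_on) simp

lemma finite_measure_period [simp]: "finite_measure (lebesgue_on {0..2*pi})"
  by (rule finite_measure_lebesgue_on) simp

lemma borel_measurable_lebesgue_onI [measurable_dest]:
  "f \<in> borel_measurable borel \<Longrightarrow> f \<in> borel_measurable (lebesgue_on S)"
  by (rule measurable_restrict_space1) (simp add: measurable_completion)

text \<open>The form is bilinear, without conjugation, hence symmetric rather than Hermitian. A mode
  and an arbitrary H^1 function can thus exchange the roles of solution and test function.\<close>

lemma energy_sym: "energy q u p v w = energy q v w u p"
  by (simp add: energy_def mult_ac)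

lemma L2_mult_bounded:
  fixes f :: "'a \<Rightarrow> complex"
  assumes f: "f \<in> L2 M" and "q \<in> borel_measurable M" "\<And>x. x \<in> space M \<Longrightarrow> norm (q x) \<le> B"
  shows "(\<lambda>x. q x * f x) \<in> L2 M"
proof (rule L2_dominated[where g="\<lambda>x. B\<^sup>2 * (norm (f x))\<^sup>2"])
  show "(norm (q x * f x))\<^sup>2 \<le> B\<^sup>2 * (norm (f x))\<^sup>2" if "x \<in> space M" for x
    unfolding norm_mult power_mult_distrib
    by (intro mult_right_mono power_mono) (use assms(3) that in auto)
qed (use L2D[OF f] assms in auto)

text \<open>The potential is attached to \<open>v\<close>, so that each term pairs two square
  integrable functions.\<close>

lemma energy_eq_integrals:
  assumes L2: "u \<in> L2 (lebesgue_on Omega)" "p \<in> L2 (lebesgue_on Omega)"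
    "v \<in> L2 (lebesgue_on Omega)" "w \<in> L2 (lebesgue_on Omega)"
    and q: "q \<in> borel_measurable borel" "\<And>x. \<bar>q x\<bar> \<le> B"
  shows "energy q u p v w = (\<Sum>j\<in>UNIV. \<integral>x. p x $ j * w x $ j \<partial>lebesgue_on Omega) 
      - (\<integral>x. u x * (of_real (q x) * v x) \<partial>lebesgue_on Omega)"
proof -
  have "(\<lambda>x. of_real (q x) * v x) \<in> L2 (lebesgue_on Omega)"
    using q by (intro L2_mult_bounded[where B=B] L2) auto
  then have "integrable (lebesgue_on Omega) (\<lambda>x. u x * (of_real (q x) * v x))"
    by (intro L2_mult_integrable L2)
  moreover have "integrable (lebesgue_on Omega) (\<lambda>x. p x $ j * w x $ j)" for j
    by (intro L2_mult_integrable L2_component L2)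
  ultimately show ?thesis
    by (simp add: energy_def mult_ac)
qed

lemma energy_tendsto:
  assumes L2: "\<And>k. u k \<in> L2 (lebesgue_on Omega)" "\<And>k. p k \<in> L2 (lebesgue_on Omega)"
    "u0 \<in> L2 (lebesgue_on Omega)" "p0 \<in> L2 (lebesgue_on Omega)"
    "v \<in> L2 (lebesgue_on Omega)" "w \<in> L2 (lebesgue_on Omega)"
    and q: "q \<in> borel_measurable borel" "\<And>x. \<bar>q x\<bar> \<le> B"
    and lim: "(\<lambda>k. L2_norm (lebesgue_on Omega) (\<lambda>x. u k x - u0 x)) \<longlonglongrightarrow> 0"
      "(\<lambda>k. L2_norm (lebesgue_on Omega) (\<lambda>x. p k x - p0 x)) \<longlonglongrightarrow> 0"
  shows "(\<lambda>k. energy q (u k) (p k) v w) \<longlonglongrightarrow> energy q u0 p0 v w"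
proof -
  have "(\<lambda>x. of_real (q x) * v x) \<in> L2 (lebesgue_on Omega)"
    using q by (intro L2_mult_bounded[where B=B] L2) auto
  then show ?thesis
    unfolding energy_eq_integrals[OF L2(1,2,5,6) q] energy_eq_integrals[OF L2(3,4,5,6) q]
    by (intro tendsto_intros L2_tendsto_integral_mult L2_component L2 lim L2_tendsto_component)
qed

section \<open>Continuously differentiable functions\<close>

lemma C1_gradient_continuous:
  assumes "C1_gradient \<phi> d\<phi>"
  shows "continuous_on UNIV \<phi>" "continuous_on UNIV d\<phi>"
  using assms by (auto simp: C1_gradient_def intro!: continuous_at_imp_continuous_on has_derivative_continuous)

lemma C1_gradient_chain:
  assumes "C1_gradient \<phi> d\<phi>" and c: "(c has_vector_derivative c') (at t within S)"
  shows "((\<lambda>t. \<phi> (c t)) has_vector_derivative (\<Sum>j\<in>UNIV. of_real (c' $ j) * d\<phi> (c t) $ j)) (at t within S)"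
proof -
  have "(\<phi> has_derivative (\<lambda>h. \<Sum>j\<in>UNIV. of_real (h $ j) * d\<phi> (c t) $ j)) (at (c t))"
    using assms by (auto simp: C1_gradient_def)
  from has_derivative_compose[OF c[unfolded has_vector_derivative_def] this]
  show ?thesis
    unfolding has_vector_derivative_def
    by (simp add: sum_distrib_left scaleR_conv_of_real[where 'a=complex] mult_ac)
qed

lemma continuous_on_compact_bounded:
  fixes f :: "'a::topological_space \<Rightarrow> 'b::real_normed_vector"
  assumes "compact K" "continuous_on K f"
  shows "\<exists>B. \<forall>x\<in>K. norm (f x) \<le> B"
  using compact_imp_bounded[OF compact_continuous_image[OF assms(2,1)]]
  by (auto simp: bounded_iff)

lemma continuous_bounded_on_Omega:
  fixes f :: "real^2 \<Rightarrow> 'b::real_normed_vector"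
  assumes "continuous_on UNIV f"
  obtains B where "\<And>x. x \<in> Omega \<Longrightarrow> norm (f x) \<le> B"
proof -
  obtain B where "\<And>x. x \<in> cball 0 1 \<Longrightarrow> norm (f x) \<le> B"
    using continuous_on_compact_bounded[OF compact_cball continuous_on_subset[OF assms subset_UNIV]] by blast
  then show ?thesis
    by (intro that[of B]) (auto simp: Omega_def)
qed

lemma continuous_L2_Omega:
  fixes f :: "real^2 \<Rightarrow> 'b::euclidean_space"
  assumes "continuous_on UNIV f"
  shows "f \<in> L2 (lebesgue_on Omega)"
proof -
  obtain B where "\<And>x. x \<in> Omega \<Longrightarrow> norm (f x) \<le> B"
    using continuous_bounded_on_Omega[OF assms] by blast
  then show ?thesis
    using assms by (intro L2_bounded[where B=B] borel_measurable_lebesgue_onI borel_measurable_continuous_onI) auto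
qed

lemma continuous_L2_period:
  fixes f :: "real \<Rightarrow> 'b::euclidean_space"
  assumes "continuous_on UNIV f"
  shows "f \<in> L2 (lebesgue_on {0..2*pi})"
proof -
  obtain B where "\<And>x. x \<in> {0..2*pi} \<Longrightarrow> norm (f x) \<le> B"
    using continuous_on_compact_bounded[OF compact_Icc continuous_on_subset[OF assms subset_UNIV]] by blast
  then show ?thesis
    using assms by (intro L2_bounded[where B=B] borel_measurable_lebesgue_onI borel_measurable_continuous_onI) auto
qed

lemma C1_gradient_L2:
  assumes "C1_gradient \<phi> d\<phi>"
  shows "\<phi> \<in> L2 (lebesgue_on Omega)" "d\<phi> \<in> L2 (lebesgue_on Omega)"
  using C1_gradient_continuous[OF assms] by (auto intro: continuous_L2_Omega)

lemma C1_gradient_mult: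
  assumes "C1_gradient \<phi> d\<phi>" "C1_gradient \<psi> d\<psi>"
  shows "C1_gradient (\<lambda>x. \<phi> x * \<psi> x) (\<lambda>x. \<chi> j. d\<phi> x $ j * \<psi> x + \<phi> x * d\<psi> x $ j)"
  unfolding C1_gradient_def
proof (intro conjI allI)
  fix x
  have "(\<phi> has_derivative (\<lambda>h. \<Sum>j\<in>UNIV. of_real (h $ j) * d\<phi> x $ j)) (at x)"
    "(\<psi> has_derivative (\<lambda>h. \<Sum>j\<in>UNIV. of_real (h $ j) * d\<psi> x $ j)) (at x)"
    using assms by (auto simp: C1_gradient_def)
  from has_derivative_mult[OF this]
  show "((\<lambda>x. \<phi> x * \<psi> x) has_derivative (\<lambda>h. \<Sum>j\<in>UNIV. of_real (h $ j) * (\<chi> j. d\<phi> x $ j * \<psi> x + \<phi> x * d\<psi> x $ j) $ j)) (at x)"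
    by (rule has_derivative_eq_rhs) (simp add: fun_eq_iff sum_2 algebra_simps)
next
  show "continuous_on UNIV (\<lambda>x. \<chi> j. d\<phi> x $ j * \<psi> x + \<phi> x * d\<psi> x $ j)"
    using C1_gradient_continuous[OF assms(1)] C1_gradient_continuous[OF assms(2)]
    by (intro continuous_intros)
qed

section \<open>Integration by parts and weak gradients of continuously differentiable
  functions\<close>

lemma C1_gradient_partial:
  assumes C1: "C1_gradient f df"
  shows "((\<lambda>t. f (x + t *\<^sub>R axis j 1)) has_vector_derivative df (x + t *\<^sub>R axis j 1) $ j) (at t)"
proof -
  have "((\<lambda>t. x + t *\<^sub>R axis j 1) has_vector_derivative axis j 1) (at t)"
    by (auto intro!: derivative_eq_intros)
  from C1_gradient_chain[OF C1 this]
  have *: "((\<lambda>t. f (x + t *\<^sub>R axis j 1)) has_vector_derivative (\<Sum>i\<in>UNIV. complex_of_real ((axis j 1 :: real^2) $ i) * df (x + t *\<^sub>R axis j 1) $ i)) (at t)" .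
  have "(\<Sum>i\<in>UNIV. complex_of_real ((axis j 1 :: real^2) $ i) * df (x + t *\<^sub>R axis j 1) $ i) = df (x + t *\<^sub>R axis j 1) $ j"
    by (subst sum.mono_neutral_cong_right[where S="{j}" and h="\<lambda>i. df (x + t *\<^sub>R axis j 1) $ i"]) (auto simp: axis_def)
  then show ?thesis using * by simp
qed

lemma C1_gradient_zero_outside:
  assumes C1: "C1_gradient f df" and K: "closed K" "\<And>x. x \<notin> K \<Longrightarrow> f x = 0" and "x \<notin> K"
  shows "df x $ j = 0"
proof -
  have "((\<lambda>t. x + t *\<^sub>R (axis j 1::real^2)) \<longlongrightarrow> x + 0 *\<^sub>R axis j 1) (nhds 0)"
    by (intro tendsto_intros filterlim_ident)
  then have "\<forall>\<^sub>F t in nhds 0. x + t *\<^sub>R axis j 1 \<in> - K"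
    using topological_tendstoD[of _ x "nhds 0" "- K"] K(1) \<open>x \<notin> K\<close> by (auto simp: open_Compl)
  then have "\<forall>\<^sub>F t in nhds 0. f (x + t *\<^sub>R axis j 1) = 0"
    by eventually_elim (use K(2) in auto)
  moreover have "((\<lambda>t::real. 0::complex) has_vector_derivative 0) (at 0)"
    by auto
  ultimately have "((\<lambda>t. f (x + t *\<^sub>R axis j 1)) has_vector_derivative 0) (at 0)"
    using has_vector_derivative_cong_ev[where x=0 and S=UNIV and f="\<lambda>t. f (x + t *\<^sub>R axis j 1)" and g="\<lambda>_. 0"] \<open>x \<notin> K\<close> K(2)
    by (simp add: eventually_mono)
  from vector_derivative_unique_at[OF C1_gradient_partial[OF C1, of x j 0] this] show ?thesis by simp
qed

text \<open>Difference quotients have integral zero because Lebesgue measure is translation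
  invariant. They are bounded by the maximum of the derivative and live in a fixed ball, so
  dominated convergence carries this over to the derivative.\<close>

lemma integral_partial_derivative_compact_support:
  assumes C1: "C1_gradient f df" and K: "compact K" "\<And>x. x \<notin> K \<Longrightarrow> f x = 0"
  shows "(\<integral>x. df x $ j \<partial>lborel) = 0"
proof -
  obtain R where R: "K \<subseteq> cball 0 R"
    using compact_imp_bounded[OF K(1)] by (auto simp: bounded_iff subset_eq)
  have cont: "continuous_on UNIV f" "continuous_on UNIV (\<lambda>x. df x $ j)"
    using C1_gradient_continuous[OF C1] by (auto intro: continuous_intros)
  have [measurable]: "f \<in> borel_measurable borel" "(\<lambda>x. df x $ j) \<in> borel_measurable borel"
    using cont by (auto intro: borel_measurable_continuous_onI)
  note deriv = C1_gradient_partial[OF C1]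
  note df0 = C1_gradient_zero_outside[OF C1 compact_imp_closed[OF K(1)] K(2)]
  obtain B0 where B0: "\<And>x. x \<in> K \<Longrightarrow> norm (df x $ j) \<le> B0"
    using continuous_on_compact_bounded[OF K(1) continuous_on_subset[OF cont(2) subset_UNIV]] by blast
  define B where "B = \<bar>B0\<bar>"
  have B: "norm (df x $ j) \<le> B" for x
    using B0[of x] df0[of x] by (cases "x \<in> K") (auto simp: B_def)
  \<comment> \<open>Forward difference quotients with step 1/(n+1). Steps of length at most 1 keep
    them all supported in the ball of radius R + 1.\<close>
  define D where "D n x = (f (x + (1 / real (Suc n)) *\<^sub>R axis j 1) - f x) * of_nat (Suc n)" for n x
  have D_meas: "D n \<in> borel_measurable borel" for n
    unfolding D_def by (intro borel_measurable_continuous_onI continuous_intros continuous_on_compose2[OF cont(1)]) auto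
  have D_bound: "norm (D n x) \<le> B * indicator (cball 0 (R+1)) x" for n x
  proof (cases "x \<in> cball 0 (R+1)")
    case True
    have "norm (f (x + (1 / real (Suc n)) *\<^sub>R axis j 1) - f (x + 0 *\<^sub>R axis j 1)) \<le> B * norm (1 / real (Suc n) - 0)"
      by (rule differentiable_bound[where S=UNIV])
         (use deriv B in \<open>auto simp: has_vector_derivative_def intro!: onorm_bound mult_left_mono simp: mult.commute B_def\<close>)
    then have "norm (f (x + (1 / real (Suc n)) *\<^sub>R axis j 1) - f x) * real (Suc n) \<le> B"
      by (simp add: field_simps)
    then show ?thesis using True by (simp only: D_def norm_mult norm_of_nat) simp
  next
    case False
    have "norm (x + (1 / real (Suc n)) *\<^sub>R axis j 1) \<ge> norm x - norm ((1 / real (Suc n)) *\<^sub>R (axis j 1::real^2))"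
      using norm_diff_ineq by blast
    moreover have "norm ((1 / real (Suc n)) *\<^sub>R (axis j 1::real^2)) \<le> 1" by simp
    ultimately have "norm (x + (1 / real (Suc n)) *\<^sub>R axis j 1) \<ge> norm x - 1" by linarith
    then have "norm x > R" "norm (x + (1 / real (Suc n)) *\<^sub>R axis j 1) > R"
      using False by auto
    then have "x \<notin> K" "x + (1 / real (Suc n)) *\<^sub>R axis j 1 \<notin> K"
      using R by (meson mem_cball_0 not_le subsetD)+
    then have "D n x = 0" using K(2) by (simp only: D_def) simp
    then show ?thesis using False by simp
  qed
  have "(\<lambda>n. \<integral>x. D n x \<partial>lborel) \<longlonglongrightarrow> (\<integral>x. df x $ j \<partial>lborel)"
  proof (rule integral_dominated_convergence[where w="\<lambda>x. B * indicator (cball 0 (R+1)) x"])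
    show "integrable lborel (\<lambda>x::real^2. B * indicator (cball 0 (R+1)) x)"
      by (intro integrable_mult_right integrable_real_indicator)
          (use emeasure_lborel_cball_finite in \<open>auto simp: less_top\<close>)
    have "(\<lambda>n. D n x) \<longlonglongrightarrow> df x $ j" for x
    proof -
      have "((\<lambda>t. (f (x + t *\<^sub>R axis j 1) - f x) /\<^sub>R t) \<longlongrightarrow> df x $ j) (at 0)"
      proof (rule LIM_zero_cancel[OF tendsto_norm_zero_cancel])
        let ?r = "\<lambda>t. (f (x + t *\<^sub>R axis j 1) - f x - t *\<^sub>R df x $ j) /\<^sub>R norm t"
        have "?r \<midarrow>0\<rightarrow> 0"
          using deriv[of x j 0] by (simp add: has_vector_derivative_def has_derivative_def)
        then have "(\<lambda>t. norm (?r t)) \<midarrow>0\<rightarrow> 0"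
          by (rule tendsto_norm_zero)
        moreover have "norm (?r t) = norm ((f (x + t *\<^sub>R axis j 1) - f x) /\<^sub>R t - df x $ j)" if "t \<noteq> 0" for t
        proof -
          have "(f (x + t *\<^sub>R axis j 1) - f x) /\<^sub>R t - df x $ j = (f (x + t *\<^sub>R axis j 1) - f x - t *\<^sub>R df x $ j) /\<^sub>R t"
            using that by (simp add: scaleR_diff_right)
          then show ?thesis by simp
        qed
        ultimately show "(\<lambda>t. norm ((f (x + t *\<^sub>R axis j 1) - f x) /\<^sub>R t - df x $ j)) \<midarrow>0\<rightarrow> 0"
          by (simp cong: LIM_cong)
      qed
      moreover have "filterlim (\<lambda>n. 1 / real (Suc n)) (at 0) sequentially"
        by (rule filterlim_atI) (use LIMSEQ_inverse_real_of_nat in \<open>auto simp: inverse_eq_divide\<close>)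
      ultimately have "(\<lambda>n. (f (x + (1 / real (Suc n)) *\<^sub>R axis j 1) - f x) /\<^sub>R (1 / real (Suc n))) \<longlonglongrightarrow> df x $ j"
        by (rule filterlim_compose)
      then show ?thesis
        by (simp add: D_def scaleR_conv_of_real mult.commute)
    qed
    then show "AE x in lborel. (\<lambda>n. D n x) \<longlonglongrightarrow> df x $ j" by simp
  qed (use D_bound D_meas in auto)
  moreover have "(\<integral>x. D n x \<partial>lborel) = 0" for n
  proof -
    have int: "integrable lborel f"
    proof -
      obtain C where C: "\<And>x. x \<in> K \<Longrightarrow> norm (f x) \<le> C"
        using continuous_on_compact_bounded[OF K(1) continuous_on_subset[OF cont(1) subset_UNIV]] by blast
      have "norm (f x) \<le> norm (\<bar>C\<bar> * indicator (cball 0 R) x)" for x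
        using C[of x] K(2)[of x] R by (cases "x \<in> K") (auto simp: indicator_def)
      moreover have "integrable lborel (\<lambda>x::real^2. \<bar>C\<bar> * indicator (cball 0 R) x)"
        by (intro integrable_mult_right integrable_real_indicator)
          (use emeasure_lborel_cball_finite in \<open>auto simp: less_top\<close>)
      ultimately show ?thesis
        by (intro Bochner_Integration.integrable_bound[where g=f and f="\<lambda>x. \<bar>C\<bar> * indicator (cball 0 R) x"]) auto
    qed
    define a where "a = (1 / real (Suc n)) *\<^sub>R (axis j 1::real^2)"
    have "integrable lborel (\<lambda>x. f (a + x))" "(\<integral>x. f (a + x) \<partial>lborel) = (\<integral>x. f x \<partial>lborel)"
      using int lborel_distr_plus[of a] integrable_distr[of "(+) a" lborel borel f]
        integral_distr[of "(+) a" lborel borel f] by auto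
    then have "(\<integral>x. (f (a + x) - f x) * of_nat (Suc n) \<partial>lborel) = 0"
      using int by simp
    then show ?thesis by (simp add: D_def a_def add.commute)
  qed
  ultimately show ?thesis
    by (simp add: LIMSEQ_const_iff)
qed

lemma lebesgue_on_integral_compact_support:
  fixes f :: "real^2 \<Rightarrow> 'b::euclidean_space"
  assumes "continuous_on UNIV f" "\<And>x. x \<notin> Omega \<Longrightarrow> f x = 0"
  shows "(\<integral>x. f x \<partial>lebesgue_on Omega) = (\<integral>x. f x \<partial>lborel)"
proof -
  have "(\<integral>x. f x \<partial>lebesgue_on Omega) = (\<integral>x. f x \<partial>lebesgue)"
    using assms(2) by (subst integral_restrict_space) (auto intro!: Bochner_Integration.integral_cong simp: indicator_def)
  also have "\<dots> = (\<integral>x. f x \<partial>lborel)"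
    using assms(1) by (intro integral_completion) (simp add: borel_measurable_continuous_onI)
  finally show ?thesis .
qed

text \<open>The product with a test function has compact support in the disk, so its partial
  derivatives integrate to zero; the product rule splits this integral into the two sides.\<close>

lemma C1_gradient_imp_weak_gradient:
  assumes u: "C1_gradient u p"
  shows "weak_gradient u p"
  unfolding weak_gradient_def
proof (intro allI impI)
  fix \<phi> d\<phi> K j
  assume A: "C1_gradient \<phi> d\<phi> \<and> compact K \<and> K \<subseteq> Omega \<and> (\<forall>x. x \<notin> K \<longrightarrow> \<phi> x = 0)"
  let ?f = "\<lambda>x. u x * \<phi> x" and ?df = "\<lambda>x. \<chi> j. p x $ j * \<phi> x + u x * d\<phi> x $ j"
  have C1: "C1_gradient ?f ?df" using C1_gradient_mult u A by blast
  have "(\<integral>x. ?df x $ j \<partial>lborel) = 0"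
    by (rule integral_partial_derivative_compact_support[OF C1, of K]) (use A in auto)
  also have "(\<integral>x. ?df x $ j \<partial>lborel) = (\<integral>x. ?df x $ j \<partial>lebesgue_on Omega)"
  proof (rule lebesgue_on_integral_compact_support[symmetric])
    show "continuous_on UNIV (\<lambda>x. ?df x $ j)"
      using C1_gradient_continuous(2)[OF C1] by (rule continuous_on_component)
    show "?df x $ j = 0" if "x \<notin> Omega" for x
      using A that by (intro C1_gradient_zero_outside[OF C1, of K]) (auto simp: compact_imp_closed)
  qed
  also have "\<dots> = (\<integral>x. p x $ j * \<phi> x \<partial>lebesgue_on Omega) + (\<integral>x. u x * d\<phi> x $ j \<partial>lebesgue_on Omega)"
    using C1_gradient_L2[OF u] C1_gradient_L2[of \<phi> d\<phi>] A
    by (simp add: L2_mult_integrable L2_component)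
  finally show "(\<integral>x. u x * d\<phi> x $ j \<partial>lebesgue_on Omega) = - (\<integral>x. p x $ j * \<phi> x \<partial>lebesgue_on Omega)"
    by (simp add: eq_neg_iff_add_eq_0 add.commute)
qed

section \<open>Boundary values of continuously differentiable functions\<close>

lemma circle_point_nth [simp]: "circle_point t $ 1 = cos t" "circle_point t $ 2 = sin t"
  by (simp_all add: circle_point_def vector_2)

lemma continuous_circle_point: "continuous_on UNIV circle_point"
proof -
  have "continuous_on UNIV (\<lambda>t::real. if i = (1::2) then cos t else sin t)" for i
    by (cases "i = 1") (auto intro!: continuous_intros)
  then have "continuous_on UNIV (\<lambda>t::real. \<chi> i::2. if i = 1 then cos t else sin t)"
    by (intro continuous_on_vec_lambda)
  moreover have eq: "circle_point = (\<lambda>t. \<chi> i. if i = 1 then cos t else sin t)"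
    by (simp add: fun_eq_iff vec_eq_iff forall_2)
  ultimately show ?thesis
    by (rule ssubst[rotated])
qed

lemma C1_gradient_imp_H1_trace:
  assumes u: "C1_gradient u p"
  shows "H1_trace u p (\<lambda>t. u (circle_point t))"
  unfolding H1_trace_def H1_def
proof (intro conjI exI)
  have "continuous_on UNIV (\<lambda>t. u (circle_point t))"
    using continuous_on_compose2[OF C1_gradient_continuous(1)[OF u] continuous_circle_point] by simp
  then show "(\<lambda>t. u (circle_point t)) \<in> L2 (lebesgue_on {0..2 * pi})"
    by (rule continuous_L2_period)
  show "\<forall>k::nat. C1_gradient u p" using u by simp
qed (use C1_gradient_L2[OF u] C1_gradient_imp_weak_gradient[OF u] in \<open>simp_all add: L2_norm_def\<close>)

section \<open>Polar coordinates in the unit disk\<close>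

text \<open>Rotations replace a change of variables in the plane: averaging an integral over the
  disk over all rotations produces angular means, which are radial.\<close>

definition rot :: "real \<Rightarrow> real^2 \<Rightarrow> real^2" where
  "rot a x = (\<chi> i. if i = 1 then cos a * x $ 1 - sin a * x $ 2 else sin a * x $ 1 + cos a * x $ 2)"

lemma rot_nth [simp]:
  "rot a x $ 1 = cos a * x $ 1 - sin a * x $ 2" "rot a x $ 2 = sin a * x $ 1 + cos a * x $ 2"
  by (simp_all add: rot_def)

lemma rot_rot: "rot a (rot b x) = rot (a + b) x"
  by (simp add: vec_eq_iff forall_2 cos_add sin_add algebra_simps)

lemma rot_0 [simp]: "rot 0 x = x"
  by (simp add: vec_eq_iff forall_2)

lemma norm_real2: "norm (x :: real^2) = sqrt ((x $ 1)\<^sup>2 + (x $ 2)\<^sup>2)"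
  by (simp add: norm_vec_def L2_set_def sum_2)

lemma norm_rot [simp]: "norm (rot a x) = norm x"
proof -
  have "(cos a * x $ 1 - sin a * x $ 2)\<^sup>2 + (sin a * x $ 1 + cos a * x $ 2)\<^sup>2
      = ((cos a)\<^sup>2 + (sin a)\<^sup>2) * ((x $ 1)\<^sup>2 + (x $ 2)\<^sup>2)"
    by algebra
  then show ?thesis by (simp add: norm_real2)
qed

lemma orthogonal_transformation_rot: "orthogonal_transformation (rot a)"
  unfolding orthogonal_transformation
  by (auto intro!: linearI simp: vec_eq_iff forall_2 algebra_simps)

lemma rot_circle_point: "rot a (r *\<^sub>R circle_point b) = r *\<^sub>R circle_point (a + b)"
  by (simp add: vec_eq_iff forall_2 cos_add sin_add algebra_simps)

lemma polar_decomposition: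
  fixes x :: "real^2"
  obtains b where "0 \<le> b" "b < 2*pi" "x = norm x *\<^sub>R circle_point b"
proof (cases "x = 0")
  case False
  then have n: "norm x > 0" by simp
  have "(x $ 1 / norm x)\<^sup>2 + (x $ 2 / norm x)\<^sup>2 = ((x $ 1)\<^sup>2 + (x $ 2)\<^sup>2) / (norm x)\<^sup>2"
    by (simp add: power_divide add_divide_distrib)
  also have "(x $ 1)\<^sup>2 + (x $ 2)\<^sup>2 = (norm x)\<^sup>2"
    by (simp add: norm_real2)
  also have "(norm x)\<^sup>2 / (norm x)\<^sup>2 = 1"
    using n by simp
  finally obtain b where "0 \<le> b" "b < 2*pi" "x $ 1 / norm x = cos b" "x $ 2 / norm x = sin b"
    by (metis sincos_total_2pi)
  then have "x $ 1 = norm x * cos b" "x $ 2 = norm x * sin b"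
    using n by (simp_all add: divide_eq_eq mult.commute)
  then have "x = norm x *\<^sub>R circle_point b"
    by (simp add: vec_eq_iff forall_2)
  then show ?thesis
    by (rule that[OF \<open>0 \<le> b\<close> \<open>b < 2*pi\<close>])
next
  case True
  show ?thesis by (rule that[of 0]) (simp_all add: True)
qed

lemma continuous_rot: "continuous_on UNIV (\<lambda>p. rot (fst p) (snd p))"
proof -
  have "continuous_on UNIV (\<lambda>p::real \<times> (real^2). if i = (1::2) then cos (fst p) * snd p $ 1 - sin (fst p) * snd p $ 2
      else sin (fst p) * snd p $ 1 + cos (fst p) * snd p $ 2)" for i
    by (cases "i = 1") (auto intro!: continuous_intros)
  then show ?thesis
    unfolding rot_def by (intro continuous_on_vec_lambda)
qed

lemma borel_measurable_rot: "rot a \<in> borel_measurable borel"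
proof -
  have "continuous_on UNIV (\<lambda>x::real^2. (a, x))"
    by (intro continuous_intros)
  from continuous_on_compose2[OF continuous_rot this] show ?thesis
    by (intro borel_measurable_continuous_onI) simp
qed

text \<open>Boxes suffice. The preimage of a box is its image under the inverse rotation, and
  orthogonal maps preserve volume.\<close>

lemma distr_lborel_rot: "distr lborel borel (rot a) = lborel"
proof (rule lborel_eqI[symmetric])
  fix l u :: "real^2"
  assume lu: "\<And>b. b \<in> Basis \<Longrightarrow> l \<bullet> b \<le> u \<bullet> b"
  note meas = borel_measurable_rot[of a]
  have vimage: "rot a -` box l u = rot (-a) ` box l u"
  proof (intro set_eqI iffI)
    fix x assume "x \<in> rot a -` box l u"
    then show "x \<in> rot (-a) ` box l u"
      by (intro image_eqI[of x _ "rot a x"]) (auto simp: rot_rot)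
  qed (auto simp: rot_rot)
  have lm: "rot (-a) ` box l u \<in> lmeasurable"
    by (intro measurable_linear_image) (auto simp: orthogonal_transformation_linear orthogonal_transformation_rot)
  have "emeasure (distr lborel borel (rot a)) (box l u) = emeasure lborel (rot a -` box l u)"
    using meas by (simp add: emeasure_distr)
  also have "\<dots> = emeasure lebesgue (rot (-a) ` box l u)"
    using meas measurable_sets[OF meas, of "box l u"] by (simp add: vimage)
  also have "\<dots> = ennreal (measure lebesgue (rot (-a) ` box l u))"
    using lm by (simp add: emeasure_eq_measure2 fmeasurableD2 emeasure_eq_ennreal_measure)
  also have "\<dots> = ennreal (measure lebesgue (box l u))"
    by (simp add: measure_orthogonal_image orthogonal_transformation_rot)
  also have "\<dots> = ennreal (prod ((\<bullet>) (u - l)) Basis)"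
    using lu by (simp add: measure_lborel_box inner_diff_left)
  finally show "emeasure (distr lborel borel (rot a)) (box l u) = ennreal (prod ((\<bullet>) (u - l)) Basis)" .
qed simp

lemma integral_lborel_rot:
  fixes f :: "real^2 \<Rightarrow> 'b::euclidean_space"
  assumes "f \<in> borel_measurable borel"
  shows "(\<integral>x. f (rot a x) \<partial>lborel) = (\<integral>x. f x \<partial>lborel)"
proof -
  note meas = borel_measurable_rot[of a]
  show ?thesis
    using integral_distr[of "rot a" lborel borel f] meas assms by (simp add: distr_lborel_rot)
qed

text \<open>Comparison on half-lines: for a in [0,1] the points of the disk with norm beyond a form
  an annulus of area pi - pi a^2, which is the integral of 2 pi r from a to 1.\<close>

lemma distr_norm_unit_disk:
  "distr (restrict_space lborel (ball (0::real^2) 1)) borel norm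
    = density lborel (\<lambda>r. ennreal (2 * pi * r) * indicator {0..1} r)" (is "?M = ?N")
proof (rule measure_eqI_lessThan)
  have ball_vol: "emeasure lborel (ball (0::real^2) 1) = ennreal pi"
    using emeasure_ball[of 1 "0::real^2"] by (simp add: unit_ball_vol_2)
  have M: "emeasure ?M {a<..} = emeasure lborel {x \<in> ball (0::real^2) 1. a < norm x}" for a
    by (subst emeasure_distr) (auto simp: space_restrict_space emeasure_restrict_space measurable_restrict_space1
        intro!: arg_cong[where f="emeasure lborel"])
  have ge: "emeasure ?M {a<..} = ennreal (pi - pi * a\<^sup>2)" if "0 \<le> a" "a \<le> 1" for a
  proof (cases "a = 1")
    case True
    then have empty: "{x \<in> ball (0::real^2) 1. a < norm x} = {}" by auto
    show ?thesis unfolding M empty using True by simp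
  next
    case False
    then have a1: "a < 1" using that by simp
    have eq: "{x \<in> ball (0::real^2) 1. a < norm x} = ball 0 1 - cball 0 a"
      by (simp add: set_eq_iff not_le)
    have sub: "cball 0 a \<subseteq> ball (0::real^2) 1"
      using a1 by (simp add: subset_iff)
    have cball_vol: "emeasure lborel (cball (0::real^2) a) = ennreal (pi * a\<^sup>2)"
      using emeasure_cball[of a "0::real^2"] that by (simp add: unit_ball_vol_2)
    have "emeasure lborel (ball (0::real^2) 1 - cball 0 a) = emeasure lborel (ball (0::real^2) 1) - emeasure lborel (cball (0::real^2) a)"
      by (rule emeasure_Diff) (simp_all add: sub cball_vol)
    then show ?thesis
      unfolding M eq ball_vol cball_vol by (simp add: ennreal_minus)
  qed
  have N: "emeasure ?N {a<..} = (\<integral>\<^sup>+r. ennreal (2 * pi * r) * indicator {max a 0..1} r \<partial>lborel)" for a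
  proof -
    have "emeasure ?N {a<..} = (\<integral>\<^sup>+r. ennreal (2 * pi * r) * indicator {0..1} r * indicator {a<..} r \<partial>lborel)"
      by (simp add: emeasure_density)
    also have "\<dots> = (\<integral>\<^sup>+r. ennreal (2 * pi * r) * indicator {max a 0..1} r \<partial>lborel)"
      by (rule nn_integral_cong_AE) (use AE_lborel_singleton[of a] in \<open>eventually_elim, auto simp: indicator_def\<close>)
    finally show ?thesis .
  qed
  have N': "emeasure ?N {a<..} = ennreal (pi - pi * (max a 0)\<^sup>2)" if "a \<le> 1" for a
    unfolding N using that
    by (subst nn_integral_FTC_Icc[where F="\<lambda>r. pi * r\<^sup>2"])
       (auto intro!: derivative_eq_intros simp: ennreal_mult power2_eq_square)
  show eq: "emeasure ?M {a<..} = emeasure ?N {a<..}" for a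
  proof -
    consider "a < 0" | "0 \<le> a" "a \<le> 1" | "1 < a" by linarith
    then show ?thesis
    proof cases
      case 1
      then have eq: "{x \<in> ball (0::real^2) 1. a < norm x} = ball 0 1"
        by (auto intro: less_le_trans)
      show ?thesis unfolding M eq using 1 ball_vol N'[of a] by simp
    next
      case 2
      then show ?thesis using ge N'[of a] by simp
    next
      case 3
      then have empty: "{x \<in> ball (0::real^2) 1. a < norm x} = {}" "{max a 0..1} = {}" by auto
      show ?thesis unfolding M N empty by simp
    qed
  qed
  show "emeasure ?M {a<..} < \<infinity>" for a
  proof -
    have "emeasure ?M {a<..} \<le> emeasure lborel (ball (0::real^2) 1)"
      unfolding M by (intro emeasure_mono) auto
    then show ?thesis using ball_vol by (simp add: le_less_trans)
  qed
qed auto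

lemma integral_radial:
  fixes h :: "real \<Rightarrow> complex"
  assumes [measurable]: "h \<in> borel_measurable borel"
  shows "(\<integral>x. h (norm x) \<partial>restrict_space lborel (ball (0::real^2) 1))
    = 2 * pi * (\<integral>r. indicator {0..1} r *\<^sub>R (r * h r) \<partial>lborel)"
proof -
  have "(\<integral>x. h (norm x) \<partial>restrict_space lborel (ball (0::real^2) 1)) = (\<integral>r. h r \<partial>distr (restrict_space lborel (ball (0::real^2) 1)) borel norm)"
    by (subst integral_distr) (auto simp: measurable_restrict_space1)
  also have "\<dots> = (\<integral>r. h r \<partial>density lborel (\<lambda>r. ennreal (2 * pi * r * indicator {0..1} r)))"
    unfolding distr_norm_unit_disk
    by (intro arg_cong2[where f=lebesgue_integral] arg_cong2[where f=density]) (auto simp: fun_eq_iff indicator_def)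
  also have "\<dots> = (\<integral>r. (2 * pi * r * indicator {0..1} r) *\<^sub>R h r \<partial>lborel)"
    by (rule integral_density) (auto simp: indicator_def)
  also have "\<dots> = (\<integral>r. 2 * pi * (indicator {0..1} r *\<^sub>R (r * h r)) \<partial>lborel)"
    by (rule Bochner_Integration.integral_cong) (auto simp: scaleR_conv_of_real)
  also have "\<dots> = 2 * pi * (\<integral>r. indicator {0..1} r *\<^sub>R (r * h r) \<partial>lborel)"
    by (rule integral_mult_right_zero)
  finally show ?thesis .
qed

text \<open>The window from a to a + c is cut at c, and the piece beyond c is moved back by one
  period.\<close>

lemma integral_periodic_shift:
  fixes G :: "real \<Rightarrow> complex"
  assumes [measurable]: "G \<in> borel_measurable borel" and per: "\<And>t. G (t + c) = G t"
    and bnd: "\<And>t. norm (G t) \<le> B" and a: "0 \<le> a" "a < c"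
  shows "(\<integral>t. indicator {0..<c} t *\<^sub>R G (t + a) \<partial>lborel) = (\<integral>t. indicator {0..<c} t *\<^sub>R G t \<partial>lborel)"
proof -
  have int: "integrable lborel (\<lambda>t. indicator {l..<u} t *\<^sub>R G t)" for l u
  proof (rule Bochner_Integration.integrable_bound)
    show "integrable lborel (\<lambda>t. B * indicator {l..<u} t)"
      by (intro integrable_mult_right integrable_real_indicator) (cases "l \<le> u"; auto)+
    have "norm (G t) \<le> \<bar>B\<bar>" for t
      using bnd[of t] by linarith
    then show "AE t in lborel. norm (indicator {l..<u} t *\<^sub>R G t) \<le> norm (B * indicator {l..<u} t)"
      by (intro AE_I2) (simp add: indicator_def)
  qed simp
  have "(\<integral>t. indicator {0..<c} t *\<^sub>R G (t + a) \<partial>lborel) = (\<integral>t. indicator {a..<a+c} (a + 1 * t) *\<^sub>R G (a + 1 * t) \<partial>lborel)"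
    by (rule Bochner_Integration.integral_cong) (auto simp: indicator_def add.commute)
  also have "\<dots> = (\<integral>t. indicator {a..<a+c} t *\<^sub>R G t \<partial>lborel)"
    using lborel_integral_real_affine[of 1 "\<lambda>t. indicator {a..<a+c} t *\<^sub>R G t" a] by simp
  also have "\<dots> = (\<integral>t. indicator {a..<c} t *\<^sub>R G t + indicator {c..<a+c} t *\<^sub>R G t \<partial>lborel)"
    by (rule Bochner_Integration.integral_cong) (use a in \<open>auto simp: indicator_def\<close>)
  also have "\<dots> = (\<integral>t. indicator {a..<c} t *\<^sub>R G t \<partial>lborel) + (\<integral>t. indicator {c..<a+c} t *\<^sub>R G t \<partial>lborel)"
    by (intro Bochner_Integration.integral_add int)
  also have "(\<integral>t. indicator {c..<a+c} t *\<^sub>R G t \<partial>lborel) = (\<integral>t. indicator {c..<a+c} (c + 1 * t) *\<^sub>R G (c + 1 * t) \<partial>lborel)"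
    using lborel_integral_real_affine[of 1 "\<lambda>t. indicator {c..<a+c} t *\<^sub>R G t" c] by simp
  also have "\<dots> = (\<integral>t. indicator {0..<a} t *\<^sub>R G t \<partial>lborel)"
    by (rule Bochner_Integration.integral_cong) (use per in \<open>auto simp: indicator_def add.commute\<close>)
  also have "(\<integral>t. indicator {a..<c} t *\<^sub>R G t \<partial>lborel) + (\<integral>t. indicator {0..<a} t *\<^sub>R G t \<partial>lborel)
      = (\<integral>t. indicator {a..<c} t *\<^sub>R G t + indicator {0..<a} t *\<^sub>R G t \<partial>lborel)"
    by (intro Bochner_Integration.integral_add[symmetric] int)
  also have "\<dots> = (\<integral>t. indicator {0..<c} t *\<^sub>R G t \<partial>lborel)"
    by (rule Bochner_Integration.integral_cong) (use a in \<open>auto simp: indicator_def\<close>)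
  finally show ?thesis .
qed

text \<open>A rotation leaves the integral over the disk unchanged, so the integral equals its mean
  over all rotations. By Fubini it is then the integral of the angular mean, a function of the norm
  alone, to which the distribution of the norm applies.\<close>

lemma integral_disk_polar:
  fixes f :: "real^2 \<Rightarrow> complex"
  assumes [measurable]: "f \<in> borel_measurable borel" and bnd: "\<And>x. norm x \<le> 1 \<Longrightarrow> norm (f x) \<le> B"
  shows "(\<integral>x. f x \<partial>lebesgue_on Omega) =
      (\<integral>r. r * (\<integral>t. f (r *\<^sub>R circle_point t) \<partial>lebesgue_on {0..2*pi}) \<partial>lebesgue_on {0..1})" (is ?eq)
    and "integrable (lebesgue_on {0..1}) (\<lambda>r. r * (\<integral>t. f (r *\<^sub>R circle_point t) \<partial>lebesgue_on {0..2*pi}))" (is ?int)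
proof -
  \<comment> \<open>The bound on \<open>f\<close> holds on the closed disk only; the cut-off makes
    it global.\<close>
  define g where "g x = indicator (cball 0 1) x *\<^sub>R f x" for x
  have g[measurable]: "g \<in> borel_measurable borel"
    unfolding g_def by (intro borel_measurable_scaleR borel_measurable_indicator assms(1)) simp
  have g_bnd: "norm (g x) \<le> \<bar>B\<bar>" for x
    using bnd[of x] by (cases "norm x \<le> 1") (auto simp: g_def)
  define T where "T = restrict_space lborel {0..<2*pi}"
  define N where "N = restrict_space lborel (ball (0::real^2) 1)"
  have fin: "finite_measure T" "finite_measure N"
    unfolding T_def N_def
    using emeasure_lborel_ball_finite[of "0::real^2" 1]
    by (auto intro!: finite_measureI simp: emeasure_restrict_space space_restrict_space)
  interpret T: finite_measure T by fact
  interpret N: finite_measure N by fact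
  interpret TN: pair_sigma_finite T N ..
  have TN_fin: "finite_measure (T \<Otimes>\<^sub>M N)"
    by (rule finite_measure_pair_measure) (fact fin)+
  interpret TN': finite_measure "T \<Otimes>\<^sub>M N" by fact
  have [measurable]: "fst \<in> borel_measurable (T \<Otimes>\<^sub>M N)" "snd \<in> borel_measurable (T \<Otimes>\<^sub>M N)"
    unfolding T_def N_def
    by (rule measurable_compose[OF measurable_fst], simp add: measurable_restrict_space1)
       (rule measurable_compose[OF measurable_snd], simp add: measurable_restrict_space1)
  have rot_meas: "(\<lambda>p. rot (fst p) (snd p)) \<in> borel_measurable (T \<Otimes>\<^sub>M N)"
    by (rule borel_measurable_continuous_Pair[where H="rot" and f=fst and g=snd])
       (use continuous_rot in \<open>auto simp: case_prod_unfold\<close>)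
  have "(\<lambda>p. g (rot (fst p) (snd p))) \<in> borel_measurable (T \<Otimes>\<^sub>M N)"
    by (rule measurable_compose[OF rot_meas g])
  then have int: "integrable (T \<Otimes>\<^sub>M N) (\<lambda>(t, x). g (rot t x))"
    by (intro TN'.integrable_const_bound[where B="\<bar>B\<bar>"]) (use g_bnd in \<open>auto simp: case_prod_unfold\<close>)
  define h where "h r = (\<integral>t. g (r *\<^sub>R circle_point t) \<partial>T)" for r
  have polar_cont: "continuous_on UNIV (\<lambda>p. fst p *\<^sub>R circle_point (snd p))"
    by (intro continuous_intros continuous_on_compose2[OF continuous_circle_point]) auto
  have [measurable]: "(\<lambda>p. snd p) \<in> borel_measurable (borel \<Otimes>\<^sub>M T)"
    unfolding T_def
    by (rule measurable_compose[OF measurable_snd]) (simp add: measurable_restrict_space1)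
  have polar_meas: "(\<lambda>p. fst p *\<^sub>R circle_point (snd p)) \<in> borel_measurable (borel \<Otimes>\<^sub>M T)"
    by (rule borel_measurable_continuous_Pair[where H="\<lambda>r t. r *\<^sub>R circle_point t" and f=fst and g=snd])
       (use polar_cont in \<open>auto simp: case_prod_unfold\<close>)
  have h_meas: "h \<in> borel_measurable borel"
    unfolding h_def
    by (rule T.borel_measurable_lebesgue_integral)
       (use measurable_compose[OF polar_meas g] in \<open>simp add: case_prod_unfold\<close>)
  have circ_meas: "(\<lambda>t. r *\<^sub>R circle_point t) \<in> borel_measurable borel" for r
    by (intro borel_measurable_continuous_onI continuous_intros continuous_circle_point)
  \<comment> \<open>The angle of \<open>x\<close> only shifts the angular variable, and periodicity
    absorbs the shift.\<close>
  have inner_T: "(\<integral>t. g (rot t x) \<partial>T) = h (norm x)" for x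
  proof -
    obtain b where b: "0 \<le> b" "b < 2*pi" "x = norm x *\<^sub>R circle_point b"
      by (rule polar_decomposition)
    have circ: "(\<lambda>t. g (norm x *\<^sub>R circle_point t)) \<in> borel_measurable borel"
      by (rule measurable_compose[OF circ_meas g])
    have "(\<integral>t. g (rot t x) \<partial>T) = (\<integral>t. g (norm x *\<^sub>R circle_point (t + b)) \<partial>T)"
      by (subst (1) b(3)) (simp add: rot_circle_point)
    also have "\<dots> = h (norm x)"
      unfolding h_def T_def
      using integral_periodic_shift[where G="\<lambda>t. g (norm x *\<^sub>R circle_point t)" and c="2*pi" and a=b, OF circ _ g_bnd b(1,2)]
      by (simp add: integral_restrict_space circle_point_def)
    finally show ?thesis .
  qed
  have inner_N: "(\<integral>x. g (rot t x) \<partial>N) = (\<integral>x. f x \<partial>lebesgue_on Omega)" for t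
  proof -
    have "(\<integral>x. g (rot t x) \<partial>N) = (\<integral>x. indicator Omega x *\<^sub>R g (rot t x) \<partial>lborel)"
      by (simp add: N_def integral_restrict_space Omega_def)
    also have "\<dots> = (\<integral>x. indicator Omega (rot t x) *\<^sub>R f (rot t x) \<partial>lborel)"
      by (rule Bochner_Integration.integral_cong) (auto simp: g_def indicator_def Omega_def)
    also have "\<dots> = (\<integral>x. indicator Omega x *\<^sub>R f x \<partial>lborel)"
      by (rule integral_lborel_rot[where f="\<lambda>x. indicator Omega x *\<^sub>R f x"]) measurable
    also have "\<dots> = (\<integral>x. indicator Omega x *\<^sub>R f x \<partial>lebesgue)"
      by (rule integral_completion[symmetric]) simp
    also have "\<dots> = (\<integral>x. f x \<partial>lebesgue_on Omega)"
      by (simp add: integral_restrict_space)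
    finally show ?thesis .
  qed
  \<comment> \<open>The factor on the left is the length of the angular interval; the same factor
    comes back on the right from the density of the norm, and the two cancel.\<close>
  have "2 * pi * (\<integral>x. f x \<partial>lebesgue_on Omega) = (\<integral>t. (\<integral>x. g (rot t x) \<partial>N) \<partial>T)"
    unfolding inner_N by (simp add: T_def measure_restrict_space space_restrict_space scaleR_conv_of_real)
  also have "\<dots> = (\<integral>x. (\<integral>t. g (rot t x) \<partial>T) \<partial>N)"
    by (rule TN.Fubini_integral[OF int, symmetric])
  also have "\<dots> = (\<integral>x. h (norm x) \<partial>N)"
    unfolding inner_T ..
  also have "\<dots> = 2 * pi * (\<integral>r. indicator {0..1} r *\<^sub>R (r * h r) \<partial>lborel)"
    unfolding N_def by (rule integral_radial[OF h_meas])
  finally have "(\<integral>x. f x \<partial>lebesgue_on Omega) = (\<integral>r. indicator {0..1} r *\<^sub>R (r * h r) \<partial>lborel)"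
    by simp
  also have "\<dots> = (\<integral>r. r * h r \<partial>lebesgue_on {0..1})"
    using h_meas by (subst integral_completion[symmetric]) (simp_all add: integral_restrict_space)
  finally have integral_h: "(\<integral>x. f x \<partial>lebesgue_on Omega) = (\<integral>r. r * h r \<partial>lebesgue_on {0..1})" .
  have h_eq: "h r = (\<integral>t. f (r *\<^sub>R circle_point t) \<partial>lebesgue_on {0..2*pi})" if r: "0 \<le> r" "r \<le> 1" for r
  proof -
    have norm_circle: "norm (circle_point t) = 1" for t
      by (simp add: norm_real2)
    have [measurable]: "(\<lambda>t. f (r *\<^sub>R circle_point t)) \<in> borel_measurable borel"
      by (rule measurable_compose[OF circ_meas]) measurable
    have "h r = (\<integral>t. indicator {0..<2*pi} t *\<^sub>R f (r *\<^sub>R circle_point t) \<partial>lborel)"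
      using r by (simp add: h_def T_def g_def integral_restrict_space norm_circle)
    also have "\<dots> = (\<integral>t. indicator {0..2*pi} t *\<^sub>R f (r *\<^sub>R circle_point t) \<partial>lborel)"
      by (rule integral_cong_AE)
         (use AE_lborel_singleton[of "2*pi"] in \<open>simp_all, eventually_elim, auto simp: indicator_def\<close>)
    also have "\<dots> = (\<integral>t. f (r *\<^sub>R circle_point t) \<partial>lebesgue_on {0..2*pi})"
      by (subst integral_completion[symmetric]) (simp_all add: integral_restrict_space)
    finally show ?thesis .
  qed
  show ?eq
    unfolding integral_h by (intro Bochner_Integration.integral_cong) (simp_all add: h_eq)
  have "norm (h r) \<le> 2 * pi * \<bar>B\<bar>" for r
  proof -
    have "norm (h r) \<le> (\<integral>t. \<bar>B\<bar> \<partial>T)"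
      unfolding h_def
      by (rule order_trans[OF integral_norm_bound], rule integral_mono') (simp_all add: g_bnd)
    also have "\<dots> = 2 * pi * \<bar>B\<bar>"
      by (simp add: T_def measure_restrict_space space_restrict_space)
    finally show ?thesis .
  qed
  then have bnd_h: "norm (r * h r) \<le> 2 * pi * \<bar>B\<bar>" if "0 \<le> r" "r \<le> 1" for r
    using mult_mono[of "\<bar>r\<bar>" 1 "norm (h r)" "2 * pi * \<bar>B\<bar>"] that by (simp add: norm_mult)
  interpret I: finite_measure "lebesgue_on {0..1::real}"
    by (rule finite_measure_lebesgue_on) simp
  have "integrable (lebesgue_on {0..1}) (\<lambda>r. r * h r)"
    by (rule I.integrable_const_bound[where B="2 * pi * \<bar>B\<bar>"])
       (use bnd_h h_meas in \<open>auto intro!: AE_I2 borel_measurable_lebesgue_onI\<close>)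
  moreover have "integrable (lebesgue_on {0..1}) (\<lambda>r. r * h r) \<longleftrightarrow> ?int"
    by (rule Bochner_Integration.integrable_cong) (simp_all add: h_eq)
  ultimately show ?int by simp
qed

section \<open>Radial profiles\<close>

text \<open>For \<gamma> > 0 these are the coefficients, in powers of s = r^2, of the Bessel
  function J_m(sqrt(\<gamma>) r) divided by its leading term (sqrt(\<gamma>) r / 2)^m / m!.\<close>

definition bessel_coeff :: "real \<Rightarrow> nat \<Rightarrow> nat \<Rightarrow> real" where
  "bessel_coeff \<gamma> m k = (- \<gamma> / 4) ^ k / (fact k * pochhammer (real m + 1) k)"

lemma pochhammer_ge_1: "1 \<le> pochhammer (real m + 1) k"
proof (induction k)
  case (Suc k)
  have "1 * 1 \<le> pochhammer (real m + 1) k * (real m + 1 + real k)"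
    using Suc by (intro mult_mono) auto
  then show ?case by (simp add: pochhammer_Suc)
qed simp

text \<open>Pochhammer symbols are at least 1, so the bound is free of the order \<open>m\<close>.
  All later uniformity in the Fourier index starts here.\<close>

lemma abs_bessel_coeff_le:
  assumes "\<gamma> \<in> {0..1}"
  shows "\<bar>bessel_coeff \<gamma> m k\<bar> \<le> (1/4) ^ k / fact k"
proof -
  have p: "1 \<le> pochhammer (real m + 1) k" by (rule pochhammer_ge_1)
  then have "\<bar>bessel_coeff \<gamma> m k\<bar> = (\<gamma> / 4) ^ k / (fact k * pochhammer (real m + 1) k)"
    using assms by (simp add: bessel_coeff_def abs_mult power_abs)
  also have "\<dots> \<le> (1/4) ^ k / (fact k * 1)"
    using assms p by (intro frac_le power_mono mult_mono) auto
  finally show ?thesis by simp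
qed

text \<open>This recurrence is the equation s G'' + (m+1) G' = -(\<gamma>/4) G read off coefficient
  by coefficient.\<close>

lemma bessel_coeff_Suc:
  "real (Suc k) * (real m + 1 + real k) * bessel_coeff \<gamma> m (Suc k) = - (\<gamma> / 4) * bessel_coeff \<gamma> m k"
proof -
  have "pochhammer (real m + 1) k \<noteq> 0" "real m + 1 + real k \<noteq> 0" "real (Suc k) \<noteq> 0"
    using pochhammer_ge_1[of m k] by linarith+
  then show ?thesis
    unfolding bessel_coeff_def pochhammer_Suc fact_Suc power_Suc
    by (simp add: divide_simps del: of_nat_Suc)
qed

definition bessel_series :: "real \<Rightarrow> nat \<Rightarrow> real \<Rightarrow> real" where
  "bessel_series \<gamma> m s = (\<Sum>k. bessel_coeff \<gamma> m k * s ^ k)"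

definition bessel_series' :: "real \<Rightarrow> nat \<Rightarrow> real \<Rightarrow> real" where
  "bessel_series' \<gamma> m s = (\<Sum>k. diffs (bessel_coeff \<gamma> m) k * s ^ k)"

context
  fixes \<gamma> :: real and m :: nat
  assumes \<gamma>: "\<gamma> \<in> {0..1}"
begin

lemma summable_bessel: "summable (\<lambda>k. bessel_coeff \<gamma> m k * s ^ k)"
proof (rule summable_comparison_test[OF _ summable_exp_generic[of "\<bar>s\<bar> / 4"]])
  have "norm (bessel_coeff \<gamma> m k * s ^ k) \<le> (\<bar>s\<bar> / 4) ^ k /\<^sub>R fact k" for k
    using mult_right_mono[OF abs_bessel_coeff_le[OF \<gamma>, of m k], of "\<bar>s\<bar> ^ k"]
    by (simp add: abs_mult power_abs power_divide field_simps)
  then show "\<exists>N. \<forall>k\<ge>N. norm (bessel_coeff \<gamma> m k * s ^ k) \<le> (\<bar>s\<bar> / 4) ^ k /\<^sub>R fact k"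
    by blast
qed

lemma summable_bessel': "summable (\<lambda>k. diffs (bessel_coeff \<gamma> m) k * s ^ k)"
  by (rule termdiff_converges_all) (rule summable_bessel)

lemma DERIV_bessel_series: "(bessel_series \<gamma> m has_real_derivative bessel_series' \<gamma> m s) (at s)"
  unfolding bessel_series_def bessel_series'_def
  by (rule termdiffs_strong_converges_everywhere) (rule summable_bessel)

text \<open>For u = z^m G(|z|^2) and s = |z|^2 the Laplacian is 4 z^m (s G'' + (m+1) G'). Multiplied
  by s^m, the bracket is the derivative of s^(m+1) G'. So this is \<Delta>u + \<gamma>u = 0 in
  divergence form, which is the form suited to a jump of the potential.\<close>

lemma DERIV_bessel_series':
  "((\<lambda>s. s ^ Suc m * bessel_series' \<gamma> m s) has_real_derivative - (\<gamma> / 4) * (s ^ m * bessel_series \<gamma> m s)) (at s)"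
proof -
  let ?c = "bessel_coeff \<gamma> m"
  let ?S = "\<Sum>k. diffs (diffs ?c) k * s ^ k"
  have D: "(bessel_series' \<gamma> m has_real_derivative ?S) (at s)"
    unfolding bessel_series'_def
    by (rule termdiffs_strong_converges_everywhere) (rule summable_bessel')
  have "(\<lambda>k. real k * diffs ?c k * s ^ (k - Suc 0)) sums ?S"
    by (rule diffs_equiv, rule termdiff_converges_all) (rule summable_bessel')
  \<comment> \<open>The factor \<open>s\<close> lifts the exponent k - 1 back to k. The term k = 0
    carries the factor 0, so the truncated subtraction is harmless there.\<close>
  from sums_mult2[OF this, of s]
  have "(\<lambda>k. real k * diffs ?c k * s ^ k) sums (?S * s)"
    by (rule sums_cong[THEN iffD1, rotated]) (auto simp: power_eq_if)
  moreover have "(\<lambda>k. (real m + 1) * (diffs ?c k * s ^ k)) sums ((real m + 1) * bessel_series' \<gamma> m s)"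
    unfolding bessel_series'_def by (intro sums_mult summable_sums summable_bessel')
  ultimately have "(\<lambda>k. real k * diffs ?c k * s ^ k + (real m + 1) * (diffs ?c k * s ^ k)) sums
      (?S * s + (real m + 1) * bessel_series' \<gamma> m s)"
    by (rule sums_add)
  also have "(\<lambda>k. real k * diffs ?c k * s ^ k + (real m + 1) * (diffs ?c k * s ^ k)) = (\<lambda>k. - (\<gamma> / 4) * (?c k * s ^ k))"
  proof
    fix k
    show "real k * diffs ?c k * s ^ k + (real m + 1) * (diffs ?c k * s ^ k) = - (\<gamma> / 4) * (?c k * s ^ k)"
      using arg_cong[OF bessel_coeff_Suc[of k m \<gamma>], of "\<lambda>x. x * s ^ k"]
      by (simp add: diffs_def algebra_simps)
  qed
  finally have "?S * s + (real m + 1) * bessel_series' \<gamma> m s = - (\<gamma> / 4) * bessel_series \<gamma> m s"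
    unfolding bessel_series_def
    by (rule sums_unique2) (intro sums_mult summable_sums summable_bessel)
  then have "s ^ m * ((real m + 1) * bessel_series' \<gamma> m s + s * ?S) = - (\<gamma> / 4) * (s ^ m * bessel_series \<gamma> m s)"
    by (simp add: algebra_simps)
  moreover have "((\<lambda>s. s ^ Suc m * bessel_series' \<gamma> m s) has_real_derivative
      s ^ m * ((real m + 1) * bessel_series' \<gamma> m s + s * ?S)) (at s)"
    by (rule DERIV_cong[OF DERIV_mult[OF DERIV_pow D]]) (simp add: algebra_simps)
  ultimately show ?thesis by simp
qed

text \<open>The factor k + 1 from differentiation cancels in the factorial, leaving coefficients of
  size at most (1/4)^(k+1); the geometric series sums to 1/3.\<close>

lemma abs_bessel_series'_le:
  assumes "\<bar>s\<bar> \<le> 1"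
  shows "\<bar>bessel_series' \<gamma> m s\<bar> \<le> 1/3"
proof -
  have le: "norm (diffs (bessel_coeff \<gamma> m) k * s ^ k) \<le> 1/4 * (1/4) ^ k" for k
  proof -
    have "\<bar>diffs (bessel_coeff \<gamma> m) k\<bar> = real (Suc k) * \<bar>bessel_coeff \<gamma> m (Suc k)\<bar>"
      by (simp add: diffs_def abs_mult)
    also have "\<dots> \<le> real (Suc k) * ((1/4) ^ Suc k / fact (Suc k))"
      by (intro mult_left_mono abs_bessel_coeff_le \<gamma>) simp
    also have "\<dots> = (1/4) ^ Suc k / fact k"
      by (simp add: field_simps del: of_nat_Suc)
    also have "\<dots> \<le> (1/4) ^ Suc k / 1"
      by (intro divide_left_mono) (auto simp: fact_ge_1)
    finally have 1: "\<bar>diffs (bessel_coeff \<gamma> m) k\<bar> \<le> 1/4 * (1/4) ^ k" by simp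
    have "\<bar>diffs (bessel_coeff \<gamma> m) k\<bar> * \<bar>s\<bar> ^ k \<le> (1/4 * (1/4) ^ k) * 1"
      by (intro mult_mono 1 power_le_one) (use assms in auto)
    then show ?thesis by (simp add: abs_mult power_abs)
  qed
  have sum: "(\<lambda>k. 1/4 * (1/4) ^ k :: real) sums (1/3)"
    using sums_mult[OF geometric_sums[of "1/4::real"], of "1/4"] by simp
  have "norm (bessel_series' \<gamma> m s) \<le> (\<Sum>k. 1/4 * (1/4) ^ k)"
    unfolding bessel_series'_def
    by (rule norm_suminf_le[OF le]) (use sum in \<open>auto simp: sums_iff\<close>)
  then show ?thesis using sum by (simp add: sums_iff)
qed

end

text \<open>Outside the support the equation says that s^(m+1) D is constant, so the derivative
  continues as a multiple of s^-(m+1), and continuity at b^2 fixes the multiple. Taking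
  \<open>G\<close> as a primitive of \<open>D\<close> makes both sides match to first order
  automatically. The last step normalises by \<open>G 1\<close>.\<close>

lemma radial_profile_exists:
  fixes \<gamma> b :: real and m :: nat
  assumes \<gamma>: "\<gamma> \<in> {0..1}" and b: "0 < b" "b < 1"
  obtains G D :: "real \<Rightarrow> real"
  where "\<And>s. 0 \<le> s \<Longrightarrow> (G has_real_derivative D s) (at s)"
    and "continuous_on UNIV D"
    and "\<And>s. 0 < s \<Longrightarrow> s \<noteq> b\<^sup>2 \<Longrightarrow> ((\<lambda>s. s ^ Suc m * D s) has_real_derivative
           (if s < b\<^sup>2 then - (\<gamma> / 4) * (s ^ m * G s) else 0)) (at s)"
    and "G 1 = 1" and "\<And>s. 0 \<le> s \<Longrightarrow> s \<le> 1 \<Longrightarrow> \<bar>G s\<bar> \<le> 2 \<and> \<bar>D s\<bar> \<le> 1"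
proof -
  define B where "B = b\<^sup>2"
  have B: "0 < B" "B < 1"
    using b by (auto simp: B_def power_less_one_iff)
  let ?J = "bessel_series \<gamma> m" and ?J' = "bessel_series' \<gamma> m"
  define D where "D s = (if s \<le> B then ?J' s else ?J' B * (B / s) ^ Suc m)" for s
  \<comment> \<open>The primitive starts at -1 so that s = 0 is an interior point and the derivative
    there is two-sided. The constant \<open>?J (-1)\<close> makes \<open>G\<close> agree with the
    series up to \<open>B\<close>.\<close>
  define G where "G s = ?J (-1) + integral {-1..s} D" for s
  have J_cont: "continuous_on A ?J'" for A
  proof -
    have "isCont ?J' s" for s
      unfolding bessel_series'_def
      by (rule DERIV_isCont, rule termdiffs_strong_converges_everywhere) (rule summable_bessel'[OF \<gamma>])
    then show ?thesis by (simp add: continuous_at_imp_continuous_on)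
  qed
  have D_cont: "continuous_on UNIV D"
  proof -
    have "continuous_on ({..B} \<union> {B..}) D"
      unfolding D_def
      by (rule continuous_on_If) (use B in \<open>auto intro!: continuous_intros J_cont\<close>)
    moreover have "{..B} \<union> {B..} = UNIV" by auto
    ultimately show ?thesis by simp
  qed
  have G_deriv: "(G has_real_derivative D s) (at s)" if "0 \<le> s" for s
  proof -
    have "((\<lambda>x. integral {-1..x} D) has_real_derivative D s) (at s within {-1..s+1})"
      by (rule integral_has_real_derivative) (use that D_cont continuous_on_subset in auto)
    then have "((\<lambda>x. integral {-1..x} D) has_real_derivative D s) (at s)"
      using that at_within_interior[of s "{-1..s+1}"] by simp
    then show ?thesis
      unfolding G_def by (auto intro!: derivative_eq_intros)
  qed
  have G_eq_J: "G s = ?J s" if "-1 \<le> s" "s \<le> B" for s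
  proof -
    have "(?J' has_integral (?J s - ?J (-1))) {-1..s}"
      by (rule fundamental_theorem_of_calculus)
         (use that DERIV_bessel_series[OF \<gamma>] in \<open>auto simp: has_real_derivative_iff_has_vector_derivative intro: has_vector_derivative_at_within\<close>)
    then have "(D has_integral (?J s - ?J (-1))) {-1..s}"
      by (rule has_integral_eq[rotated]) (use that in \<open>auto simp: D_def\<close>)
    then show ?thesis by (simp add: G_def integral_unique)
  qed
  have D_deriv: "((\<lambda>s. s ^ Suc m * D s) has_real_derivative
      (if s < B then - (\<gamma> / 4) * (s ^ m * G s) else 0)) (at s)" if "0 < s" "s \<noteq> B" for s
  proof (cases "s < B")
    case True
    have "((\<lambda>s. s ^ Suc m * D s) has_real_derivative - (\<gamma> / 4) * (s ^ m * ?J s)) (at s)"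
      by (rule has_field_derivative_transform_within_open[OF DERIV_bessel_series'[OF \<gamma>], of "{..<B}"])
         (use True in \<open>auto simp: D_def\<close>)
    then show ?thesis using True that by (simp add: G_eq_J)
  next
    case False
    have "((\<lambda>s. s ^ Suc m * D s) has_real_derivative 0) (at s)"
      by (rule has_field_derivative_transform_within_open[of "\<lambda>s. B ^ Suc m * ?J' B" _ _ "{B<..}"])
         (use False that B in \<open>auto simp: D_def power_divide\<close>)
    then show ?thesis using False by simp
  qed
  have D_bound: "\<bar>D s\<bar> \<le> 1/3" if "0 \<le> s" "s \<le> 1" for s
  proof (cases "s \<le> B")
    case True
    then show ?thesis using abs_bessel_series'_le[OF \<gamma>, of s m] that by (simp add: D_def)
  next
    case False
    have "\<bar>?J' B\<bar> * (B / s) ^ Suc m \<le> 1/3 * 1"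
      by (intro mult_mono power_le_one abs_bessel_series'_le[OF \<gamma>]) (use False B in auto)
    then show ?thesis using False B by (simp add: D_def abs_mult power_abs)
  qed
  have G_bound: "\<bar>G s - 1\<bar> \<le> 1/3" if "0 \<le> s" "s \<le> 1" for s
  proof -
    have "norm (G s - G 0) \<le> 1/3 * norm (s - 0)"
      by (rule field_differentiable_bound[where S="{0..1}"])
         (use that G_deriv D_bound in \<open>auto intro: has_field_derivative_at_within\<close>)
    moreover have "G 0 = 1"
      using B G_eq_J[of 0] powser_zero[of "bessel_coeff \<gamma> m"]
      by (simp add: bessel_series_def) (simp add: bessel_coeff_def)
    ultimately show ?thesis using that by simp
  qed
  have G1: "2/3 \<le> G 1" using G_bound[OF zero_le_one order_refl] by linarith
  show ?thesis
  proof (rule that[of "\<lambda>s. G s / G 1" "\<lambda>s. D s / G 1"])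
    show "((\<lambda>s. G s / G 1) has_real_derivative D s / G 1) (at s)" if "0 \<le> s" for s
      by (rule DERIV_cdivide) (rule G_deriv[OF that])
    show "continuous_on UNIV (\<lambda>s. D s / G 1)"
      using G1 by (intro continuous_intros D_cont) auto
    show "((\<lambda>s. s ^ Suc m * (D s / G 1)) has_real_derivative
        (if s < b\<^sup>2 then - (\<gamma> / 4) * (s ^ m * (G s / G 1)) else 0)) (at s)" if "0 < s" "s \<noteq> b\<^sup>2" for s
      using DERIV_cdivide[OF D_deriv[of s], of "G 1"] that unfolding B_def by (cases "s < b\<^sup>2") simp_all
    show "G 1 / G 1 = 1" using G1 by simp
    show "\<bar>G s / G 1\<bar> \<le> 2 \<and> \<bar>D s / G 1\<bar> \<le> 1" if "0 \<le> s" "s \<le> 1" for s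
    proof -
      \<comment> \<open>Here |G| is at most 4/3 and |D| at most 1/3, while \<open>G 1\<close> is at
        least 2/3.\<close>
      have "\<bar>G s\<bar> \<le> 2 * G 1" "\<bar>D s\<bar> \<le> 1 * G 1"
        using G_bound[OF that] D_bound[OF that] G1 by linarith+
      then show ?thesis using G1 by (simp add: divide_le_eq)
    qed
  qed
qed

section \<open>Separated solutions\<close>

text \<open>All that the rest of the argument uses of the Bessel profiles, one pair for each order
  \<open>m\<close>, in the variable s = r^2. The equation is required only off s = b^2, where the
  potential jumps.\<close>

locale disk_profile =
  fixes \<gamma> b :: real and G D :: "nat \<Rightarrow> real \<Rightarrow> real"
  assumes \<gamma>: "\<gamma> \<in> {0..1}" and b: "0 < b" "b < 1"
    and G_deriv: "\<And>m s. 0 \<le> s \<Longrightarrow> (G m has_real_derivative D m s) (at s)"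
    and D_cont: "\<And>m. continuous_on UNIV (D m)"
    and D_deriv: "\<And>m s. 0 < s \<Longrightarrow> s \<noteq> b\<^sup>2 \<Longrightarrow> ((\<lambda>s. s ^ Suc m * D m s) has_real_derivative
           (if s < b\<^sup>2 then - (\<gamma> / 4) * (s ^ m * G m s) else 0)) (at s)"
    and G_1: "\<And>m. G m 1 = 1"
    and G_bound: "\<And>m s. 0 \<le> s \<Longrightarrow> s \<le> 1 \<Longrightarrow> \<bar>G m s\<bar> \<le> 2"
    and D_bound: "\<And>m s. 0 \<le> s \<Longrightarrow> s \<le> 1 \<Longrightarrow> \<bar>D m s\<bar> \<le> 1"

lemma disk_profile_exists:
  assumes "\<gamma> \<in> {0..1}" "0 < b" "b < 1"
  shows "\<exists>G D. disk_profile \<gamma> b G D"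
proof -
  define P where "P m G D \<longleftrightarrow> (\<forall>s\<ge>0. (G has_real_derivative D s) (at s)) \<and> continuous_on UNIV D
      \<and> (\<forall>s>0. s \<noteq> b\<^sup>2 \<longrightarrow> ((\<lambda>s. s ^ Suc m * D s) has_real_derivative
           (if s < b\<^sup>2 then - (\<gamma> / 4) * (s ^ m * G s) else 0)) (at s))
      \<and> G 1 = 1 \<and> (\<forall>s. 0 \<le> s \<longrightarrow> s \<le> 1 \<longrightarrow> \<bar>G s\<bar> \<le> 2 \<and> \<bar>D s\<bar> \<le> 1)" for m G D
  have "\<exists>G D. P m G D" for m
    by (rule radial_profile_exists[OF assms, of m], rule exI, rule exI, unfold P_def, intro conjI allI impI)
       blast+
  then obtain G D where "\<And>m. P m (G m) (D m)"
    by metis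
  then have "disk_profile \<gamma> b G D"
    using assms unfolding disk_profile_def P_def by blast
  then show ?thesis by blast
qed

text \<open>The variable \<open>z\<close> for modes of nonnegative index, its conjugate for the others.\<close>

definition orientation :: "int \<Rightarrow> complex" where
  "orientation n = (if 0 \<le> n then \<i> else - \<i>)"

definition disk_var :: "int \<Rightarrow> real^2 \<Rightarrow> complex" where
  "disk_var n x = of_real (x $ 1) + orientation n * of_real (x $ 2)"

lemma orientation_mult [simp]: "orientation n * orientation n = -1"
  by (simp add: orientation_def)

lemma orientation_nat_abs: "orientation n * of_nat (nat \<bar>n\<bar>) = \<i> * of_int n"
  by (simp add: orientation_def)

lemma norm_orientation [simp]: "norm (orientation n) = 1"
  by (simp add: orientation_def)

lemma norm_disk_var [simp]: "norm (disk_var n x) = norm x"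
  by (simp add: disk_var_def orientation_def norm_real2 cmod_def)

lemma disk_var_circle: "disk_var n (r *\<^sub>R circle_point t) = of_real r * exp (orientation n * of_real t)"
proof (cases "0 \<le> n")
  case True
  then show ?thesis
    by (simp add: disk_var_def orientation_def exp_Euler cos_of_real sin_of_real algebra_simps)
next
  case False
  then show ?thesis
    by (simp add: disk_var_def orientation_def exp_minus_Euler cos_of_real sin_of_real algebra_simps)
qed

lemma exp_orientation_power:
  "exp (orientation n * of_real t) ^ nat \<bar>n\<bar> = fourier_mode n t"
proof -
  have "exp (orientation n * of_real t) ^ nat \<bar>n\<bar> = exp (of_nat (nat \<bar>n\<bar>) * (orientation n * of_real t))"
    by (rule exp_of_nat_mult[symmetric])
  also have "of_nat (nat \<bar>n\<bar>) * (orientation n * of_real t) = \<i> * of_int n * of_real t"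
    using orientation_nat_abs[of n] by (metis mult.assoc mult.commute)
  finally show ?thesis by (simp add: fourier_mode_def)
qed

context disk_profile
begin

text \<open>A power of a linear function times a function of |x|^2: this form is differentiable at
  the origin, where polar coordinates degenerate.\<close>

definition mode :: "int \<Rightarrow> real^2 \<Rightarrow> complex" where
  "mode n x = disk_var n x ^ nat \<bar>n\<bar> * of_real (G (nat \<bar>n\<bar>) ((norm x)\<^sup>2))"

text \<open>For n = 0 the exponent \<open>nat \<bar>n\<bar> - 1\<close> is truncated to 0, but the
  factor in front vanishes.\<close>

definition mode_grad :: "int \<Rightarrow> real^2 \<Rightarrow> complex^2" where
  "mode_grad n x = (\<chi> j. of_nat (nat \<bar>n\<bar>) * disk_var n x ^ (nat \<bar>n\<bar> - 1) * (if j = 1 then 1 else orientation n)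
        * of_real (G (nat \<bar>n\<bar>) ((norm x)\<^sup>2))
      + disk_var n x ^ nat \<bar>n\<bar> * of_real (2 * x $ j * D (nat \<bar>n\<bar>) ((norm x)\<^sup>2)))"

text \<open>The derivative of r^m G(r^2) at r = 1, where \<open>G\<close> has value 1.\<close>

definition eigenvalue :: "int \<Rightarrow> real" where
  "eigenvalue n = \<bar>of_int n\<bar> + 2 * D (nat \<bar>n\<bar>) 1"

lemma mode_circle: "mode n (circle_point t) = fourier_mode n t"
proof -
  have "norm (circle_point t) = 1"
    by (simp add: norm_real2)
  then show ?thesis
    using disk_var_circle[of n 1 t] by (simp add: mode_def G_1 exp_orientation_power)
qed

lemma mode_C1: "C1_gradient (mode n) (mode_grad n)"
  unfolding C1_gradient_def
proof (intro conjI allI)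
  fix x :: "real^2"
  let ?m = "nat \<bar>n\<bar>"
  have "linear (disk_var n)"
    by (rule linearI) (simp_all add: disk_var_def algebra_simps scaleR_conv_of_real[where 'a=complex])
  then have "(disk_var n has_derivative disk_var n) (at x)"
    by (simp add: linear_linear bounded_linear_imp_has_derivative)
  then have var: "(disk_var n has_derivative (\<lambda>h. of_real (h $ 1) + orientation n * of_real (h $ 2))) (at x)"
    by (simp add: disk_var_def[abs_def])
  have sq: "((\<lambda>x::real^2. (norm x)\<^sup>2) has_derivative (\<lambda>h. 2 * (x $ 1 * h $ 1 + x $ 2 * h $ 2))) (at x)"
    unfolding power2_norm_eq_inner
    by (rule has_derivative_eq_rhs, rule has_derivative_inner[OF has_derivative_ident has_derivative_ident])
       (simp add: fun_eq_iff inner_vec_def sum_2 algebra_simps)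
  have "((\<lambda>x. G ?m ((norm x)\<^sup>2)) has_derivative (\<lambda>h. D ?m ((norm x)\<^sup>2) * (2 * (x $ 1 * h $ 1 + x $ 2 * h $ 2)))) (at x)"
    by (rule has_derivative_compose[OF sq, of "G ?m"])
       (use G_deriv[of "(norm x)\<^sup>2" ?m] in \<open>simp add: has_field_derivative_def\<close>)
  then have G: "((\<lambda>x. complex_of_real (G ?m ((norm x)\<^sup>2))) has_derivative (\<lambda>h. of_real (D ?m ((norm x)\<^sup>2) * (2 * (x $ 1 * h $ 1 + x $ 2 * h $ 2))))) (at x)"
    by (rule has_derivative_of_real)
  have "(mode n has_derivative (\<lambda>h. disk_var n x ^ ?m * of_real (D ?m ((norm x)\<^sup>2) * (2 * (x $ 1 * h $ 1 + x $ 2 * h $ 2)))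
      + (of_nat ?m * (of_real (h $ 1) + orientation n * of_real (h $ 2)) * disk_var n x ^ (?m - 1)) * of_real (G ?m ((norm x)\<^sup>2)))) (at x)"
    unfolding mode_def
    by (rule has_derivative_mult[OF has_derivative_power[OF var] G])
  then show "(mode n has_derivative (\<lambda>h. \<Sum>j\<in>UNIV. of_real (h $ j) * mode_grad n x $ j)) (at x)"
    by (rule has_derivative_eq_rhs) (simp add: fun_eq_iff sum_2 mode_grad_def algebra_simps)
next
  have "continuous_on UNIV (disk_var n)"
    unfolding disk_var_def by (intro continuous_intros)
  moreover have "continuous_on UNIV (\<lambda>x::real^2. G (nat \<bar>n\<bar>) ((norm x)\<^sup>2))"
  proof -
    have "continuous_on {0..} (G (nat \<bar>n\<bar>))"
      by (intro continuous_at_imp_continuous_on ballI) (auto intro!: DERIV_isCont G_deriv)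
    then show ?thesis
      by (rule continuous_on_compose2) (auto intro!: continuous_intros)
  qed
  moreover have "continuous_on UNIV (\<lambda>x::real^2. D (nat \<bar>n\<bar>) ((norm x)\<^sup>2))"
    by (rule continuous_on_compose2[OF D_cont]) (auto intro!: continuous_intros)
  ultimately show "continuous_on UNIV (mode_grad n)"
    unfolding mode_grad_def by (intro continuous_intros)
qed

text \<open>The power of the norm is kept because it gives geometric convergence of the mode series
  at interior points; the constant 2 alone bounds the modes in integrals.\<close>

lemma norm_mode_le:
  assumes "norm x \<le> 1"
  shows "norm (mode n x) \<le> 2 * norm x ^ nat \<bar>n\<bar>"
proof -
  have "\<bar>G (nat \<bar>n\<bar>) ((norm x)\<^sup>2)\<bar> \<le> 2"
    using assms by (intro G_bound) (auto simp: power_le_one)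
  then show ?thesis
    using mult_left_mono[of "\<bar>G (nat \<bar>n\<bar>) ((norm x)\<^sup>2)\<bar>" 2 "norm x ^ nat \<bar>n\<bar>"]
    by (simp add: mode_def norm_mult norm_power mult.commute)
qed

lemma norm_mode_grad_le:
  assumes "norm x \<le> 1"
  shows "norm (mode_grad n x) \<le> 4 * real (nat \<bar>n\<bar>) * norm x ^ (nat \<bar>n\<bar> - 1) + 4 * norm x ^ nat \<bar>n\<bar>"
proof -
  let ?m = "nat \<bar>n\<bar>"
  have g: "\<bar>G ?m ((norm x)\<^sup>2)\<bar> \<le> 2" and d: "\<bar>D ?m ((norm x)\<^sup>2)\<bar> \<le> 1"
    using assms by (auto intro!: G_bound D_bound simp: power_le_one)
  have comp: "norm (mode_grad n x $ j) \<le> 2 * real ?m * norm x ^ (?m - 1) + 2 * norm x ^ ?m" for j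
  proof -
    have "\<bar>x $ j\<bar> \<le> 1"
      using Finite_Cartesian_Product.norm_nth_le[of x j] assms by simp
    then have "\<bar>x $ j\<bar> * \<bar>D ?m ((norm x)\<^sup>2)\<bar> \<le> 1 * 1"
      using d by (intro mult_mono) auto
    then have 1: "norm (disk_var n x ^ ?m * of_real (2 * x $ j * D ?m ((norm x)\<^sup>2))) \<le> norm x ^ ?m * 2"
      unfolding norm_mult norm_power norm_disk_var norm_of_real
      by (intro mult_left_mono) (auto simp: abs_mult)
    have 2: "norm (of_nat ?m * disk_var n x ^ (?m - 1) * (if j = 1 then 1 else orientation n) * of_real (G ?m ((norm x)\<^sup>2)))
        \<le> real ?m * norm x ^ (?m - 1) * 1 * 2"
      unfolding norm_mult norm_power norm_disk_var norm_of_real norm_of_nat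
      by (intro mult_mono) (use g in auto)
    show ?thesis
      unfolding mode_grad_def vec_lambda_beta
      by (rule order_trans[OF norm_triangle_ineq order_trans[OF add_mono[OF 2 1]]]) simp
  qed
  have "norm (mode_grad n x) \<le> (\<Sum>j\<in>UNIV. norm (mode_grad n x $ j))"
    by (simp add: norm_vec_def L2_set_le_sum)
  also have "\<dots> \<le> 2 * (2 * real ?m * norm x ^ (?m - 1) + 2 * norm x ^ ?m)"
    using comp[of 1] comp[of 2] by (simp add: sum_2)
  finally show ?thesis by simp
qed

lemma abs_eigenvalue_le: "\<bar>eigenvalue n\<bar> \<le> \<bar>of_int n\<bar> + 2"
  using D_bound[OF zero_le_one order_refl, of "nat \<bar>n\<bar>"] unfolding eigenvalue_def by linarith

end

section \<open>Green's formula for separated solutions\<close>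

lemma has_vector_derivative_fourier_mode:
  "(fourier_mode n has_vector_derivative \<i> * of_int n * fourier_mode n t) (at t within S)"
proof -
  have "((\<lambda>z. exp (\<i> * of_int n * z)) has_field_derivative exp (\<i> * of_int n * of_real t) * (\<i> * of_int n)) (at (of_real t))"
    by (auto intro!: derivative_eq_intros)
  from has_vector_derivative_real_field[OF this, of S] show ?thesis
    by (simp add: fourier_mode_def[abs_def] mult.commute)
qed

lemma continuous_fourier_mode: "continuous_on S (fourier_mode n)"
  by (intro continuous_at_imp_continuous_on ballI has_vector_derivative_continuous[OF has_vector_derivative_fourier_mode])

lemma fourier_mode_mult: "fourier_mode n t * fourier_mode k t = fourier_mode (n + k) t"
  by (simp add: fourier_mode_def algebra_simps flip: exp_add)

lemma fourier_mode_0 [simp]: "fourier_mode 0 t = 1"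
  by (simp add: fourier_mode_def)

lemma fourier_mode_at_0 [simp]: "fourier_mode n 0 = 1"
  by (simp add: fourier_mode_def)

lemma fourier_mode_2pi [simp]: "fourier_mode n (2 * pi) = 1"
  using exp_integer_2pi[of "of_int n"] by (simp add: fourier_mode_def mult_ac)

lemma norm_circle_point [simp]: "norm (circle_point t) = 1"
  by (simp add: norm_real2)

lemma has_vector_derivative_circle_point:
  "(circle_point has_vector_derivative (- sin t) *\<^sub>R axis 1 1 + cos t *\<^sub>R axis 2 1) (at t within S)"
proof -
  have eq: "circle_point = (\<lambda>t. cos t *\<^sub>R axis 1 1 + sin t *\<^sub>R axis 2 1)"
    by (auto simp: fun_eq_iff vec_eq_iff forall_2 axis_def)
  show ?thesis
    by (subst eq) (auto intro!: derivative_eq_intros)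
qed

lemma borel_measurable_radial_potential [measurable]: "radial_potential \<gamma> b \<in> borel_measurable borel"
  unfolding radial_potential_def by measurable

lemma abs_radial_potential_le:
  assumes "\<gamma> \<in> {0..1}"
  shows "\<bar>radial_potential \<gamma> b x\<bar> \<le> 1"
  using assms by (auto simp: radial_potential_def indicator_def)

context disk_profile
begin

abbreviation (input) "q \<equiv> radial_potential \<gamma> b"

text \<open>This is r R'(r) for the radial factor R(r) = r^m G(r^2), the factor r being the Jacobian
  of polar coordinates.\<close>

definition flux :: "nat \<Rightarrow> real \<Rightarrow> real" where
  "flux m r = real m * r ^ m * G m (r\<^sup>2) + 2 * r ^ (m + 2) * D m (r\<^sup>2)"

text \<open>The radial equation (r R')' = m^2 R / r - q r R, with the division by r carried out. For
  m = 0 the truncated exponent again meets a vanishing factor.\<close>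

definition flux' :: "nat \<Rightarrow> real \<Rightarrow> real" where
  "flux' m r = (real m)\<^sup>2 * r ^ (m - 1) * G m (r\<^sup>2) - (if r < b then \<gamma> else 0) * r ^ (m + 1) * G m (r\<^sup>2)"

lemma G_sq_deriv: "((\<lambda>r. G m (r\<^sup>2)) has_real_derivative D m (r\<^sup>2) * (2 * r)) (at r)"
  by (rule DERIV_chain2[OF G_deriv]) (auto intro!: derivative_eq_intros)

lemma flux_deriv:
  assumes r: "0 < r" "r \<noteq> b"
  shows "(flux m has_real_derivative flux' m r) (at r)"
proof -
  have r2: "0 < r\<^sup>2" "r\<^sup>2 \<noteq> b\<^sup>2" "r\<^sup>2 < b\<^sup>2 \<longleftrightarrow> r < b"
    using r b by (auto simp: power2_eq_iff_nonneg intro: power_strict_mono power2_less_imp_less)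
  let ?W' = "if r < b then - (\<gamma> / 4) * ((r\<^sup>2) ^ m * G m (r\<^sup>2)) else 0"
  have "((\<lambda>s. s ^ Suc m * D m s) has_real_derivative ?W') (at (r\<^sup>2))"
    using D_deriv[OF r2(1,2), of m] unfolding r2(3) .
  then have W: "((\<lambda>r. (r\<^sup>2) ^ Suc m * D m (r\<^sup>2)) has_real_derivative ?W' * (2 * r)) (at r)"
    by (rule DERIV_chain2) (auto intro!: derivative_eq_intros)
  \<comment> \<open>Dividing by \<open>r ^ m\<close> recovers
    \<open>r ^ (m + 2) * D m (r\<^sup>2)\<close>, half of the second term of the flux. The extra
    term in its derivative, with factor \<open>real m\<close>, cancels against the product rule for
    the first term.\<close>
  have "((\<lambda>r. (r\<^sup>2) ^ Suc m * D m (r\<^sup>2) / r ^ m) has_real_derivative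
      (?W' * (2 * r) * r ^ m - (r\<^sup>2) ^ Suc m * D m (r\<^sup>2) * (real m * r ^ (m - Suc 0))) / (r ^ m * r ^ m)) (at r)"
    by (rule DERIV_divide[OF W DERIV_pow]) (use r in auto)
  also have "(?W' * (2 * r) * r ^ m - (r\<^sup>2) ^ Suc m * D m (r\<^sup>2) * (real m * r ^ (m - Suc 0))) / (r ^ m * r ^ m)
      = - ((if r < b then \<gamma> else 0) / 2) * r ^ (m + 1) * G m (r\<^sup>2) - real m * r ^ (m + 1) * D m (r\<^sup>2)"
  proof (cases m)
    case 0
    then show ?thesis using r by (simp add: field_simps)
  next
    case (Suc k)
    show ?thesis using r
      by (simp add: Suc field_simps power2_eq_square power_mult_distrib)
  qed
  finally have W2: "((\<lambda>r. r ^ (m + 2) * D m (r\<^sup>2)) has_real_derivative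
      - ((if r < b then \<gamma> else 0) / 2) * r ^ (m + 1) * G m (r\<^sup>2) - real m * r ^ (m + 1) * D m (r\<^sup>2)) (at r)"
    by (rule has_field_derivative_transform_within_open[of _ _ _ "{0<..}"])
       (use r in \<open>auto simp: field_simps power2_eq_square power_mult_distrib\<close>)
  have "(flux m has_real_derivative (real m * (real m * r ^ (m - Suc 0)) * G m (r\<^sup>2) + D m (r\<^sup>2) * (2 * r) * (real m * r ^ m))
      + 2 * (- ((if r < b then \<gamma> else 0) / 2) * r ^ (m + 1) * G m (r\<^sup>2) - real m * r ^ (m + 1) * D m (r\<^sup>2))) (at r)"
    unfolding flux_def mult.assoc[of 2]
    by (intro DERIV_add DERIV_cmult[OF W2] DERIV_mult[OF DERIV_cmult[OF DERIV_pow] G_sq_deriv])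
  then show ?thesis
    by (rule DERIV_cong) (simp add: flux'_def power2_eq_square algebra_simps)
qed

lemma flux_continuous: "continuous_on S (flux m)"
proof -
  have "continuous_on S (\<lambda>r. G m (r\<^sup>2))"
    by (intro continuous_at_imp_continuous_on ballI DERIV_isCont[OF G_sq_deriv])
  moreover have "continuous_on S (\<lambda>r. D m (r\<^sup>2))"
    by (rule continuous_on_compose2[OF D_cont]) (auto intro!: continuous_intros)
  ultimately show ?thesis
    unfolding flux_def[abs_def] by (intro continuous_intros)
qed

lemma flux_0: "flux m 0 = 0"
  by (cases m) (auto simp: flux_def)

lemma flux_1: "flux (nat \<bar>n\<bar>) 1 = eigenvalue n"
  by (simp add: flux_def eigenvalue_def G_1)

text \<open>The pairing of the gradient with \<open>X\<close> is split along the radial and the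
  tangential direction. The first coefficient is the flux; the second comes from the angular
  derivative of e^(int).\<close>

lemma mode_grad_polar:
  fixes X :: "complex^2"
  shows "of_real r * (\<Sum>j\<in>UNIV. mode_grad n (r *\<^sub>R circle_point t) $ j * X $ j) =
    of_real (flux (nat \<bar>n\<bar>) r) * (fourier_mode n t * (of_real (cos t) * X $ 1 + of_real (sin t) * X $ 2))
    + of_real (real (nat \<bar>n\<bar>) * r ^ nat \<bar>n\<bar> * G (nat \<bar>n\<bar>) (r\<^sup>2)) *
        (orientation n * (fourier_mode n t * (- of_real (sin t) * X $ 1 + of_real (cos t) * X $ 2)))"
proof -
  let ?m = "nat \<bar>n\<bar>" and ?o = "orientation n"
  define e where "e = exp (?o * of_real t)"
  define E where "E = fourier_mode n t"
  define c where "c = complex_of_real (cos t)"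
  define s where "s = complex_of_real (sin t)"
  define z where "z = complex_of_real r"
  define g where "g = complex_of_real (G ?m (r\<^sup>2))"
  define d where "d = complex_of_real (D ?m (r\<^sup>2))"
  have e: "e = c + ?o * s"
    using disk_var_circle[of n 1 t] by (simp add: disk_var_def e_def c_def s_def)
  have cs: "c * c + s * s = 1"
    unfolding c_def s_def by (metis of_real_1 of_real_add of_real_mult sin_cos_squared_add3)
  have E: "e ^ ?m = E"
    unfolding e_def E_def by (rule exp_orientation_power)
  have nrm: "(norm (r *\<^sub>R circle_point t))\<^sup>2 = r\<^sup>2"
    by (simp add: power_mult_distrib)
  have dv: "disk_var n (r *\<^sub>R circle_point t) = z * e"
    by (simp add: disk_var_circle z_def e_def)
  have grad: "mode_grad n (r *\<^sub>R circle_point t) $ 1 = of_nat ?m * (z * e) ^ (?m - 1) * g + (z * e) ^ ?m * (2 * (z * c) * d)"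
    "mode_grad n (r *\<^sub>R circle_point t) $ 2 = of_nat ?m * (z * e) ^ (?m - 1) * ?o * g + (z * e) ^ ?m * (2 * (z * s) * d)"
    by (simp_all add: mode_grad_def nrm dv g_def d_def z_def c_def s_def)
  have flux: "of_real (flux ?m r) = of_nat ?m * z ^ ?m * g + 2 * z ^ ?m * z * z * d"
  proof -
    have "complex_of_real (flux k r) = of_nat k * z ^ k * of_real (G k (r\<^sup>2)) + 2 * z ^ k * z * z * of_real (D k (r\<^sup>2))" for k
      by (simp add: flux_def z_def power2_eq_square)
    then show ?thesis unfolding g_def d_def .
  qed
  have oo: "?o * ?o = -1" by simp
  have main: "of_nat ?m * z * (z * e) ^ (?m - 1) * (X $ 1 + ?o * X $ 2)
    = of_nat ?m * z ^ ?m * (E * (c * X $ 1 + s * X $ 2) + ?o * (E * (- s * X $ 1 + c * X $ 2)))"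
  proof (cases ?m)
    case (Suc k)
    have "E * ((c * X $ 1 + s * X $ 2) + ?o * (- s * X $ 1 + c * X $ 2)) = e ^ k * (e * ((c * X $ 1 + s * X $ 2) + ?o * (- s * X $ 1 + c * X $ 2)))"
      using E by (simp add: Suc mult.assoc[symmetric] mult.commute)
    \<comment> \<open>Multiplication by the unit number \<open>e\<close> turns the polar frame back
      into the Cartesian one.\<close>
    also have "e * ((c * X $ 1 + s * X $ 2) + ?o * (- s * X $ 1 + c * X $ 2)) = X $ 1 + ?o * X $ 2"
      unfolding e using cs oo by algebra
    finally show ?thesis
      by (simp add: Suc power_mult_distrib algebra_simps)
  qed simp
  have "z * (\<Sum>j\<in>UNIV. mode_grad n (r *\<^sub>R circle_point t) $ j * X $ j)
      = g * (of_nat ?m * z * (z * e) ^ (?m - 1) * (X $ 1 + ?o * X $ 2)) + z * (z ^ ?m * E) * (2 * z * d) * (c * X $ 1 + s * X $ 2)"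
    by (simp add: sum_2 grad E[symmetric] power_mult_distrib algebra_simps)
  also have "\<dots> = of_real (flux ?m r) * (E * (c * X $ 1 + s * X $ 2))
      + (of_nat ?m * z ^ ?m * g) * (?o * (E * (- s * X $ 1 + c * X $ 2)))"
    unfolding main flux by (simp add: algebra_simps)
  finally have *: "z * (\<Sum>j\<in>UNIV. mode_grad n (r *\<^sub>R circle_point t) $ j * X $ j)
      = of_real (flux ?m r) * (E * (c * X $ 1 + s * X $ 2))
      + (of_nat ?m * z ^ ?m * g) * (?o * (E * (- s * X $ 1 + c * X $ 2)))" .
  have "complex_of_real (real k * r ^ k * G k (r\<^sup>2)) = of_nat k * z ^ k * of_real (G k (r\<^sup>2))" for k
    by (simp add: z_def)
  from this[of ?m] show ?thesis
    using * unfolding g_def by (simp only: z_def c_def s_def E_def)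
qed

lemma mode_polar: "mode n (r *\<^sub>R circle_point t) = of_real (r ^ nat \<bar>n\<bar> * G (nat \<bar>n\<bar>) (r\<^sup>2)) * fourier_mode n t"
proof -
  have "(norm (r *\<^sub>R circle_point t))\<^sup>2 = r\<^sup>2"
    by (simp add: power_mult_distrib)
  then show ?thesis
    by (simp add: mode_def disk_var_circle power_mult_distrib exp_orientation_power)
qed

text \<open>In polar coordinates the angle is integrated out. The tangential part is integrated by
  parts over the period, and the radial integrand becomes flux * A' + flux' * A, the derivative of
  flux * A, where A(r) is the angular pairing of e^(int) with \<phi> on the circle of radius r. The
  flux vanishes at r = 0 and equals the eigenvalue at r = 1. Only first derivatives of \<phi>
  enter.\<close>

lemma mode_green:
  assumes \<phi>: "C1_gradient \<phi> d\<phi>"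
  shows "energy q (mode n) (mode_grad n) \<phi> d\<phi> =
    eigenvalue n * (\<integral>t. fourier_mode n t * \<phi> (circle_point t) \<partial>lebesgue_on {0..2*pi})"
proof -
  let ?m = "nat \<bar>n\<bar>" and ?E = "fourier_mode n"
  define f0 where "f0 x = (\<Sum>j\<in>UNIV. mode_grad n x $ j * d\<phi> x $ j) - of_real (q x) * mode n x * \<phi> x" for x
  define f where "f x = indicator (cball 0 1) x *\<^sub>R f0 x" for x
  define A where "A r = integral {0..2*pi} (\<lambda>t. ?E t * \<phi> (r *\<^sub>R circle_point t))" for r
  define A' where "A' r = integral {0..2*pi} (\<lambda>t. ?E t * (of_real (cos t) * d\<phi> (r *\<^sub>R circle_point t) $ 1
      + of_real (sin t) * d\<phi> (r *\<^sub>R circle_point t) $ 2))" for r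
  define Tg where "Tg r = integral {0..2*pi} (\<lambda>t. ?E t * (- of_real (sin t) * d\<phi> (r *\<^sub>R circle_point t) $ 1
      + of_real (cos t) * d\<phi> (r *\<^sub>R circle_point t) $ 2))" for r
  note cont\<phi> = C1_gradient_continuous[OF \<phi>]
  note contm = C1_gradient_continuous[OF mode_C1[of n]]
  have cont_polar: "continuous_on S (\<lambda>t. g (r *\<^sub>R circle_point t))"
    if "continuous_on UNIV g" for g :: "real^2 \<Rightarrow> 'x::topological_space" and S r
    by (rule continuous_on_compose2[OF that])
       (auto intro!: continuous_intros continuous_on_subset[OF continuous_circle_point])
  have contE: "continuous_on S ?E" for S by (rule continuous_fourier_mode)
  have int_A: "(\<lambda>t. ?E t * \<phi> (r *\<^sub>R circle_point t)) integrable_on {0..2*pi}" for r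
    by (intro integrable_continuous_real continuous_intros contE cont_polar cont\<phi>)
  have int_A': "(\<lambda>t. ?E t * (of_real (cos t) * d\<phi> (r *\<^sub>R circle_point t) $ 1
      + of_real (sin t) * d\<phi> (r *\<^sub>R circle_point t) $ 2)) integrable_on {0..2*pi}" for r
    by (intro integrable_continuous_real continuous_intros contE cont_polar cont\<phi>)
  have int_Tg: "(\<lambda>t. ?E t * (- of_real (sin t) * d\<phi> (r *\<^sub>R circle_point t) $ 1
      + of_real (cos t) * d\<phi> (r *\<^sub>R circle_point t) $ 2)) integrable_on {0..2*pi}" for r
    by (intro integrable_continuous_real continuous_intros contE cont_polar cont\<phi>)
  \<comment> \<open>The angular derivative of e^(int) \<phi> has integral zero over a period.
    Multiplying the resulting identity by the orientation, whose square is -1, gives the plus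
    sign.\<close>
  have tangential: "of_real r * (orientation n * Tg r) = of_nat ?m * A r" for r
  proof -
    let ?h = "\<lambda>t. ?E t * (of_real r * (- of_real (sin t) * d\<phi> (r *\<^sub>R circle_point t) $ 1
      + of_real (cos t) * d\<phi> (r *\<^sub>R circle_point t) $ 2)) + \<i> * of_int n * ?E t * \<phi> (r *\<^sub>R circle_point t)"
    have "((\<lambda>t. ?E t * \<phi> (r *\<^sub>R circle_point t)) has_vector_derivative ?h t) (at t within {0..2*pi})" for t
    proof -
      have "((\<lambda>t. r *\<^sub>R circle_point t) has_vector_derivative r *\<^sub>R ((- sin t) *\<^sub>R axis 1 1 + cos t *\<^sub>R axis 2 1)) (at t within {0..2*pi})"
        by (rule bounded_linear.has_vector_derivative[OF bounded_linear_scaleR_right has_vector_derivative_circle_point]) 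
      from has_vector_derivative_mult[OF has_vector_derivative_fourier_mode C1_gradient_chain[OF \<phi> this]]
      show ?thesis
        by (rule has_vector_derivative_eq_rhs) (simp add: sum_2 axis_def algebra_simps)
    qed
    then have "(?h has_integral (?E (2*pi) * \<phi> (r *\<^sub>R circle_point (2*pi)) - ?E 0 * \<phi> (r *\<^sub>R circle_point 0))) {0..2*pi}"
      by (intro fundamental_theorem_of_calculus) auto
    then have "(?h has_integral 0) {0..2*pi}"
      by (simp add: circle_point_def)
    moreover have "(?h has_integral (of_real r * Tg r + \<i> * of_int n * A r)) {0..2*pi}"
    proof -
      have 1: "((\<lambda>t. of_real r * (?E t * (- of_real (sin t) * d\<phi> (r *\<^sub>R circle_point t) $ 1
      + of_real (cos t) * d\<phi> (r *\<^sub>R circle_point t) $ 2))) has_integral of_real r * Tg r) {0..2*pi}"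
        unfolding Tg_def by (intro has_integral_mult_right integrable_integral int_Tg)
      have 2: "((\<lambda>t. \<i> * of_int n * (?E t * \<phi> (r *\<^sub>R circle_point t))) has_integral \<i> * of_int n * A r) {0..2*pi}"
        unfolding A_def by (intro has_integral_mult_right integrable_integral int_A)
      show ?thesis
        by (rule has_integral_eq[OF _ has_integral_add[OF 1 2]]) (simp add: mult_ac)
    qed
    ultimately have "of_real r * Tg r + \<i> * of_int n * A r = 0"
      by (rule has_integral_unique[symmetric])
    then have "of_real r * Tg r = - (orientation n * of_nat ?m * A r)"
      unfolding orientation_nat_abs by (simp add: eq_neg_iff_add_eq_0)
    then have "of_real r * (orientation n * Tg r) = orientation n * - (orientation n * of_nat ?m * A r)"
      by (simp only: mult.left_commute[of "of_real r"])
    also have "\<dots> = - (orientation n * orientation n) * (of_nat ?m * A r)"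
      by (simp only: mult_ac mult_minus_left mult_minus_right)
    finally show ?thesis by (simp only: orientation_mult) simp
  qed
  have A_deriv: "(A has_vector_derivative A' r) (at r)" for r
  proof -
    have "((\<lambda>r. integral (cbox 0 (2*pi)) (\<lambda>t. ?E t * \<phi> (r *\<^sub>R circle_point t))) has_vector_derivative
        integral (cbox 0 (2*pi)) (\<lambda>t. ?E t * (of_real (cos t) * d\<phi> (r *\<^sub>R circle_point t) $ 1
      + of_real (sin t) * d\<phi> (r *\<^sub>R circle_point t) $ 2))) (at r within UNIV)"
    proof (rule leibniz_rule_vector_derivative)
      fix r t :: real
      have "((\<lambda>r. r *\<^sub>R circle_point t) has_vector_derivative circle_point t) (at r within UNIV)"
        by (auto intro!: derivative_eq_intros)
      from has_vector_derivative_mult_right[OF C1_gradient_chain[OF \<phi> this], of "?E t"]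
      show "((\<lambda>r. ?E t * \<phi> (r *\<^sub>R circle_point t)) has_vector_derivative
          ?E t * (of_real (cos t) * d\<phi> (r *\<^sub>R circle_point t) $ 1 + of_real (sin t) * d\<phi> (r *\<^sub>R circle_point t) $ 2)) (at r within UNIV)"
        by (simp add: sum_2)
    next
      have c: "continuous_on S (\<lambda>p::real\<times>real. d\<phi> (fst p *\<^sub>R circle_point (snd p)))" for S
        by (rule continuous_on_compose2[OF cont\<phi>(2)])
           (auto intro!: continuous_intros continuous_on_compose2[OF continuous_circle_point])
      show "continuous_on (UNIV \<times> cbox 0 (2*pi)) (\<lambda>(r, t). ?E t * (of_real (cos t) * d\<phi> (r *\<^sub>R circle_point t) $ 1
          + of_real (sin t) * d\<phi> (r *\<^sub>R circle_point t) $ 2))"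
        unfolding case_prod_unfold
        by (intro continuous_intros c continuous_on_compose2[OF contE[of UNIV]]) auto
    qed (use int_A in auto)
    then show ?thesis by (simp add: A_def[abs_def] A'_def)
  qed
  have f_bounded: "\<exists>B. \<forall>x. norm x \<le> 1 \<longrightarrow> norm (f x) \<le> B"
  proof -
    have c: "continuous_on (cball 0 1) (\<lambda>x. \<Sum>j\<in>UNIV. mode_grad n x $ j * d\<phi> x $ j)"
      "continuous_on (cball 0 1) (\<lambda>x. mode n x * \<phi> x)"
      by (intro continuous_intros continuous_on_subset[OF cont\<phi>(1)] continuous_on_subset[OF contm(1)]
          continuous_on_subset[OF cont\<phi>(2)] continuous_on_subset[OF contm(2)] subset_UNIV)+
    obtain B1 where B1: "\<forall>x\<in>cball 0 1. norm (\<Sum>j\<in>UNIV. mode_grad n x $ j * d\<phi> x $ j) \<le> B1"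
      using continuous_on_compact_bounded[OF compact_cball c(1)] by (rule exE)
    obtain B2 where B2: "\<forall>x\<in>cball 0 1. norm (mode n x * \<phi> x) \<le> B2"
      using continuous_on_compact_bounded[OF compact_cball c(2)] by (rule exE)
    have "norm (f x) \<le> B1 + B2" if "norm x \<le> 1" for x
    proof -
      have "norm (of_real (q x) * mode n x * \<phi> x) \<le> 1 * norm (mode n x * \<phi> x)"
        unfolding mult.assoc norm_mult[of "of_real (q x)"] norm_of_real
        by (intro mult_right_mono abs_radial_potential_le \<gamma>) auto
      then show ?thesis
        using that B1[rule_format, of x] B2[rule_format, of x] norm_triangle_ineq4[of "\<Sum>j\<in>UNIV. mode_grad n x $ j * d\<phi> x $ j" "of_real (q x) * mode n x * \<phi> x"]
        by (simp add: f_def f0_def)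
    qed
    then show ?thesis by blast
  qed
  then obtain B where f_bnd: "\<And>x. norm x \<le> 1 \<Longrightarrow> norm (f x) \<le> B" by blast
  have f_meas: "f \<in> borel_measurable borel"
  proof -
    have "(\<lambda>x. \<Sum>j\<in>UNIV. mode_grad n x $ j * d\<phi> x $ j) \<in> borel_measurable borel"
      by (intro borel_measurable_continuous_onI continuous_intros cont\<phi> contm)
    moreover have "(\<lambda>x. of_real (q x) * mode n x * \<phi> x) \<in> borel_measurable borel"
      using borel_measurable_continuous_onI[OF cont\<phi>(1)] borel_measurable_continuous_onI[OF contm(1)] by measurable
    ultimately show ?thesis
      unfolding f_def f0_def by (intro borel_measurable_scaleR borel_measurable_indicator borel_measurable_diff) auto
  qed
  have "energy q (mode n) (mode_grad n) \<phi> d\<phi> = (\<integral>x. f x \<partial>lebesgue_on Omega)"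
    unfolding energy_def
    by (rule Bochner_Integration.integral_cong) (auto simp: f_def f0_def Omega_def)
  also have "\<dots> = (\<integral>r. r * (\<integral>t. f (r *\<^sub>R circle_point t) \<partial>lebesgue_on {0..2*pi}) \<partial>lebesgue_on {0..1})"
    by (rule integral_disk_polar(1)[OF f_meas f_bnd])
  also have "\<dots> = integral {0..1} (\<lambda>r. r * (\<integral>t. f (r *\<^sub>R circle_point t) \<partial>lebesgue_on {0..2*pi}))"
    by (rule lebesgue_integral_eq_integral[OF integral_disk_polar(2)[OF f_meas f_bnd]]) auto
  also have "\<dots> = integral {0..1} (\<lambda>r. of_real (flux ?m r) * A' r + of_real (flux' ?m r) * A r)"
  \<comment> \<open>The centre and the jump radius are discarded; two points do not affect the
    integral.\<close>
  proof (rule integral_spike[where S="{0, b}"])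
    fix r assume r: "r \<in> {0..1} - {0, b}"
    then have r': "0 < r" "r \<le> 1" "r \<noteq> b" by auto
    let ?q = "if r < b then \<gamma> else 0"
    have q: "q (r *\<^sub>R circle_point t) = ?q" for t
    proof -
      have "norm (r *\<^sub>R circle_point t) = r" using r' by simp
      then show ?thesis using r' unfolding radial_potential_def by simp
    qed
    have "(\<integral>t. f (r *\<^sub>R circle_point t) \<partial>lebesgue_on {0..2*pi}) = (\<integral>t. f0 (r *\<^sub>R circle_point t) \<partial>lebesgue_on {0..2*pi})"
      using r' by (simp add: f_def)
    also have "\<dots> = integral {0..2*pi} (\<lambda>t. f0 (r *\<^sub>R circle_point t))"
      unfolding f0_def q
      by (intro lebesgue_integral_eq_integral continuous_imp_integrable_real continuous_intros cont_polar cont\<phi> contm) simp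
    finally have "r * (\<integral>t. f (r *\<^sub>R circle_point t) \<partial>lebesgue_on {0..2*pi}) = integral {0..2*pi} (\<lambda>t. r * f0 (r *\<^sub>R circle_point t))"
      by simp
    also have "\<dots> = of_real (flux ?m r) * A' r + (of_real (real ?m * r ^ ?m * G ?m (r\<^sup>2)) * (orientation n * Tg r)
        - of_real (?q * r ^ (?m + 1) * G ?m (r\<^sup>2)) * A r)"
    proof (rule integral_unique)
      have 1: "((\<lambda>t. of_real (flux ?m r) * (?E t * (of_real (cos t) * d\<phi> (r *\<^sub>R circle_point t) $ 1
            + of_real (sin t) * d\<phi> (r *\<^sub>R circle_point t) $ 2))) has_integral of_real (flux ?m r) * A' r) {0..2*pi}"
        unfolding A'_def by (intro has_integral_mult_right integrable_integral int_A')
      have 2: "((\<lambda>t. of_real (real ?m * r ^ ?m * G ?m (r\<^sup>2)) * (orientation n * (?E t * (- of_real (sin t) * d\<phi> (r *\<^sub>R circle_point t) $ 1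
            + of_real (cos t) * d\<phi> (r *\<^sub>R circle_point t) $ 2)))) has_integral
            of_real (real ?m * r ^ ?m * G ?m (r\<^sup>2)) * (orientation n * Tg r)) {0..2*pi}"
        unfolding Tg_def by (intro has_integral_mult_right integrable_integral int_Tg)
      have 3: "((\<lambda>t. of_real (?q * r ^ (?m + 1) * G ?m (r\<^sup>2)) * (?E t * \<phi> (r *\<^sub>R circle_point t))) has_integral
            of_real (?q * r ^ (?m + 1) * G ?m (r\<^sup>2)) * A r) {0..2*pi}"
        unfolding A_def by (intro has_integral_mult_right integrable_integral int_A)
      show "((\<lambda>t. r * f0 (r *\<^sub>R circle_point t)) has_integral of_real (flux ?m r) * A' r
          + (of_real (real ?m * r ^ ?m * G ?m (r\<^sup>2)) * (orientation n * Tg r) - of_real (?q * r ^ (?m + 1) * G ?m (r\<^sup>2)) * A r)) {0..2*pi}"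
        by (rule has_integral_eq[OF _ has_integral_add[OF 1 has_integral_diff[OF 2 3]]])
           (simp only: f0_def right_diff_distrib mode_grad_polar mode_polar q, simp)
    qed
    \<comment> \<open>One factor \<open>r\<close> is split off \<open>r ^ ?m\<close> and spent on
      the tangential identity, which supplies the second factor of m.\<close>
    also have "of_real (real ?m * r ^ ?m * G ?m (r\<^sup>2)) * (orientation n * Tg r)
        = of_real ((real ?m)\<^sup>2 * r ^ (?m - 1) * G ?m (r\<^sup>2)) * A r"
    proof (cases ?m)
      case (Suc k)
      then show ?thesis
        using arg_cong[OF tangential[of r], of "\<lambda>z. of_real (real ?m * r ^ k * G ?m (r\<^sup>2)) * z"]
        by (simp add: power2_eq_square mult_ac del: of_nat_Suc)
    qed simp
    finally show "of_real (flux ?m r) * A' r + of_real (flux' ?m r) * A r = r * (\<integral>t. f (r *\<^sub>R circle_point t) \<partial>lebesgue_on {0..2*pi})"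
      by (simp add: flux'_def algebra_simps)
  qed simp
  also have "\<dots> = of_real (flux ?m 1) * A 1 - of_real (flux ?m 0) * A 0"
  \<comment> \<open>The exceptional radius is \<open>b\<close>: there the derivative of the flux
    jumps, while flux * A stays continuous.\<close>
  proof (rule integral_unique, rule fundamental_theorem_of_calculus_interior_strong[where S="{b}"])
    fix r assume r: "r \<in> {0<..<1} - {b}"
    have "((\<lambda>r. complex_of_real (flux ?m r)) has_vector_derivative of_real (flux' ?m r)) (at r)"
      by (intro has_vector_derivative_of_real)
         (use r in \<open>auto intro!: flux_deriv simp flip: has_real_derivative_iff_has_vector_derivative\<close>)
    from has_vector_derivative_mult[OF this A_deriv]
    show "((\<lambda>r. of_real (flux ?m r) * A r) has_vector_derivative of_real (flux ?m r) * A' r + of_real (flux' ?m r) * A r) (at r)" .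
  next
    have "continuous_on {0..1} A"
      by (intro continuous_at_imp_continuous_on ballI has_vector_derivative_continuous[OF A_deriv])
    then show "continuous_on {0..1} (\<lambda>r. of_real (flux ?m r) * A r)"
      by (intro continuous_intros flux_continuous)
  qed auto
  also have "\<dots> = eigenvalue n * A 1"
    by (simp add: flux_0 flux_1)
  also have "A 1 = (\<integral>t. ?E t * \<phi> (circle_point t) \<partial>lebesgue_on {0..2*pi})"
    unfolding A_def using cont_polar[OF cont\<phi>(1), of _ 1]
    by (simp, intro lebesgue_integral_eq_integral[symmetric] continuous_imp_integrable_real continuous_intros contE) auto
  finally show ?thesis .
qed

end

section \<open>Orthogonality\<close>

lemma cnj_L2: "f \<in> L2 M \<Longrightarrow> (\<lambda>x. cnj (f x)) \<in> L2 M"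
  by (rule L2_dominated[where g="\<lambda>x. (norm (f x))\<^sup>2"])
     (auto dest: L2D intro: measurable_compose[OF _ borel_measurable_continuous_onI[OF continuous_on_cnj[OF continuous_on_id]]])

lemma of_real_integral_norm_square:
  fixes f :: "'a \<Rightarrow> complex"
  shows "of_real (\<integral>x. (norm (f x))\<^sup>2 \<partial>M) = (\<integral>x. f x * cnj (f x) \<partial>M)"
  unfolding complex_norm_square[symmetric] by (rule integral_complex_of_real[symmetric])

text \<open>Orthogonality is asked only after summation over \<open>j\<close>, since gradients of
  different modes are orthogonal as vector fields but not component by component. A one-element
  \<open>J\<close> covers the modes themselves.\<close>

lemma integral_norm_square_orthogonal_sum:
  fixes f :: "'i \<Rightarrow> 'j \<Rightarrow> 'a \<Rightarrow> complex"
  assumes A: "finite A" and f: "\<And>n j. f n j \<in> L2 M"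
    and orth: "\<And>n k. n \<in> A \<Longrightarrow> k \<in> A \<Longrightarrow> n \<noteq> k \<Longrightarrow> (\<Sum>j\<in>J. \<integral>x. f n j x * cnj (f k j x) \<partial>M) = 0"
  shows "(\<Sum>j\<in>J. \<integral>x. (norm (\<Sum>n\<in>A. c n * f n j x))\<^sup>2 \<partial>M)
    = (\<Sum>n\<in>A. (norm (c n))\<^sup>2 * (\<Sum>j\<in>J. \<integral>x. (norm (f n j x))\<^sup>2 \<partial>M))"
proof -
  have int: "integrable M (\<lambda>x. f n j x * cnj (f k j x))" for n k j
    by (intro L2_mult_integrable cnj_L2 f)
  have "complex_of_real (\<integral>x. (norm (\<Sum>n\<in>A. c n * f n j x))\<^sup>2 \<partial>M)
      = (\<Sum>n\<in>A. \<Sum>k\<in>A. c n * cnj (c k) * (\<integral>x. f n j x * cnj (f k j x) \<partial>M))" for j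
  proof -
    have "complex_of_real (\<integral>x. (norm (\<Sum>n\<in>A. c n * f n j x))\<^sup>2 \<partial>M)
        = (\<integral>x. (\<Sum>n\<in>A. \<Sum>k\<in>A. c n * cnj (c k) * (f n j x * cnj (f k j x))) \<partial>M)"
      unfolding of_real_integral_norm_square
      by (rule Bochner_Integration.integral_cong) (simp_all add: cnj_sum sum_product mult_ac)
    also have "\<dots> = (\<Sum>n\<in>A. \<Sum>k\<in>A. c n * cnj (c k) * (\<integral>x. f n j x * cnj (f k j x) \<partial>M))"
      by (simp add: Bochner_Integration.integral_sum int)
    finally show ?thesis .
  qed
  then have "complex_of_real (\<Sum>j\<in>J. \<integral>x. (norm (\<Sum>n\<in>A. c n * f n j x))\<^sup>2 \<partial>M)
      = (\<Sum>j\<in>J. \<Sum>n\<in>A. \<Sum>k\<in>A. c n * cnj (c k) * (\<integral>x. f n j x * cnj (f k j x) \<partial>M))"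
    by simp
  also have "\<dots> = (\<Sum>n\<in>A. \<Sum>j\<in>J. \<Sum>k\<in>A. c n * cnj (c k) * (\<integral>x. f n j x * cnj (f k j x) \<partial>M))"
    by (rule sum.swap)
  also have "\<dots> = (\<Sum>n\<in>A. \<Sum>k\<in>A. c n * cnj (c k) * (\<Sum>j\<in>J. \<integral>x. f n j x * cnj (f k j x) \<partial>M))"
    by (subst sum.swap) (simp add: sum_distrib_left)
  also have "\<dots> = (\<Sum>n\<in>A. c n * cnj (c n) * (\<Sum>j\<in>J. \<integral>x. f n j x * cnj (f n j x) \<partial>M))"
  proof (rule sum.cong[OF refl])
    fix n assume n: "n \<in> A"
    have "(\<Sum>k\<in>A. c n * cnj (c k) * (\<Sum>j\<in>J. \<integral>x. f n j x * cnj (f k j x) \<partial>M))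
        = (\<Sum>k\<in>{n}. c n * cnj (c k) * (\<Sum>j\<in>J. \<integral>x. f n j x * cnj (f k j x) \<partial>M))"
      by (rule sum.mono_neutral_right) (use n A orth in auto)
    then show "(\<Sum>k\<in>A. c n * cnj (c k) * (\<Sum>j\<in>J. \<integral>x. f n j x * cnj (f k j x) \<partial>M))
        = c n * cnj (c n) * (\<Sum>j\<in>J. \<integral>x. f n j x * cnj (f n j x) \<partial>M)"
      by simp
  qed
  also have "\<dots> = complex_of_real (\<Sum>n\<in>A. (norm (c n))\<^sup>2 * (\<Sum>j\<in>J. \<integral>x. (norm (f n j x))\<^sup>2 \<partial>M))"
    by (simp add: of_real_integral_norm_square complex_norm_square flip: of_real_power)
  finally show ?thesis
    by (simp only: of_real_eq_iff)
qed

lemma integral_fourier_mode: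
  "(\<integral>t. fourier_mode n t \<partial>lebesgue_on {0..2*pi}) = (if n = 0 then 2 * pi else 0)"
proof (cases "n = 0")
  case True
  then show ?thesis by (simp add: measure_restrict_space scaleR_conv_of_real)
next
  case False
  have "((\<lambda>t. \<i> * of_int n * fourier_mode n t) has_integral (fourier_mode n (2*pi) - fourier_mode n 0)) {0..2*pi}"
    by (rule fundamental_theorem_of_calculus) (auto intro: has_vector_derivative_fourier_mode)
  then have "((\<lambda>t. inverse (\<i> * of_int n) * (\<i> * of_int n * fourier_mode n t)) has_integral inverse (\<i> * of_int n) * 0) {0..2*pi}"
    by (intro has_integral_mult_right) simp
  moreover have "inverse (\<i> * of_int n) * (\<i> * of_int n * z) = z" for z :: complex
    using False by (simp add: field_simps)
  ultimately have "(fourier_mode n has_integral 0) {0..2*pi}"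
    by simp
  then have "integral {0..2*pi} (fourier_mode n) = 0"
    by (rule integral_unique)
  moreover have "(\<integral>t. fourier_mode n t \<partial>lebesgue_on {0..2*pi}) = integral {0..2*pi} (fourier_mode n)"
    by (intro lebesgue_integral_eq_integral continuous_imp_integrable_real continuous_fourier_mode) simp
  ultimately show ?thesis using False by simp
qed

lemma cnj_fourier_mode: "cnj (fourier_mode n t) = fourier_mode (- n) t"
  by (simp add: fourier_mode_def exp_cnj)

lemma cnj_disk_var: "n \<noteq> 0 \<Longrightarrow> cnj (disk_var n x) = disk_var (- n) x"
  by (simp add: disk_var_def orientation_def)

lemma integral_Omega_polar_zero:
  fixes f :: "real^2 \<Rightarrow> complex"
  assumes f: "f \<in> borel_measurable borel" "\<And>x. norm x \<le> 1 \<Longrightarrow> norm (f x) \<le> B"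
    and polar: "\<And>r t. 0 \<le> r \<Longrightarrow> f (r *\<^sub>R circle_point t) = h r * fourier_mode n t" and n: "n \<noteq> 0"
  shows "(\<integral>x. f x \<partial>lebesgue_on Omega) = 0"
proof -
  have "(\<integral>x. f x \<partial>lebesgue_on Omega) =
      (\<integral>r. r * (\<integral>t. f (r *\<^sub>R circle_point t) \<partial>lebesgue_on {0..2*pi}) \<partial>lebesgue_on {0..1})"
    by (rule integral_disk_polar(1)[OF f])
  also have "\<dots> = (\<integral>r. 0 \<partial>lebesgue_on {0..1::real})"
    by (rule Bochner_Integration.integral_cong) (use n in \<open>simp_all add: polar integral_fourier_mode\<close>)
  finally show ?thesis by simp
qed

context disk_profile
begin

lemma cnj_mode: "cnj (mode n x) = mode (- n) x"
  by (cases "n = 0") (simp_all add: mode_def cnj_disk_var)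

lemma cnj_mode_grad: "cnj (mode_grad n x $ j) = mode_grad (- n) x $ j"
  by (cases "n = 0") (auto simp: mode_grad_def cnj_disk_var orientation_def)

lemma mode_bound: "norm x \<le> 1 \<Longrightarrow> norm (mode n x) \<le> 2"
  using norm_mode_le[of x n] power_le_one[of "norm x" "nat \<bar>n\<bar>"] by simp

lemma mode_L2: "mode n \<in> L2 (lebesgue_on Omega)" "mode_grad n \<in> L2 (lebesgue_on Omega)"
  by (rule C1_gradient_L2[OF mode_C1])+

lemma mode_trace: "H1_trace (mode n) (mode_grad n) (fourier_mode n)"
  using C1_gradient_imp_H1_trace[OF mode_C1, of n] by (simp add: mode_circle)

text \<open>Both sides are continuous under the three L^2 limits in the definition of the trace, so
  Green's formula extends from smooth test functions to every H^1 function with a trace.\<close>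

lemma mode_energy:
  assumes "H1_trace u p g"
  shows "energy q (mode n) (mode_grad n) u p = eigenvalue n * (\<integral>t. fourier_mode n t * g t \<partial>lebesgue_on {0..2*pi})"
proof -
  let ?O = "lebesgue_on Omega" and ?T = "lebesgue_on {0..2*pi}"
  have L2: "u \<in> L2 ?O" "p \<in> L2 ?O" "g \<in> L2 ?T"
    using assms by (auto simp: H1_trace_def H1_def)
  obtain \<phi> d\<phi> where C1: "\<And>k::nat. C1_gradient (\<phi> k) (d\<phi> k)"
    and lim: "(\<lambda>k. L2_norm ?O (\<lambda>x. \<phi> k x - u x)) \<longlonglongrightarrow> 0"
      "(\<lambda>k. L2_norm ?O (\<lambda>x. d\<phi> k x - p x)) \<longlonglongrightarrow> 0"
      "(\<lambda>k. L2_norm ?T (\<lambda>t. \<phi> k (circle_point t) - g t)) \<longlonglongrightarrow> 0"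
    using assms by (auto simp: H1_trace_def)
  have "(\<lambda>k. energy q (\<phi> k) (d\<phi> k) (mode n) (mode_grad n)) \<longlonglongrightarrow> energy q u p (mode n) (mode_grad n)"
    by (rule energy_tendsto[where B=1])
       (use L2 C1_gradient_L2[OF C1] mode_L2 lim \<gamma> in \<open>auto simp: abs_radial_potential_le\<close>)
  moreover have "energy q (\<phi> k) (d\<phi> k) (mode n) (mode_grad n)
      = eigenvalue n * (\<integral>t. \<phi> k (circle_point t) * fourier_mode n t \<partial>?T)" for k
    using mode_green[OF C1, of n k] by (simp add: energy_sym mult.commute)
  moreover have "(\<lambda>k. eigenvalue n * (\<integral>t. \<phi> k (circle_point t) * fourier_mode n t \<partial>?T))
      \<longlonglongrightarrow> eigenvalue n * (\<integral>t. g t * fourier_mode n t \<partial>?T)"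
  proof (intro tendsto_mult tendsto_const L2_tendsto_integral_mult L2 lim)
    show "(\<lambda>t. \<phi> k (circle_point t)) \<in> L2 ?T" for k
      using C1_gradient_imp_H1_trace[OF C1, of k] by (simp add: H1_trace_def)
    show "fourier_mode n \<in> L2 ?T"
      by (rule continuous_L2_period[OF continuous_fourier_mode])
  qed
  ultimately show ?thesis
    by (simp add: LIMSEQ_unique energy_sym mult.commute)
qed

lemma mode_measurable: "mode n \<in> borel_measurable borel"
  by (rule borel_measurable_continuous_onI[OF C1_gradient_continuous(1)[OF mode_C1]])

text \<open>A radial weight leaves the angular factor e^(i(n+k)t) untouched, and this integrates to
  zero. The weight is 1 for the L^2 product and the potential for the energy.\<close>

lemma weighted_mode_orthogonal:
  fixes w :: "real \<Rightarrow> real"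
  assumes w: "w \<in> borel_measurable borel" "\<And>r. \<bar>w r\<bar> \<le> 1" and nk: "n + k \<noteq> 0"
  shows "(\<integral>x. of_real (w (norm x)) * (mode n x * mode k x) \<partial>lebesgue_on Omega) = 0"
proof (rule integral_Omega_polar_zero[OF _ _ _ nk])
  show "(\<lambda>x. of_real (w (norm x)) * (mode n x * mode k x)) \<in> borel_measurable borel"
    using w(1) mode_measurable[of n] mode_measurable[of k] by measurable
  show "norm (of_real (w (norm x)) * (mode n x * mode k x)) \<le> 1 * (2 * 2)" if "norm x \<le> 1" for x
    unfolding norm_mult norm_of_real
    by (intro mult_mono w mode_bound that) auto
  show "of_real (w (norm (r *\<^sub>R circle_point t))) * (mode n (r *\<^sub>R circle_point t) * mode k (r *\<^sub>R circle_point t))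
      = of_real (w r * (r ^ nat \<bar>n\<bar> * G (nat \<bar>n\<bar>) (r\<^sup>2)) * (r ^ nat \<bar>k\<bar> * G (nat \<bar>k\<bar>) (r\<^sup>2))) * fourier_mode (n + k) t"
    if "0 \<le> r" for r t
    using that by (simp add: mode_polar mult_ac flip: fourier_mode_mult)
qed

lemma mode_orthogonal:
  assumes "n \<noteq> k"
  shows "(\<integral>x. mode n x * cnj (mode k x) \<partial>lebesgue_on Omega) = 0"
  using weighted_mode_orthogonal[of "\<lambda>_. 1" n "- k"] assms by (simp add: cnj_mode)

text \<open>The conjugate of mode k is mode -k. Testing mode n with it turns Green's formula into a
  formula for the inner product of gradients, so no gradient integral has to be computed.\<close>

lemma mode_grad_inner:
  "(\<Sum>j\<in>UNIV. \<integral>x. mode_grad n x $ j * cnj (mode_grad k x $ j) \<partial>lebesgue_on Omega)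
    = (if n = k then 2 * pi * eigenvalue n else 0) + (\<integral>x. of_real (q x) * (mode n x * cnj (mode k x)) \<partial>lebesgue_on Omega)"
proof -
  have "energy q (mode n) (mode_grad n) (mode (- k)) (mode_grad (- k))
      = (\<Sum>j\<in>UNIV. \<integral>x. mode_grad n x $ j * mode_grad (- k) x $ j \<partial>lebesgue_on Omega)
        - (\<integral>x. mode n x * (of_real (q x) * mode (- k) x) \<partial>lebesgue_on Omega)"
    by (rule energy_eq_integrals[where B=1]) (use \<gamma> in \<open>auto simp: mode_L2 abs_radial_potential_le\<close>)
  moreover have "energy q (mode n) (mode_grad n) (mode (- k)) (mode_grad (- k)) = (if n = k then 2 * pi * eigenvalue n else 0)"
    by (simp add: mode_energy[OF mode_trace] fourier_mode_mult integral_fourier_mode)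
  ultimately show ?thesis
    by (simp add: cnj_mode cnj_mode_grad algebra_simps)
qed

lemma mode_grad_orthogonal:
  assumes "n \<noteq> k"
  shows "(\<Sum>j\<in>UNIV. \<integral>x. mode_grad n x $ j * cnj (mode_grad k x $ j) \<partial>lebesgue_on Omega) = 0"
proof -
  have "(\<lambda>r. \<gamma> * indicator {0<..<b} r) \<in> borel_measurable borel" by measurable
  from weighted_mode_orthogonal[OF this, of n "- k"] show ?thesis
    using assms \<gamma> by (simp add: mode_grad_inner radial_potential_def cnj_mode indicator_def)
qed

lemma measure_Omega: "measure (lebesgue_on Omega) Omega = pi"
  using content_ball[of 1 "0::real^2"] by (simp add: measure_restrict_space Omega_def unit_ball_vol_2)

lemma integral_weight_mode_le:
  fixes w :: "real^2 \<Rightarrow> real"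
  assumes "w \<in> borel_measurable borel" "\<And>x. \<bar>w x\<bar> \<le> 1"
  shows "norm (\<integral>x. of_real (w x) * (mode n x * cnj (mode n x)) \<partial>lebesgue_on Omega) \<le> 4 * pi"
proof -
  interpret finite_measure "lebesgue_on Omega" by simp
  have "norm (\<integral>x. of_real (w x) * (mode n x * cnj (mode n x)) \<partial>lebesgue_on Omega) \<le> (\<integral>x. 4 \<partial>lebesgue_on Omega)"
  proof (rule order_trans[OF integral_norm_bound], rule integral_mono')
    show "norm (of_real (w x) * (mode n x * cnj (mode n x))) \<le> 4" if "x \<in> space (lebesgue_on Omega)" for x
    proof -
      have x: "norm x \<le> 1" using that by (simp add: Omega_def)
      have "norm (of_real (w x) * (mode n x * cnj (mode n x))) \<le> 1 * (2 * 2)"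
        unfolding norm_mult norm_of_real complex_mod_cnj
        by (intro mult_mono assms mode_bound x) auto
      then show ?thesis by simp
    qed
  qed auto
  then show ?thesis by (simp add: measure_Omega)
qed

lemma mode_norm_le: "(\<integral>x. (norm (mode n x))\<^sup>2 \<partial>lebesgue_on Omega) \<le> 4 * pi"
proof -
  have "norm (complex_of_real (\<integral>x. (norm (mode n x))\<^sup>2 \<partial>lebesgue_on Omega)) \<le> 4 * pi"
    unfolding of_real_integral_norm_square using integral_weight_mode_le[of "\<lambda>_. 1" n] by simp
  then show ?thesis by simp
qed

text \<open>The eigenvalue contributes 2 pi (|n| + 2) and the potential term at most 4 pi, the
  squared bound on the mode times the area. The linear growth in |n| matches the weight of order
  1/2.\<close>

lemma mode_grad_norm_le: "(\<Sum>j\<in>UNIV. \<integral>x. (norm (mode_grad n x $ j))\<^sup>2 \<partial>lebesgue_on Omega) \<le> 2 * pi * (\<bar>of_int n\<bar> + 4)"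
proof -
  have "(\<Sum>j\<in>UNIV. \<integral>x. (norm (mode_grad n x $ j))\<^sup>2 \<partial>lebesgue_on Omega)
      \<le> norm (complex_of_real (\<Sum>j\<in>UNIV. \<integral>x. (norm (mode_grad n x $ j))\<^sup>2 \<partial>lebesgue_on Omega))"
    unfolding norm_of_real by (rule abs_ge_self)
  also have "\<dots> \<le> norm (of_real (2 * pi * eigenvalue n)::complex) + 4 * pi"
    unfolding of_real_sum of_real_integral_norm_square mode_grad_inner
    by (rule order_trans[OF norm_triangle_ineq], rule add_mono)
       (use integral_weight_mode_le[of q n] abs_radial_potential_le[OF \<gamma>] in auto)
  also have "norm (of_real (2 * pi * eigenvalue n)::complex) \<le> 2 * pi * (\<bar>of_int n\<bar> + 2)"
    unfolding norm_of_real abs_mult using abs_eigenvalue_le[of n] by simp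
  finally show ?thesis by (simp add: algebra_simps)
qed

lemma mode_sum_norm_le:
  assumes "finite A"
  shows "(\<integral>x. (norm (\<Sum>n\<in>A. c n * mode n x))\<^sup>2 \<partial>lebesgue_on Omega)
      \<le> 10 * pi * (\<Sum>n\<in>A. (1 + (of_int n)\<^sup>2) powr (1/2) * (norm (c n))\<^sup>2)" (is ?u)
    and "(\<Sum>j\<in>UNIV. \<integral>x. (norm (\<Sum>n\<in>A. c n * mode_grad n x $ j))\<^sup>2 \<partial>lebesgue_on Omega)
      \<le> 10 * pi * (\<Sum>n\<in>A. (1 + (of_int n)\<^sup>2) powr (1/2) * (norm (c n))\<^sup>2)" (is ?p)
proof -
  have w: "1 \<le> (1 + (of_int n)\<^sup>2) powr (1/2 :: real)" "\<bar>of_int n\<bar> \<le> (1 + (of_int n)\<^sup>2) powr (1/2 :: real)" for n :: int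
  proof -
    have "(1 + (of_int n)\<^sup>2) powr (1/2) = sqrt (1 + (of_int n)\<^sup>2)"
      by (simp add: powr_half_sqrt)
    then show "1 \<le> (1 + (of_int n)\<^sup>2) powr (1/2 :: real)" "\<bar>of_int n\<bar> \<le> (1 + (of_int n)\<^sup>2) powr (1/2 :: real)"
      by (auto intro!: real_le_rsqrt)
  qed
  have bound: "(\<Sum>n\<in>A. (norm (c n))\<^sup>2 * X n) \<le> 10 * pi * (\<Sum>n\<in>A. (1 + (of_int n)\<^sup>2) powr (1/2) * (norm (c n))\<^sup>2)"
    if "\<And>n. X n \<le> 10 * pi * (1 + (of_int n)\<^sup>2) powr (1/2)" for X
    unfolding sum_distrib_left
  proof (rule sum_mono)
    fix n
    show "(norm (c n))\<^sup>2 * X n \<le> 10 * pi * ((1 + (of_int n)\<^sup>2) powr (1/2) * (norm (c n))\<^sup>2)"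
      using mult_left_mono[OF that[of n], of "(norm (c n))\<^sup>2"] by (simp add: mult_ac)
  qed
  have "(\<Sum>j\<in>{()}. \<integral>x. (norm (\<Sum>n\<in>A. c n * mode n x))\<^sup>2 \<partial>lebesgue_on Omega)
      = (\<Sum>n\<in>A. (norm (c n))\<^sup>2 * (\<Sum>j\<in>{()}. \<integral>x. (norm (mode n x))\<^sup>2 \<partial>lebesgue_on Omega))"
    by (rule integral_norm_square_orthogonal_sum[OF assms]) (simp_all add: mode_L2 mode_orthogonal)
  moreover have "(\<integral>x. (norm (mode n x))\<^sup>2 \<partial>lebesgue_on Omega) \<le> 10 * pi * (1 + (of_int n)\<^sup>2) powr (1/2)" for n
    using mult_left_mono[OF w(1)[of n], of "10 * pi"] mode_norm_le[of n] pi_gt_zero by linarith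
  ultimately show ?u
    using bound by simp
  have "(\<Sum>j\<in>UNIV. \<integral>x. (norm (\<Sum>n\<in>A. c n * mode_grad n x $ j))\<^sup>2 \<partial>lebesgue_on Omega)
      = (\<Sum>n\<in>A. (norm (c n))\<^sup>2 * (\<Sum>j\<in>UNIV. \<integral>x. (norm (mode_grad n x $ j))\<^sup>2 \<partial>lebesgue_on Omega))"
    by (rule integral_norm_square_orthogonal_sum[OF assms]) (simp_all add: L2_component mode_L2 mode_grad_orthogonal)
  moreover have "(\<Sum>j\<in>UNIV. \<integral>x. (norm (mode_grad n x $ j))\<^sup>2 \<partial>lebesgue_on Omega) \<le> 10 * pi * (1 + (of_int n)\<^sup>2) powr (1/2)" for n
  proof -
    \<comment> \<open>The weight dominates both |n| and 1, so |n| + 4 is at most 5 times the weight;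
      this is the origin of 10 pi.\<close>
    have "2 * pi * (\<bar>of_int n\<bar> + 4) \<le> 2 * pi * (5 * (1 + (of_int n)\<^sup>2) powr (1/2))"
      using w[of n] by (intro mult_left_mono) auto
    also have "\<dots> = 10 * pi * (1 + (of_int n)\<^sup>2) powr (1/2)" by simp
    finally show ?thesis using mode_grad_norm_le[of n] by (rule order_trans[rotated])
  qed
  ultimately show ?p
    using bound by simp
qed

end

section \<open>Square mean convergence of Fourier series\<close>

abbreviation (input) "period \<equiv> lebesgue_on {0..2*pi}"

lemma L2_dist_triangle:
  fixes f g h :: "'a \<Rightarrow> 'b::euclidean_space"
  assumes "f \<in> L2 M" "g \<in> L2 M" "h \<in> L2 M"
  shows "(\<integral>x. (norm (f x - h x))\<^sup>2 \<partial>M) \<le> 2 * (\<integral>x. (norm (f x - g x))\<^sup>2 \<partial>M) + 2 * (\<integral>x. (norm (g x - h x))\<^sup>2 \<partial>M)"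
proof -
  have i: "integrable M (\<lambda>x. (norm (f x - g x))\<^sup>2)" "integrable M (\<lambda>x. (norm (g x - h x))\<^sup>2)"
    "integrable M (\<lambda>x. (norm (f x - h x))\<^sup>2)"
    by (intro L2D(2) L2_diff assms)+
  have "(\<integral>x. (norm (f x - h x))\<^sup>2 \<partial>M) \<le> (\<integral>x. 2 * (norm (f x - g x))\<^sup>2 + 2 * (norm (g x - h x))\<^sup>2 \<partial>M)"
    using norm_add_square_le[of "f x - g x" "g x - h x" for x] i
    by (intro integral_mono) auto
  then show ?thesis using i by simp
qed

text \<open>The inductive form has no degrees to track, and closure under products follows by two
  inductions.\<close>

inductive trig_poly :: "(real \<Rightarrow> complex) \<Rightarrow> bool" where
  mode: "trig_poly (\<lambda>t. c * fourier_mode n t)"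
| add: "trig_poly f \<Longrightarrow> trig_poly g \<Longrightarrow> trig_poly (\<lambda>t. f t + g t)"

lemma trig_poly_const: "trig_poly (\<lambda>t. c)"
  using trig_poly.mode[of c 0] by simp

lemma trig_poly_cmult: "trig_poly f \<Longrightarrow> trig_poly (\<lambda>t. c * f t)"
proof (induction rule: trig_poly.induct)
  case (mode d n)
  then show ?case using trig_poly.mode[of "c * d" n] by (simp add: mult.assoc)
qed (auto simp: distrib_left intro: trig_poly.add)

lemma trig_poly_mult:
  assumes "trig_poly f" "trig_poly g"
  shows "trig_poly (\<lambda>t. f t * g t)"
  using assms(1)
proof (induction rule: trig_poly.induct)
  case (mode c n)
  from assms(2) have "trig_poly (\<lambda>t. fourier_mode n t * g t)"
  proof (induction rule: trig_poly.induct)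
    case (mode d k)
    have "(\<lambda>t. fourier_mode n t * (d * fourier_mode k t)) = (\<lambda>t. d * fourier_mode (n + k) t)"
      by (simp add: fun_eq_iff mult_ac flip: fourier_mode_mult)
    then show ?case by (simp add: trig_poly.mode)
  qed (auto simp: distrib_left intro: trig_poly.add)
  then show ?case
    using trig_poly_cmult by (simp add: mult.assoc)
qed (auto simp: distrib_right intro: trig_poly.add)

lemma trig_poly_continuous: "trig_poly f \<Longrightarrow> continuous_on S f"
  by (induction rule: trig_poly.induct) (auto intro!: continuous_intros continuous_fourier_mode)

text \<open>On the unit circle a real linear functional is a combination of cos and sin, hence of
  e^(it) and e^(-it); sums and products preserve trigonometric polynomials.\<close>

lemma trig_poly_real_polynomial:
  fixes p :: "complex \<Rightarrow> real"
  assumes "real_polynomial_function p"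
  shows "trig_poly (\<lambda>t. of_real (p (cis t)))"
  using assms
proof (induction rule: real_polynomial_function.induct)
  case (linear f)
  interpret bounded_linear f by fact
  have f: "f (cis t) = cos t * f 1 + sin t * f \<i>" for t
  proof -
    have "cis t = cos t *\<^sub>R 1 + sin t *\<^sub>R \<i>"
      by (simp add: complex_eq_iff)
    then show ?thesis by (simp add: add scaleR)
  qed
  have "(\<lambda>t. of_real (f (cis t))) = (\<lambda>t. (of_real (f 1) / 2 - \<i> * of_real (f \<i>) / 2) * fourier_mode 1 t
      + (of_real (f 1) / 2 + \<i> * of_real (f \<i>) / 2) * fourier_mode (- 1) t)"
    by (simp add: fun_eq_iff f fourier_mode_def exp_Euler exp_minus_Euler cos_of_real sin_of_real complex_eq_iff field_simps)
  then show ?case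
    by (simp only:) (intro trig_poly.intros)
qed (auto intro: trig_poly_const trig_poly.add trig_poly_mult)

lemma trig_poly_dense_continuous:
  fixes F :: "complex \<Rightarrow> complex"
  assumes "continuous_on (sphere 0 1) F" "0 < e"
  obtains T where "trig_poly T" "\<And>t. norm (F (cis t) - T t) < e"
proof -
  obtain p where p: "polynomial_function p" "\<And>z. z \<in> sphere 0 1 \<Longrightarrow> norm (F z - p z) < e"
    using Stone_Weierstrass_polynomial_function[OF compact_sphere assms] by blast
  have "real_polynomial_function (Re \<circ> p)" "real_polynomial_function (Im \<circ> p)"
    using p(1) bounded_linear_Re bounded_linear_Im by (auto simp: polynomial_function_def)
  then have "trig_poly (\<lambda>t. of_real (Re (p (cis t))) + \<i> * of_real (Im (p (cis t))))"
    by (intro trig_poly.add trig_poly_cmult) (auto dest: trig_poly_real_polynomial)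
  then have "trig_poly (\<lambda>t. p (cis t))"
    by (simp flip: complex_eq)
  then show ?thesis
    by (rule that) (use p(2) in auto)
qed

text \<open>The factor vanishing at \<open>1\<close> removes the jump of \<open>Arg2pi\<close>.\<close>

lemma continuous_on_sphere_cutoff:
  fixes f :: "real \<Rightarrow> complex"
  assumes f: "continuous_on UNIV f" "\<And>t. norm (f t) \<le> M"
  shows "continuous_on (sphere 0 1) (\<lambda>z. of_real (min 1 (real n * norm (z - 1))) * f (Arg2pi z))"
proof (rule continuous_at_imp_continuous_on, rule ballI)
  fix z :: complex assume z: "z \<in> sphere 0 1"
  show "isCont (\<lambda>z. of_real (min 1 (real n * norm (z - 1))) * f (Arg2pi z)) z"
  proof (cases "z = 1")
    case False
    have "z \<notin> \<real>\<^sub>\<ge>\<^sub>0"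
    proof
      assume "z \<in> \<real>\<^sub>\<ge>\<^sub>0"
      then obtain r where "z = of_real r" "0 \<le> r" by (auto elim: nonneg_Reals_cases)
      then show False using z False by simp
    qed
    then have "isCont Arg2pi z" by (rule continuous_at_Arg2pi)
    moreover have "isCont f (Arg2pi z)"
      using f(1) by (simp add: continuous_on_eq_continuous_at)
    ultimately have "isCont (\<lambda>z. f (Arg2pi z)) z"
      by (rule isCont_o2)
    then show ?thesis
      by (intro continuous_intros)
  next
    case True
    have "(\<lambda>z. of_real (min 1 (real n * norm (z - 1))) * f (Arg2pi z)) \<midarrow>1\<rightarrow> 0"
    proof (rule Lim_null_comparison)
      have M: "0 \<le> M" using f(2)[of 0] norm_ge_zero[of "f 0"] by linarith
      have "norm (of_real (min 1 (real n * norm (z - 1))) * f (Arg2pi z)) \<le> real n * norm (z - 1) * M" for z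
        unfolding norm_mult norm_of_real
        by (rule mult_mono[OF _ f(2)]) auto
      then show "\<forall>\<^sub>F z in at 1. norm (of_real (min 1 (real n * norm (z - 1))) * f (Arg2pi z)) \<le> real n * norm (z - 1) * M"
        by simp
      have "(\<lambda>z::complex. real n * norm (z - 1) * M) \<midarrow>1\<rightarrow> real n * norm (1 - 1 :: complex) * M"
        by (intro tendsto_intros)
      then show "(\<lambda>z::complex. real n * norm (z - 1) * M) \<midarrow>1\<rightarrow> 0" by simp
    qed
    then show ?thesis using True by (simp add: isCont_def)
  qed
qed

text \<open>A measurable function is almost everywhere a limit of continuous ones. Clipping these to
  the bound \<open>M\<close> provides domination, and a cut-off near the point 1 makes them
  continuous on the circle, where Stone-Weierstrass applies.\<close>

lemma trig_poly_dense_bounded: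
  fixes h :: "real \<Rightarrow> complex"
  assumes h: "h \<in> borel_measurable period" "\<And>t. norm (h t) \<le> M" and "0 < M" "0 < e"
  obtains T where "trig_poly T" "(\<integral>t. (norm (h t - T t))\<^sup>2 \<partial>period) < e"
proof -
  interpret finite_measure period by simp
  have "h measurable_on {0..2*pi}"
    using h(1) by (simp add: measurable_on_iff_borel_measurable)
  then obtain N f where N: "negligible N" and f: "\<And>n. continuous_on UNIV (f n)"
    and lim: "\<And>t. t \<notin> N \<Longrightarrow> (\<lambda>n. f n t) \<longlonglongrightarrow> (if t \<in> {0..2*pi} then h t else 0)"
    unfolding measurable_on_def by blast
  \<comment> \<open>The radial retraction of the plane onto the disk of radius \<open>M\<close>; it
    fixes the values of \<open>h\<close>.\<close>
  define clip where "clip y = y / of_real (max 1 (norm y / M))" for y :: complex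
  have clip_cont: "continuous_on S clip" for S
    unfolding clip_def using \<open>0 < M\<close> by (intro continuous_intros) auto
  have clip_bound: "norm (clip y) \<le> M" for y
    using \<open>0 < M\<close> by (auto simp: clip_def norm_divide divide_le_eq max_def field_simps)
  have clip_id: "clip y = y" if "norm y \<le> M" for y
    using that \<open>0 < M\<close> by (simp add: clip_def max_absorb1)
  define F where "F n z = of_real (min 1 (real n * norm (z - 1))) * clip (f n (Arg2pi z))" for n z
  have F_cont: "continuous_on (sphere 0 1) (F n)" for n
    unfolding F_def
    by (rule continuous_on_sphere_cutoff[where M=M])
       (auto intro!: clip_bound continuous_on_compose2[OF clip_cont[of UNIV] f])
  have Fcis_cont: "continuous_on S (\<lambda>t. F n (cis t))" for n S
    by (rule continuous_on_compose2[OF F_cont]) (auto intro!: continuous_intros)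
  have F_bound: "norm (F n z) \<le> M" for n z
  proof -
    have "norm (F n z) \<le> 1 * M"
      unfolding F_def norm_mult norm_of_real by (intro mult_mono clip_bound) auto
    then show ?thesis by simp
  qed
  have F_L2: "(\<lambda>t. F n (cis t)) \<in> L2 period" for n
    by (rule continuous_L2_period[OF Fcis_cont])
  have h_L2: "h \<in> L2 period"
    by (rule L2_bounded[where B=M]) (use h in auto)
  have F_lim: "(\<lambda>n. F n (cis t)) \<longlonglongrightarrow> h t" if t: "t \<notin> N" "0 < t" "t < 2*pi" for t
  proof -
    have arg: "Arg2pi (cis t) = t"
      using Arg2pi_exp[of "\<i> * of_real t"] t by (simp add: cis_conv_exp)
    have "cis t \<noteq> 1"
    proof
      assume "cis t = 1"
      then have "Arg2pi (cis t) = 0" by (simp add: Arg2pi_eq_0)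
      then show False using arg t by simp
    qed
    then have pos: "0 < norm (cis t - 1)" by simp
    obtain n0 :: nat where n0: "1 / norm (cis t - 1) \<le> real n0"
      using real_arch_simple by blast
    have "\<forall>\<^sub>F n in sequentially. F n (cis t) = clip (f n t)"
      using eventually_ge_at_top[of n0]
    proof eventually_elim
      case (elim n)
      have "1 \<le> real n0 * norm (cis t - 1)"
        using n0 pos by (simp add: divide_le_eq)
      also have "\<dots> \<le> real n * norm (cis t - 1)"
        using elim by (intro mult_right_mono) auto
      finally show ?case by (simp add: F_def arg)
    qed
    moreover have "(\<lambda>n. clip (f n t)) \<longlonglongrightarrow> clip (h t)"
    proof (rule isCont_tendsto_compose[of _ clip])
      show "isCont clip (h t)"
        using clip_cont[of UNIV] by (simp add: continuous_on_eq_continuous_at)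
      show "(\<lambda>n. f n t) \<longlonglongrightarrow> h t"
        using lim[OF t(1)] t by simp
    qed
    ultimately show ?thesis
      using clip_id[OF h(2)] by (simp add: tendsto_cong)
  qed
  have "(\<lambda>n. \<integral>t. (norm (h t - F n (cis t)))\<^sup>2 \<partial>period) \<longlonglongrightarrow> (\<integral>t. 0 \<partial>period)"
  proof (rule integral_dominated_convergence[where w="\<lambda>t. (2 * M)\<^sup>2"])
    \<comment> \<open>The endpoints join the exceptional set: there the cut-off is zero for every n,
      so the approximants cannot reach \<open>h\<close>.\<close>
    have "N \<union> {0, 2*pi} \<in> null_sets lebesgue"
      using N by (intro null_sets.Un) (auto simp: negligible_iff_null_sets[symmetric])
    then have "AE t in lebesgue. t \<notin> N \<union> {0, 2*pi}"
      by (rule AE_not_in)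
    then have ae: "AE t in period. t \<notin> N \<union> {0, 2*pi}"
      by (subst AE_restrict_space_iff) (auto elim: eventually_mono)
    show "AE t in period. (\<lambda>n. (norm (h t - F n (cis t)))\<^sup>2) \<longlonglongrightarrow> 0"
      using ae AE_space[of period]
    proof eventually_elim
      case (elim t)
      then have "(\<lambda>n. F n (cis t)) \<longlonglongrightarrow> h t" by (intro F_lim) auto
      then have "(\<lambda>n. (norm (h t - F n (cis t)))\<^sup>2) \<longlonglongrightarrow> (norm (h t - h t))\<^sup>2"
        by (intro tendsto_intros)
      then show ?case by simp
    qed
    have "norm ((norm (h t - F n (cis t)))\<^sup>2) \<le> (2 * M)\<^sup>2" for n t
    proof -
      have "norm (h t - F n (cis t)) \<le> 2 * M"
        using norm_triangle_ineq4[of "h t" "F n (cis t)"] h(2)[of t] F_bound[of n "cis t"] by linarith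
      then have "(norm (h t - F n (cis t)))\<^sup>2 \<le> (2 * M)\<^sup>2"
        by (intro power_mono) auto
      then show ?thesis by simp
    qed
    then show "AE t in period. norm ((norm (h t - F n (cis t)))\<^sup>2) \<le> (2 * M)\<^sup>2" for n
      by simp
  qed (use L2D(1)[OF L2_diff[OF h_L2 F_L2]] in auto)
  then have "\<forall>\<^sub>F n in sequentially. (\<integral>t. (norm (h t - F n (cis t)))\<^sup>2 \<partial>period) < e / 4"
    using \<open>0 < e\<close> by (intro order_tendstoD(2)) auto
  then obtain n where n: "(\<integral>t. (norm (h t - F n (cis t)))\<^sup>2 \<partial>period) < e / 4"
    by (auto dest: eventually_happens)
  \<comment> \<open>The uniform error squared times the length 2 pi is e/8. With the previous error
    below e/4, the doubled sum stays below 3e/4.\<close>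
  obtain T where T: "trig_poly T" "\<And>t. norm (F n (cis t) - T t) < sqrt (e / (16 * pi))"
    using trig_poly_dense_continuous[OF F_cont] \<open>0 < e\<close> by (metis divide_pos_pos mult_pos_pos pi_gt_zero real_sqrt_gt_0_iff zero_less_numeral)
  have T_L2: "T \<in> L2 period"
    by (rule continuous_L2_period[OF trig_poly_continuous[OF T(1)]])
  have "(\<integral>t. (norm (F n (cis t) - T t))\<^sup>2 \<partial>period) \<le> (\<integral>t. e / (16 * pi) \<partial>period)"
  proof (rule integral_mono')
    fix t
    have "(norm (F n (cis t) - T t))\<^sup>2 \<le> (sqrt (e / (16 * pi)))\<^sup>2"
      using T(2)[of t] by (intro power_mono) auto
    then show "(norm (F n (cis t) - T t))\<^sup>2 \<le> e / (16 * pi)"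
      using \<open>0 < e\<close> by simp
  qed (use \<open>0 < e\<close> in auto)
  also have "\<dots> = e / 8"
    by (simp add: measure_restrict_space)
  finally have "(\<integral>t. (norm (h t - T t))\<^sup>2 \<partial>period) < e"
    using L2_dist_triangle[OF h_L2 F_L2[of n] T_L2] n \<open>0 < e\<close> by linarith
  then show ?thesis using that T(1) by blast
qed

text \<open>Setting \<open>g\<close> to zero where it is large reduces to the bounded case. Each of
  the two errors is below e/4, and the triangle estimate for squares doubles their sum.\<close>

lemma trig_poly_dense_L2:
  fixes g :: "real \<Rightarrow> complex"
  assumes g: "g \<in> L2 period" and "0 < e"
  obtains T where "trig_poly T" "(\<integral>t. (norm (g t - T t))\<^sup>2 \<partial>period) < e"
proof -
  note [measurable] = L2D(1)[OF g]
  define h where "h n t = (if norm (g t) \<le> real (Suc n) then g t else 0)" for n t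
  have h_meas: "h n \<in> borel_measurable period" for n
    unfolding h_def by measurable
  have h_bound: "norm (h n t) \<le> real (Suc n)" for n t
    unfolding h_def by simp
  have h_L2: "h n \<in> L2 period" for n
    by (rule L2_bounded[OF _ h_meas h_bound]) simp
  have "(\<lambda>n. \<integral>t. (norm (g t - h n t))\<^sup>2 \<partial>period) \<longlonglongrightarrow> (\<integral>t. 0 \<partial>period)"
  proof (rule integral_dominated_convergence[where w="\<lambda>t. (norm (g t))\<^sup>2"])
    have "(\<lambda>n. (norm (g t - h n t))\<^sup>2) \<longlonglongrightarrow> 0" for t
    proof (rule tendsto_eventually)
      obtain n0 where "norm (g t) \<le> real n0" using real_arch_simple by blast
      then show "\<forall>\<^sub>F n in sequentially. (norm (g t - h n t))\<^sup>2 = 0"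
        by (intro eventually_sequentiallyI[of n0]) (auto simp: h_def)
    qed
    then show "AE t in period. (\<lambda>n. (norm (g t - h n t))\<^sup>2) \<longlonglongrightarrow> 0" by simp
    show "AE t in period. norm ((norm (g t - h n t))\<^sup>2) \<le> (norm (g t))\<^sup>2" for n
      by (auto simp: h_def)
  qed (use L2D(2)[OF g] h_meas in auto)
  then have "\<forall>\<^sub>F n in sequentially. (\<integral>t. (norm (g t - h n t))\<^sup>2 \<partial>period) < e / 4"
    using \<open>0 < e\<close> by (intro order_tendstoD(2)) auto
  then obtain n where n: "(\<integral>t. (norm (g t - h n t))\<^sup>2 \<partial>period) < e / 4"
    by (auto dest: eventually_happens)
  obtain T where T: "trig_poly T" "(\<integral>t. (norm (h n t - T t))\<^sup>2 \<partial>period) < e / 4"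
    by (rule trig_poly_dense_bounded[OF h_meas h_bound, of n "e / 4"]) (use \<open>0 < e\<close> in auto)
  have T_L2: "T \<in> L2 period"
    by (rule continuous_L2_period[OF trig_poly_continuous[OF T(1)]])
  have "(\<integral>t. (norm (g t - T t))\<^sup>2 \<partial>period) < e"
    using L2_dist_triangle[OF g h_L2[of n] T_L2] n T(2) by linarith
  then show ?thesis using that T(1) by blast
qed

section \<open>Partial sums of Fourier series as orthogonal projections\<close>

definition fourier_sum :: "(real \<Rightarrow> complex) \<Rightarrow> nat \<Rightarrow> real \<Rightarrow> complex" where
  "fourier_sum g N t = (\<Sum>n\<in>{-int N..int N}. fourier_coeff g n * fourier_mode n t)"

lemma fourier_mode_L2: "fourier_mode n \<in> L2 period"
  by (rule continuous_L2_period[OF continuous_fourier_mode])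

lemma fourier_coeff_add:
  assumes "f \<in> L2 period" "g \<in> L2 period"
  shows "fourier_coeff (\<lambda>t. f t + g t) n = fourier_coeff f n + fourier_coeff g n"
  using L2_mult_integrable[OF assms(1) fourier_mode_L2[of "- n"]] L2_mult_integrable[OF assms(2) fourier_mode_L2[of "- n"]]
  by (simp add: fourier_coeff_def distrib_right distrib_left)

lemma fourier_coeff_cmult: "fourier_coeff (\<lambda>t. c * f t) n = c * fourier_coeff f n"
  by (simp add: fourier_coeff_def mult.assoc)

lemma fourier_coeff_mode: "fourier_coeff (fourier_mode k) n = (if n = k then 1 else 0)"
  by (simp add: fourier_coeff_def fourier_mode_mult integral_fourier_mode)

lemma fourier_sum_add:
  assumes "f \<in> L2 period" "g \<in> L2 period"
  shows "fourier_sum (\<lambda>t. f t + g t) N t = fourier_sum f N t + fourier_sum g N t"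
  by (simp add: fourier_sum_def fourier_coeff_add[OF assms] distrib_right sum.distrib)

lemma fourier_sum_continuous: "continuous_on S (fourier_sum g N)"
  unfolding fourier_sum_def[abs_def] by (intro continuous_intros continuous_fourier_mode)

lemma fourier_sum_L2: "fourier_sum g N \<in> L2 period"
  by (rule continuous_L2_period[OF fourier_sum_continuous])

lemma fourier_sum_trig_poly:
  assumes "trig_poly T"
  shows "\<forall>\<^sub>F N in sequentially. \<forall>t. fourier_sum T N t = T t"
  using assms
proof (induction rule: trig_poly.induct)
  case (mode c k)
  show ?case
  proof (rule eventually_sequentiallyI[of "nat \<bar>k\<bar>"], rule allI)
    fix N t assume N: "nat \<bar>k\<bar> \<le> N"
    have "fourier_sum (\<lambda>t. c * fourier_mode k t) N t = (\<Sum>n\<in>{-int N..int N}. if n = k then c * fourier_mode k t else 0)"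
      unfolding fourier_sum_def fourier_coeff_cmult fourier_coeff_mode by (rule sum.cong) auto
    also have "\<dots> = c * fourier_mode k t"
      using N by (subst sum.delta) auto
    finally show "fourier_sum (\<lambda>t. c * fourier_mode k t) N t = c * fourier_mode k t" .
  qed
next
  case (add f g)
  then have L2: "f \<in> L2 period" "g \<in> L2 period"
    by (auto intro!: continuous_L2_period trig_poly_continuous)
  from add.IH show ?case
    by eventually_elim (simp add: fourier_sum_add[OF L2])
qed

text \<open>The remainder is orthogonal to the partial sum, so Pythagoras applies. The point is that
  the map to the remainder is a contraction for every \<open>N\<close>.\<close>

lemma fourier_sum_bessel:
  assumes f: "f \<in> L2 period"
  shows "(\<integral>t. (norm (f t - fourier_sum f N t))\<^sup>2 \<partial>period) \<le> (\<integral>t. (norm (f t))\<^sup>2 \<partial>period)"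
proof -
  define r where "r t = f t - fourier_sum f N t" for t
  let ?S = "fourier_sum f N"
  have L2: "r \<in> L2 period" "?S \<in> L2 period"
    unfolding r_def by (intro L2_diff f fourier_sum_L2)+
  have coeff_r: "(\<integral>t. r t * fourier_mode (- n) t \<partial>period) = 0" if n: "n \<in> {-int N..int N}" for n
  proof -
    have "(\<integral>t. f t * fourier_mode (- n) t \<partial>period) = 2 * pi * fourier_coeff f n"
      by (simp add: fourier_coeff_def)
    moreover have "(\<integral>t. ?S t * fourier_mode (- n) t \<partial>period) = 2 * pi * fourier_coeff f n"
    proof -
      have "(\<integral>t. ?S t * fourier_mode (- n) t \<partial>period)
          = (\<integral>t. (\<Sum>k\<in>{-int N..int N}. fourier_coeff f k * (fourier_mode k t * fourier_mode (- n) t)) \<partial>period)"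
        by (simp add: fourier_sum_def sum_distrib_right mult.assoc)
      also have "\<dots> = (\<Sum>k\<in>{-int N..int N}. fourier_coeff f k * (\<integral>t. fourier_mode k t * fourier_mode (- n) t \<partial>period))"
        by (simp add: Bochner_Integration.integral_sum L2_mult_integrable fourier_mode_L2)
      also have "\<dots> = (\<Sum>k\<in>{-int N..int N}. if k = n then 2 * pi * fourier_coeff f n else 0)"
        by (rule sum.cong) (auto simp: fourier_mode_mult integral_fourier_mode)
      also have "\<dots> = 2 * pi * fourier_coeff f n"
        using n by (subst sum.delta) auto
      finally show ?thesis .
    qed
    ultimately show ?thesis
      by (simp add: r_def left_diff_distrib L2_mult_integrable f fourier_sum_L2 fourier_mode_L2)
  qed
  have orth: "(\<integral>t. r t * cnj (?S t) \<partial>period) = 0"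
  proof -
    have "(\<integral>t. r t * cnj (?S t) \<partial>period)
        = (\<integral>t. (\<Sum>n\<in>{-int N..int N}. cnj (fourier_coeff f n) * (r t * fourier_mode (- n) t)) \<partial>period)"
      by (simp add: fourier_sum_def cnj_sum cnj_fourier_mode sum_distrib_left mult_ac)
    also have "\<dots> = (\<Sum>n\<in>{-int N..int N}. cnj (fourier_coeff f n) * (\<integral>t. r t * fourier_mode (- n) t \<partial>period))"
      by (simp add: Bochner_Integration.integral_sum L2_mult_integrable L2 fourier_mode_L2)
    also have "\<dots> = 0" by (rule sum.neutral) (simp add: coeff_r)
    finally show ?thesis .
  qed
  have eq: "(norm (f t))\<^sup>2 = (norm (r t))\<^sup>2 + (norm (?S t))\<^sup>2 + 2 * Re (r t * cnj (?S t))" for t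
  proof -
    have "f t = r t + ?S t" by (simp add: r_def)
    then show ?thesis
      by (simp add: cmod_power2) (simp add: power2_eq_square algebra_simps)
  qed
  have int: "integrable period (\<lambda>t. r t * cnj (?S t))"
    by (intro L2_mult_integrable cnj_L2 L2)
  define \<rho> where "\<rho> t = Re (r t * cnj (?S t))" for t
  have rho: "integrable period \<rho>" "(\<integral>t. \<rho> t \<partial>period) = 0"
    unfolding \<rho>_def using integrable_Re[OF int] integral_Re[OF int] orth by simp_all
  have "(\<integral>t. (norm (f t))\<^sup>2 \<partial>period) = (\<integral>t. (norm (r t))\<^sup>2 + (norm (?S t))\<^sup>2 + 2 * \<rho> t \<partial>period)"
    unfolding eq \<rho>_def ..
  also have "\<dots> = (\<integral>t. (norm (r t))\<^sup>2 \<partial>period) + (\<integral>t. (norm (?S t))\<^sup>2 \<partial>period)"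
    using L2D(2)[OF L2(1)] L2D(2)[OF L2(2)] rho by simp
  finally show ?thesis
    by (simp add: r_def)
qed

text \<open>The remainder map eventually annihilates an approximating trigonometric polynomial
  \<open>T\<close>, so the remainder of g is that of g - T, which the contraction keeps
  small.\<close>

lemma fourier_sum_tendsto_L2:
  assumes g: "g \<in> L2 period"
  shows "(\<lambda>N. L2_norm period (\<lambda>t. fourier_sum g N t - g t)) \<longlonglongrightarrow> 0"
proof -
  have "(\<lambda>N. \<integral>t. (norm (fourier_sum g N t - g t))\<^sup>2 \<partial>period) \<longlonglongrightarrow> 0"
  proof (rule tendstoI)
    fix e :: real assume "0 < e"
    obtain T where T: "trig_poly T" "(\<integral>t. (norm (g t - T t))\<^sup>2 \<partial>period) < e"
      by (rule trig_poly_dense_L2[OF g \<open>0 < e\<close>])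
    have T_L2: "T \<in> L2 period"
      by (rule continuous_L2_period[OF trig_poly_continuous[OF T(1)]])
    from fourier_sum_trig_poly[OF T(1)]
    show "\<forall>\<^sub>F N in sequentially. dist (\<integral>t. (norm (fourier_sum g N t - g t))\<^sup>2 \<partial>period) 0 < e"
    proof eventually_elim
      case (elim N)
      have "fourier_sum g N t = fourier_sum (\<lambda>t. g t - T t) N t + T t" for t
        using fourier_sum_add[OF L2_diff[OF g T_L2] T_L2, of N t] elim by simp
      then have "(\<integral>t. (norm (fourier_sum g N t - g t))\<^sup>2 \<partial>period)
          = (\<integral>t. (norm ((g t - T t) - fourier_sum (\<lambda>t. g t - T t) N t))\<^sup>2 \<partial>period)"
        by (intro Bochner_Integration.integral_cong refl) (simp add: norm_minus_commute algebra_simps)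
      also have "\<dots> \<le> (\<integral>t. (norm (g t - T t))\<^sup>2 \<partial>period)"
        by (rule fourier_sum_bessel[OF L2_diff[OF g T_L2]])
      finally show ?case using T(2) by simp
    qed
  qed
  then show ?thesis
    unfolding L2_norm_def using tendsto_real_sqrt by fastforce
qed

section \<open>The Dirichlet problem\<close>

text \<open>Meant for increments between partial sums: with the lower index fixed and the upper one
  tending to infinity, a uniform bound passes to the pointwise limit.\<close>

lemma L2_fatou:
  fixes F :: "nat \<Rightarrow> 'a \<Rightarrow> 'b::euclidean_space"
  assumes F: "\<And>k. F k \<in> L2 M" and f: "f \<in> borel_measurable M"
    and lim: "\<And>x. x \<in> space M \<Longrightarrow> (\<lambda>k. F k x) \<longlonglongrightarrow> f x"
    and le: "\<And>k. k \<ge> m \<Longrightarrow> (\<integral>x. (norm (F k x))\<^sup>2 \<partial>M) \<le> B"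
  shows "f \<in> L2 M" "(\<integral>x. (norm (f x))\<^sup>2 \<partial>M) \<le> B"
proof -
  note [measurable] = L2D(1)[OF F] f
  have B: "0 \<le> B"
    using le[OF order_refl] by (rule order_trans[rotated]) simp
  have nn: "(\<integral>\<^sup>+x. ennreal ((norm (F k x))\<^sup>2) \<partial>M) \<le> ennreal B" if "k \<ge> m" for k
    using le[OF that] by (subst nn_integral_eq_integral[OF L2D(2)[OF F]]) (auto intro: ennreal_leI)
  have "(\<integral>\<^sup>+x. ennreal ((norm (f x))\<^sup>2) \<partial>M) = (\<integral>\<^sup>+x. liminf (\<lambda>k. ennreal ((norm (F k x))\<^sup>2)) \<partial>M)"
  proof (rule nn_integral_cong)
    fix x assume "x \<in> space M"
    then have "(\<lambda>k. ennreal ((norm (F k x))\<^sup>2)) \<longlonglongrightarrow> ennreal ((norm (f x))\<^sup>2)"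
      by (intro tendsto_ennrealI tendsto_intros lim)
    then show "ennreal ((norm (f x))\<^sup>2) = liminf (\<lambda>k. ennreal ((norm (F k x))\<^sup>2))"
      by (intro lim_imp_Liminf[symmetric]) auto
  qed
  also have "\<dots> \<le> liminf (\<lambda>k. \<integral>\<^sup>+x. ennreal ((norm (F k x))\<^sup>2) \<partial>M)"
    by (rule nn_integral_liminf) measurable
  also have "\<dots> \<le> ennreal B"
    by (rule order_trans[OF Liminf_mono[of _ "\<lambda>_. ennreal B"]])
       (auto intro!: eventually_sequentiallyI[of m] nn simp: Liminf_const)
  finally have bound: "(\<integral>\<^sup>+x. ennreal ((norm (f x))\<^sup>2) \<partial>M) \<le> ennreal B" .
  have int: "integrable M (\<lambda>x. (norm (f x))\<^sup>2)"
    by (rule integrableI_bounded) (use bound in \<open>auto intro: le_less_trans\<close>)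
  then show "f \<in> L2 M" by (intro L2I f)
  show "(\<integral>x. (norm (f x))\<^sup>2 \<partial>M) \<le> B"
    using bound B by (subst (asm) nn_integral_eq_integral[OF int]) (auto simp: ennreal_le_iff)
qed

lemma convergent_if_summable_increments:
  fixes s :: "nat \<Rightarrow> 'a::banach"
  assumes "summable a" "\<And>n. norm (s (Suc n) - s n) \<le> a n"
  shows "convergent s"
proof -
  have "summable (\<lambda>n. s (Suc n) - s n)"
    by (rule summable_comparison_test'[OF assms(1)]) (use assms(2) in auto)
  then have "(\<lambda>N. \<Sum>n<N. s (Suc n) - s n) \<longlonglongrightarrow> (\<Sum>n. s (Suc n) - s n)"
    by (rule summable_LIMSEQ)
  then have "(\<lambda>N. (s N - s 0) + s 0) \<longlonglongrightarrow> (\<Sum>n. s (Suc n) - s n) + s 0"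
    unfolding sum_lessThan_telescope by (intro tendsto_intros)
  then show ?thesis by (auto simp: convergent_def)
qed

lemma sum_symmetric_interval_Suc:
  fixes f :: "int \<Rightarrow> 'a::comm_monoid_add"
  shows "(\<Sum>n\<in>{-int (Suc N)..int (Suc N)}. f n) = (\<Sum>n\<in>{-int N..int N}. f n) + (f (int (Suc N)) + f (- int (Suc N)))"
proof -
  have "{-int (Suc N)..int (Suc N)} = insert (int (Suc N)) (insert (- int (Suc N)) {-int N..int N})"
    by auto
  then show ?thesis by (simp add: ac_simps)
qed

lemma C1_gradient_sum:
  assumes "finite A" "\<And>n. n \<in> A \<Longrightarrow> C1_gradient (f n) (df n)"
  shows "C1_gradient (\<lambda>x. \<Sum>n\<in>A. c n * f n x) (\<lambda>x. \<chi> j. \<Sum>n\<in>A. c n * df n x $ j)"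
  unfolding C1_gradient_def
proof (intro conjI allI)
  fix x
  have "((\<lambda>x. \<Sum>n\<in>A. c n * f n x) has_derivative (\<lambda>h. \<Sum>n\<in>A. c n * (\<Sum>j\<in>UNIV. of_real (h $ j) * df n x $ j))) (at x)"
    using assms(2) by (intro has_derivative_sum has_derivative_mult_right) (auto simp: C1_gradient_def)
  then show "((\<lambda>x. \<Sum>n\<in>A. c n * f n x) has_derivative
      (\<lambda>h. \<Sum>j\<in>UNIV. of_real (h $ j) * (\<chi> j. \<Sum>n\<in>A. c n * df n x $ j) $ j)) (at x)"
    by (rule has_derivative_eq_rhs)
       (simp add: fun_eq_iff sum_2 sum_distrib_left sum.distrib algebra_simps)
next
  have "continuous_on UNIV (df n)" if "n \<in> A" for n
    using C1_gradient_continuous(2) assms(2) that by blast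
  then show "continuous_on UNIV (\<lambda>x. \<chi> j. \<Sum>n\<in>A. c n * df n x $ j)"
    by (intro continuous_intros) auto
qed

lemma energy_sum:
  assumes A: "finite A" and L2: "\<And>n. n \<in> A \<Longrightarrow> f n \<in> L2 (lebesgue_on Omega)" "\<And>n. n \<in> A \<Longrightarrow> df n \<in> L2 (lebesgue_on Omega)"
      "v \<in> L2 (lebesgue_on Omega)" "w \<in> L2 (lebesgue_on Omega)"
    and q: "q \<in> borel_measurable borel" "\<And>x. \<bar>q x\<bar> \<le> B"
  shows "energy q (\<lambda>x. \<Sum>n\<in>A. c n * f n x) (\<lambda>x. \<chi> j. \<Sum>n\<in>A. c n * df n x $ j) v w = (\<Sum>n\<in>A. c n * energy q (f n) (df n) v w)"
proof -
  have qv: "(\<lambda>x. of_real (q x) * v x) \<in> L2 (lebesgue_on Omega)"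
    using q by (intro L2_mult_bounded[where B=B] L2) auto
  have int: "integrable (lebesgue_on Omega) (\<lambda>x. (\<Sum>j\<in>UNIV. df n x $ j * w x $ j) - of_real (q x) * f n x * v x)" if "n \<in> A" for n
  proof -
    have "integrable (lebesgue_on Omega) (\<lambda>x. f n x * (of_real (q x) * v x))"
      by (intro L2_mult_integrable L2 qv that)
    then have qfv: "integrable (lebesgue_on Omega) (\<lambda>x. of_real (q x) * f n x * v x)"
      by (simp add: mult_ac)
    show ?thesis
      by (rule Bochner_Integration.integrable_diff[OF _ qfv])
         (intro Bochner_Integration.integrable_sum L2_mult_integrable L2_component L2 that)
  qed
  have "energy q (\<lambda>x. \<Sum>n\<in>A. c n * f n x) (\<lambda>x. \<chi> j. \<Sum>n\<in>A. c n * df n x $ j) v w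
      = (\<integral>x. (\<Sum>n\<in>A. c n * ((\<Sum>j\<in>UNIV. df n x $ j * w x $ j) - of_real (q x) * f n x * v x)) \<partial>lebesgue_on Omega)"
    unfolding energy_def
    by (rule Bochner_Integration.integral_cong)
       (simp_all add: sum_2 sum_distrib_left sum_distrib_right sum.distrib sum_subtractf algebra_simps)
  also have "\<dots> = (\<Sum>n\<in>A. c n * energy q (f n) (df n) v w)"
    unfolding energy_def
    by (simp add: Bochner_Integration.integral_sum int)
  finally show ?thesis .
qed

lemma norm_vec_square:
  fixes v :: "complex^2"
  shows "(norm v)\<^sup>2 = (\<Sum>j\<in>UNIV. (norm (v $ j))\<^sup>2)"
  by (simp add: norm_vec_def L2_set_def sum_nonneg)

lemma bounded_fourier_coeff:
  assumes "g \<in> H_half"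
  shows "norm (fourier_coeff g n) \<le> H_per_norm (1/2) (fourier_coeff g)"
proof -
  let ?w = "\<lambda>n::int. (1 + (of_int n)\<^sup>2) powr (1/2) * (cmod (fourier_coeff g n))\<^sup>2"
  have sum: "?w summable_on UNIV"
    using assms by (simp add: H_half_def H_per_def)
  have "1 \<le> (1 + (of_int n)\<^sup>2) powr (1/2 :: real)"
    by (simp add: powr_half_sqrt)
  then have "1 * (cmod (fourier_coeff g n))\<^sup>2 \<le> ?w n"
    by (intro mult_right_mono) auto
  also have "\<dots> \<le> infsum ?w UNIV"
    using finite_sum_le_infsum[OF sum, of "{n}"] by simp
  finally show ?thesis
    unfolding H_per_norm_def by (intro real_le_rsqrt) simp
qed

section \<open>Convergence of the mode series to a weak solution\<close>

context disk_profile
begin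

lemma eigenvalue_uminus: "eigenvalue (- n) = eigenvalue n"
  by (simp add: eigenvalue_def)

definition mode_sum :: "(real \<Rightarrow> complex) \<Rightarrow> nat \<Rightarrow> real^2 \<Rightarrow> complex" where
  "mode_sum g N x = (\<Sum>n\<in>{-int N..int N}. fourier_coeff g n * mode n x)"

definition mode_grad_sum :: "(real \<Rightarrow> complex) \<Rightarrow> nat \<Rightarrow> real^2 \<Rightarrow> complex^2" where
  "mode_grad_sum g N x = (\<chi> j. \<Sum>n\<in>{-int N..int N}. fourier_coeff g n * mode_grad n x $ j)"

lemma mode_sum_C1: "C1_gradient (mode_sum g N) (mode_grad_sum g N)"
  unfolding mode_sum_def[abs_def] mode_grad_sum_def[abs_def]
  by (rule C1_gradient_sum) (auto simp: mode_C1)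

lemma mode_sum_circle: "mode_sum g N (circle_point t) = fourier_sum g N t"
  by (simp add: mode_sum_def fourier_sum_def mode_circle)

text \<open>Bounded coefficients times |x|^|n| give a geometric series. The limit thus exists at
  every interior point and serves as the solution itself, in place of an abstract limit in a
  complete L^2 space.\<close>

lemma mode_sum_convergent:
  assumes g: "g \<in> H_half" and x: "x \<in> Omega"
  shows "convergent (\<lambda>N. mode_sum g N x)"
proof (rule convergent_if_summable_increments)
  let ?C = "H_per_norm (1/2) (fourier_coeff g)" and ?r = "norm x"
  have r: "?r < 1" using x by (simp add: Omega_def)
  show "summable (\<lambda>n. 4 * ?C * ?r ^ Suc n)"
    using r by (intro summable_mult) (simp add: summable_geometric summable_mult)
  fix N
  have le: "norm (fourier_coeff g n * mode n x) \<le> ?C * (2 * ?r ^ nat \<bar>n\<bar>)" for n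
    unfolding norm_mult using r norm_mode_le[of x n] bounded_fourier_coeff[OF g, of n]
    by (intro mult_mono order_trans[OF norm_ge_zero bounded_fourier_coeff[OF g, of n]]) auto
  have "norm (mode_sum g (Suc N) x - mode_sum g N x)
      = norm (fourier_coeff g (int (Suc N)) * mode (int (Suc N)) x + fourier_coeff g (- int (Suc N)) * mode (- int (Suc N)) x)"
    unfolding mode_sum_def sum_symmetric_interval_Suc by simp
  also have "\<dots> \<le> ?C * (2 * ?r ^ Suc N) + ?C * (2 * ?r ^ Suc N)"
    using le[of "int (Suc N)"] le[of "- int (Suc N)"]
    by (intro order_trans[OF norm_triangle_ineq] add_mono) (simp_all add: nat_add_distrib)
  finally show "norm (mode_sum g (Suc N) x - mode_sum g N x) \<le> 4 * ?C * ?r ^ Suc N"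
    by (simp add: mult_ac)
qed

lemma mode_grad_sum_convergent:
  assumes g: "g \<in> H_half" and x: "x \<in> Omega"
  shows "convergent (\<lambda>N. mode_grad_sum g N x)"
proof (rule convergent_if_summable_increments)
  let ?C = "H_per_norm (1/2) (fourier_coeff g)" and ?r = "norm x"
  let ?b = "\<lambda>N. 4 * real (Suc N) * ?r ^ N + 4 * ?r ^ Suc N"
  have r: "?r < 1" using x by (simp add: Omega_def)
  \<comment> \<open>The differentiated geometric series handles the linear factor |n| in the
    gradient bound.\<close>
  have "summable (\<lambda>n. diffs (\<lambda>_. 1) n * ?r ^ n)"
    by (rule termdiff_converges[of _ 1]) (use r in \<open>auto intro: summable_geometric\<close>)
  then have 1: "summable (\<lambda>n. 4 * (real (Suc n) * ?r ^ n))"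
    by (intro summable_mult) (simp add: diffs_def)
  have 2: "summable (\<lambda>n. 4 * (?r * ?r ^ n))"
    using r by (intro summable_mult summable_geometric) auto
  have "summable ?b"
    using summable_add[OF 1 2] by (simp only: mult.assoc power_Suc)
  then show "summable (\<lambda>N. 4 * ?C * ?b N)"
    by (rule summable_mult)
  fix N
  have C: "0 \<le> ?C" by (simp add: H_per_norm_def infsum_nonneg)
  have le: "norm (fourier_coeff g n * mode_grad n x $ j) \<le> ?C * ?b N" if "nat \<bar>n\<bar> = Suc N" for n j
  proof -
    have "norm (mode_grad n x $ j) \<le> norm (mode_grad n x)"
      by (rule Finite_Cartesian_Product.norm_nth_le)
    also have "\<dots> \<le> ?b N"
      using norm_mode_grad_le[of x n] r that by simp
    finally show ?thesis
      unfolding norm_mult using bounded_fourier_coeff[OF g, of n] C by (intro mult_mono) auto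
  qed
  have comp: "norm ((mode_grad_sum g (Suc N) x - mode_grad_sum g N x) $ j) \<le> 2 * (?C * ?b N)" for j
  proof -
    have "norm ((mode_grad_sum g (Suc N) x - mode_grad_sum g N x) $ j)
      = norm (fourier_coeff g (int (Suc N)) * mode_grad (int (Suc N)) x $ j + fourier_coeff g (- int (Suc N)) * mode_grad (- int (Suc N)) x $ j)"
      unfolding mode_grad_sum_def sum_symmetric_interval_Suc by simp
    also have "\<dots> \<le> ?C * ?b N + ?C * ?b N"
      by (intro order_trans[OF norm_triangle_ineq] add_mono le) auto
    finally show ?thesis by simp
  qed
  have "norm (mode_grad_sum g (Suc N) x - mode_grad_sum g N x)
      \<le> (\<Sum>j\<in>UNIV. norm ((mode_grad_sum g (Suc N) x - mode_grad_sum g N x) $ j))"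
    by (simp add: norm_vec_def L2_set_le_sum)
  also have "\<dots> \<le> 4 * ?C * ?b N"
    using comp[of 1] comp[of 2] by (simp add: sum_2)
  finally show "norm (mode_grad_sum g (Suc N) x - mode_grad_sum g N x) \<le> 4 * ?C * ?b N" .
qed

text \<open>Convergence is established only inside the open disk; elsewhere \<open>lim\<close> may
  be an arbitrary value, which no integral over \<open>Omega\<close> sees.\<close>

definition solution :: "(real \<Rightarrow> complex) \<Rightarrow> real^2 \<Rightarrow> complex" where
  "solution g x = lim (\<lambda>N. mode_sum g N x)"

definition solution_grad :: "(real \<Rightarrow> complex) \<Rightarrow> real^2 \<Rightarrow> complex^2" where
  "solution_grad g x = lim (\<lambda>N. mode_grad_sum g N x)"

text \<open>The part of the squared H^(1/2) norm carried by the frequencies beyond N.\<close>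

definition fourier_tail :: "(real \<Rightarrow> complex) \<Rightarrow> nat \<Rightarrow> real" where
  "fourier_tail g N = (\<Sum>\<^sub>\<infinity>n. (1 + (of_int n)\<^sup>2) powr (1/2) * (cmod (fourier_coeff g n))\<^sup>2)
     - (\<Sum>n\<in>{-int N..int N}. (1 + (of_int n)\<^sup>2) powr (1/2) * (cmod (fourier_coeff g n))\<^sup>2)"

lemma fourier_tail_tendsto:
  assumes "g \<in> H_half"
  shows "fourier_tail g \<longlonglongrightarrow> 0"
proof -
  let ?w = "\<lambda>n::int. (1 + (of_int n)\<^sup>2) powr (1/2) * (cmod (fourier_coeff g n))\<^sup>2"
  have "?w summable_on UNIV"
    using assms by (simp add: H_half_def H_per_def)
  then have "(?w has_sum infsum ?w UNIV) UNIV"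
    by (rule has_sum_infsum)
  then have lim: "(sum ?w \<longlongrightarrow> infsum ?w UNIV) (finite_subsets_at_top UNIV)"
    by (simp add: has_sum_def)
  have "filterlim (\<lambda>N. {-int N..int N}) (finite_subsets_at_top UNIV) sequentially"
    unfolding filterlim_finite_subsets_at_top
  proof (intro allI impI)
    fix X :: "int set" assume X: "finite X \<and> X \<subseteq> UNIV"
    then obtain K where K: "\<And>n. n \<in> X \<Longrightarrow> \<bar>n\<bar> \<le> K"
      by (metis abs_le_iff finite_int_iff_bounded_le atMost_iff imageI minus_le_iff subsetD)
    show "\<forall>\<^sub>F N in sequentially. finite {-int N..int N} \<and> X \<subseteq> {-int N..int N} \<and> {-int N..int N} \<subseteq> UNIV"
    proof (rule eventually_sequentiallyI[of "nat K"], intro conjI subsetI)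
      fix N n assume "nat K \<le> N" "n \<in> X"
      then show "n \<in> {-int N..int N}" using K[of n] by auto
    qed auto
  qed
  from filterlim_compose[OF lim this]
  have "(\<lambda>N. infsum ?w UNIV - sum ?w {-int N..int N}) \<longlonglongrightarrow> infsum ?w UNIV - infsum ?w UNIV"
    by (intro tendsto_intros)
  then show ?thesis by (simp add: fourier_tail_def[abs_def])
qed

text \<open>Only frequencies with N < |n| <= K remain in the difference, and orthogonality bounds it
  by their weighted squares. The bound no longer depends on \<open>K\<close>.\<close>

lemma mode_sum_diff_le:
  assumes g: "g \<in> H_half" and "N \<le> K"
  shows "(\<integral>x. (norm (mode_sum g K x - mode_sum g N x))\<^sup>2 \<partial>lebesgue_on Omega) \<le> 10 * pi * fourier_tail g N"
    and "(\<integral>x. (norm (mode_grad_sum g K x - mode_grad_sum g N x))\<^sup>2 \<partial>lebesgue_on Omega) \<le> 10 * pi * fourier_tail g N"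
proof -
  let ?w = "\<lambda>n::int. (1 + (of_int n)\<^sup>2) powr (1/2) * (cmod (fourier_coeff g n))\<^sup>2"
  let ?A = "{-int K..int K} - {-int N..int N}"
  have sub: "{-int N..int N} \<subseteq> {-int K..int K}" using \<open>N \<le> K\<close> by auto
  have sum: "?w summable_on UNIV"
    using g by (simp add: H_half_def H_per_def)
  have "(\<Sum>n\<in>?A. ?w n) = (\<Sum>n\<in>{-int K..int K}. ?w n) - (\<Sum>n\<in>{-int N..int N}. ?w n)"
    by (rule sum_diff) (use sub in auto)
  also have "\<dots> \<le> fourier_tail g N"
    using finite_sum_le_infsum[OF sum, of "{-int K..int K}"] by (simp add: fourier_tail_def)
  finally have tail: "10 * pi * (\<Sum>n\<in>?A. ?w n) \<le> 10 * pi * fourier_tail g N"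
    by (intro mult_left_mono) auto
  have "mode_sum g K x - mode_sum g N x = (\<Sum>n\<in>?A. fourier_coeff g n * mode n x)" for x
    unfolding mode_sum_def by (rule sum_diff[symmetric]) (use sub in auto)
  then show "(\<integral>x. (norm (mode_sum g K x - mode_sum g N x))\<^sup>2 \<partial>lebesgue_on Omega) \<le> 10 * pi * fourier_tail g N"
    using order_trans[OF mode_sum_norm_le(1)[of ?A "fourier_coeff g"] tail] by simp
  have comp: "(mode_grad_sum g K x - mode_grad_sum g N x) $ j = (\<Sum>n\<in>?A. fourier_coeff g n * mode_grad n x $ j)" for x j
    unfolding mode_grad_sum_def vector_minus_component vec_lambda_beta by (rule sum_diff[symmetric]) (use sub in auto)
  have "integrable (lebesgue_on Omega) (\<lambda>x. (norm (\<Sum>n\<in>?A. fourier_coeff g n * mode_grad n x $ j))\<^sup>2)" for j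
    by (intro L2D(2) L2_sum L2_scale L2_component mode_L2)
  then have "(\<integral>x. (norm (mode_grad_sum g K x - mode_grad_sum g N x))\<^sup>2 \<partial>lebesgue_on Omega)
      = (\<Sum>j\<in>UNIV. \<integral>x. (norm (\<Sum>n\<in>?A. fourier_coeff g n * mode_grad n x $ j))\<^sup>2 \<partial>lebesgue_on Omega)"
    unfolding norm_vec_square comp by (intro Bochner_Integration.integral_sum) auto
  then show "(\<integral>x. (norm (mode_grad_sum g K x - mode_grad_sum g N x))\<^sup>2 \<partial>lebesgue_on Omega) \<le> 10 * pi * fourier_tail g N"
    using order_trans[OF mode_sum_norm_le(2)[of ?A "fourier_coeff g"] tail] by simp
qed

text \<open>With N fixed, letting K tend to infinity in the previous bound controls the distance
  from the pointwise limit to the N-th sum by the tail, which tends to zero.\<close>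

lemma solution_L2_limit:
  assumes g: "g \<in> H_half"
  shows "solution g \<in> L2 (lebesgue_on Omega)"
    and "(\<lambda>N. L2_norm (lebesgue_on Omega) (\<lambda>x. mode_sum g N x - solution g x)) \<longlonglongrightarrow> 0"
    and "solution_grad g \<in> L2 (lebesgue_on Omega)"
    and "(\<lambda>N. L2_norm (lebesgue_on Omega) (\<lambda>x. mode_grad_sum g N x - solution_grad g x)) \<longlonglongrightarrow> 0"
proof -
  let ?O = "lebesgue_on Omega"
  \<comment> \<open>One argument, polymorphic in the values, serves the complex-valued sums and
    their gradients.\<close>
  have abstract: "f \<in> L2 ?O \<and> (\<lambda>N. L2_norm ?O (\<lambda>x. s N x - f x)) \<longlonglongrightarrow> 0"
    if s: "\<And>N. s N \<in> L2 ?O" and conv: "\<And>x. x \<in> Omega \<Longrightarrow> convergent (\<lambda>N. s N x)"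
      and f: "f = (\<lambda>x. lim (\<lambda>N. s N x))"
      and le: "\<And>N K. N \<le> K \<Longrightarrow> (\<integral>x. (norm (s K x - s N x))\<^sup>2 \<partial>?O) \<le> 10 * pi * fourier_tail g N"
    for s :: "nat \<Rightarrow> real^2 \<Rightarrow> 'x::euclidean_space" and f
  proof -
    have f_meas: "f \<in> borel_measurable ?O"
      unfolding f by (intro borel_measurable_lim_metric L2D(1) s)
    have lim: "(\<lambda>K. s K x - s N x) \<longlonglongrightarrow> f x - s N x" if "x \<in> space ?O" for x N
      using conv[of x] that unfolding f convergent_LIMSEQ_iff by (intro tendsto_intros) auto
    have diff: "(\<lambda>x. f x - s N x) \<in> L2 ?O" "(\<integral>x. (norm (f x - s N x))\<^sup>2 \<partial>?O) \<le> 10 * pi * fourier_tail g N" for N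
      by (rule L2_fatou[where F="\<lambda>K x. s K x - s N x" and m=N and B="10 * pi * fourier_tail g N"];
          use s f_meas lim le L2D(1)[OF s] in \<open>auto intro!: L2_diff\<close>)+
    have "f \<in> L2 ?O"
      using L2_add[OF diff(1)[of 0] s[of 0]] by simp
    moreover have "(\<lambda>N. L2_norm ?O (\<lambda>x. s N x - f x)) \<longlonglongrightarrow> 0"
    proof (rule tendsto_sandwich[OF _ _ tendsto_const])
      have "(\<lambda>N. sqrt (10 * pi * fourier_tail g N)) \<longlonglongrightarrow> sqrt (10 * pi * 0)"
        by (intro tendsto_intros fourier_tail_tendsto g)
      then show "(\<lambda>N. sqrt (10 * pi * fourier_tail g N)) \<longlonglongrightarrow> 0" by simp
      show "\<forall>\<^sub>F N in sequentially. L2_norm ?O (\<lambda>x. s N x - f x) \<le> sqrt (10 * pi * fourier_tail g N)"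
        using diff(2) by (simp add: L2_norm_def norm_minus_commute)
    qed simp
    ultimately show ?thesis by blast
  qed
  have L2: "mode_sum g N \<in> L2 ?O" "mode_grad_sum g N \<in> L2 ?O" for N
    by (rule C1_gradient_L2[OF mode_sum_C1])+
  show "solution g \<in> L2 ?O" "(\<lambda>N. L2_norm ?O (\<lambda>x. mode_sum g N x - solution g x)) \<longlonglongrightarrow> 0"
    using abstract[OF L2(1) mode_sum_convergent[OF g], of "solution g"] mode_sum_diff_le(1)[OF g]
    by (simp_all add: solution_def[abs_def])
  show "solution_grad g \<in> L2 ?O" "(\<lambda>N. L2_norm ?O (\<lambda>x. mode_grad_sum g N x - solution_grad g x)) \<longlonglongrightarrow> 0"
    using abstract[OF L2(2) mode_grad_sum_convergent[OF g], of "solution_grad g"] mode_sum_diff_le(2)[OF g]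
    by (simp_all add: solution_grad_def[abs_def])
qed

lemma solution_weak_gradient:
  assumes g: "g \<in> H_half"
  shows "weak_gradient (solution g) (solution_grad g)"
  unfolding weak_gradient_def
proof (intro allI impI)
  fix \<phi> d\<phi> K j
  assume A: "C1_gradient \<phi> d\<phi> \<and> compact K \<and> K \<subseteq> Omega \<and> (\<forall>x. x \<notin> K \<longrightarrow> \<phi> x = 0)"
  let ?O = "lebesgue_on Omega"
  have \<phi>: "\<phi> \<in> L2 ?O" "d\<phi> \<in> L2 ?O" using A C1_gradient_L2 by auto
  note lim = solution_L2_limit[OF g] and sum = C1_gradient_L2[OF mode_sum_C1]
  have "(\<lambda>N. \<integral>x. mode_sum g N x * d\<phi> x $ j \<partial>?O) \<longlonglongrightarrow> (\<integral>x. solution g x * d\<phi> x $ j \<partial>?O)"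
    by (intro L2_tendsto_integral_mult L2_component \<phi> lim sum)
  moreover have "(\<lambda>N. - (\<integral>x. mode_grad_sum g N x $ j * \<phi> x \<partial>?O)) \<longlonglongrightarrow> - (\<integral>x. solution_grad g x $ j * \<phi> x \<partial>?O)"
    by (intro tendsto_minus L2_tendsto_integral_mult L2_component \<phi> lim sum L2_tendsto_component)
  moreover have "(\<integral>x. mode_sum g N x * d\<phi> x $ j \<partial>?O) = - (\<integral>x. mode_grad_sum g N x $ j * \<phi> x \<partial>?O)" for N
    using C1_gradient_imp_weak_gradient[OF mode_sum_C1, of g N] A unfolding weak_gradient_def by blast
  ultimately show "(\<integral>x. solution g x * d\<phi> x $ j \<partial>?O) = - (\<integral>x. solution_grad g x $ j * \<phi> x \<partial>?O)"
    by (simp add: LIMSEQ_unique)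
qed

lemma solution_trace:
  assumes g: "g \<in> H_half"
  shows "H1_trace (solution g) (solution_grad g) g"
proof -
  have g_L2: "g \<in> L2 period" using g by (simp add: H_half_def)
  show ?thesis
    unfolding H1_trace_def H1_def
    using solution_L2_limit[OF g] solution_weak_gradient[OF g] g_L2 mode_sum_C1 fourier_sum_tendsto_L2[OF g_L2]
    by (intro conjI exI[of _ "mode_sum g"] exI[of _ "mode_grad_sum g"]) (simp_all add: mode_sum_circle)
qed

text \<open>This single limit serves twice: for trace zero all sums vanish, which is the weak
  equation; for the trace e^(-int) only the term of index n survives, which is the normal
  derivative.\<close>

lemma solution_energy:
  assumes g: "g \<in> H_half" and v: "H1_trace v w h"
  shows "(\<lambda>N. \<Sum>n\<in>{-int N..int N}. fourier_coeff g n * (eigenvalue n * (\<integral>t. fourier_mode n t * h t \<partial>period)))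
    \<longlonglongrightarrow> energy q (solution g) (solution_grad g) v w"
proof -
  have vw: "v \<in> L2 (lebesgue_on Omega)" "w \<in> L2 (lebesgue_on Omega)"
    using v by (auto simp: H1_trace_def H1_def)
  have "(\<lambda>N. energy q (mode_sum g N) (mode_grad_sum g N) v w) \<longlonglongrightarrow> energy q (solution g) (solution_grad g) v w"
    by (rule energy_tendsto[where B=1])
       (use C1_gradient_L2[OF mode_sum_C1] solution_L2_limit[OF g] vw abs_radial_potential_le[OF \<gamma>] in auto)
  moreover have "energy q (mode_sum g N) (mode_grad_sum g N) v w
      = (\<Sum>n\<in>{-int N..int N}. fourier_coeff g n * (eigenvalue n * (\<integral>t. fourier_mode n t * h t \<partial>period)))" for N
    unfolding mode_sum_def[abs_def] mode_grad_sum_def[abs_def]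
    by (subst energy_sum[where B=1])
       (use mode_L2 vw abs_radial_potential_le[OF \<gamma>] in \<open>auto simp: mode_energy[OF v]\<close>)
  ultimately show ?thesis by simp
qed

text \<open>The description in \<open>DtN\<close> needs one pair u, p that realises the
  coefficients, and that every other admissible pair gives the same coefficients; the pairs
  themselves may differ.\<close>

theorem DtN_eq:
  assumes g: "g \<in> H_half"
  shows "DtN q g n = eigenvalue n * fourier_coeff g n"
proof -
  have "DtN q g = (\<lambda>n. eigenvalue n * fourier_coeff g n)"
    unfolding DtN_def
  proof (rule the_equality)
    have "weak_solution q g (solution g) (solution_grad g)"
      unfolding weak_solution_def
    proof (intro conjI allI impI)
      fix v w assume "H1_trace v w (\<lambda>_. 0)"
      from solution_energy[OF g this] show "energy q (solution g) (solution_grad g) v w = 0"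
        by (simp add: LIMSEQ_const_iff)
    qed (rule solution_trace[OF g])
    moreover have "normal_derivative q (solution g) (solution_grad g) (\<lambda>n. eigenvalue n * fourier_coeff g n)"
      unfolding normal_derivative_def
    proof (intro allI impI)
      fix n v w assume v: "H1_trace v w (fourier_mode (- n))"
      \<comment> \<open>As soon as N reaches |n|, the sum contains the index k = n and stays
        constant.\<close>
      have "\<forall>\<^sub>F N in sequentially. (\<Sum>k\<in>{-int N..int N}. fourier_coeff g k *
          (eigenvalue k * (\<integral>t. fourier_mode k t * fourier_mode (- n) t \<partial>period))) = 2 * pi * (eigenvalue n * fourier_coeff g n)"
      proof (rule eventually_sequentiallyI[of "nat \<bar>n\<bar>"])
        fix N assume N: "nat \<bar>n\<bar> \<le> N"
        have "(\<Sum>k\<in>{-int N..int N}. fourier_coeff g k * (eigenvalue k * (\<integral>t. fourier_mode k t * fourier_mode (- n) t \<partial>period)))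
            = (\<Sum>k\<in>{-int N..int N}. if k = n then 2 * pi * (eigenvalue n * fourier_coeff g n) else 0)"
          by (rule sum.cong) (auto simp: fourier_mode_mult integral_fourier_mode)
        also have "\<dots> = 2 * pi * (eigenvalue n * fourier_coeff g n)"
          using N by (subst sum.delta) auto
        finally show "(\<Sum>k\<in>{-int N..int N}. fourier_coeff g k * (eigenvalue k * (\<integral>t. fourier_mode k t * fourier_mode (- n) t \<partial>period)))
            = 2 * pi * (eigenvalue n * fourier_coeff g n)" .
      qed
      from LIMSEQ_unique[OF solution_energy[OF g v] tendsto_eventually[OF this]]
      show "eigenvalue n * fourier_coeff g n = 1 / (2 * of_real pi) * energy q (solution g) (solution_grad g) v w"
        by simp
    qed
    ultimately show "\<exists>u p. weak_solution q g u p \<and> normal_derivative q u p (\<lambda>n. eigenvalue n * fourier_coeff g n)"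
      by blast
  next
    fix l assume "\<exists>u p. weak_solution q g u p \<and> normal_derivative q u p l"
    then obtain u p where u: "H1_trace u p g" and l: "normal_derivative q u p l"
      by (auto simp: weak_solution_def)
    show "l = (\<lambda>n. eigenvalue n * fourier_coeff g n)"
    proof
      fix n
      have "l n = 1 / (2 * of_real pi) * energy q u p (mode (- n)) (mode_grad (- n))"
        using l mode_trace unfolding normal_derivative_def by blast
      also have "energy q u p (mode (- n)) (mode_grad (- n)) = eigenvalue n * (\<integral>t. g t * fourier_mode (- n) t \<partial>period)"
        using mode_energy[OF u, of "- n"] by (simp add: energy_sym eigenvalue_uminus mult.commute)
      finally show "l n = eigenvalue n * fourier_coeff g n"
        by (simp add: fourier_coeff_def)
    qed
  qed
  then show ?thesis by simp
qed

end

section \<open>Stability of the eigenvalues\<close>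

lemma measure_annulus:
  assumes "0 \<le> a" "a \<le> b" "b \<le> 1"
  shows "measure (lebesgue_on Omega) {x \<in> Omega. a \<le> norm x \<and> norm x < b} = pi * (b\<^sup>2 - a\<^sup>2)"
proof -
  have "{x \<in> Omega. a \<le> norm x \<and> norm x < b} = ball 0 b - ball (0::real^2) a"
    using assms by (auto simp: Omega_def)
  moreover have "measure lebesgue (ball 0 b - ball (0::real^2) a) = measure lebesgue (ball (0::real^2) b) - measure lebesgue (ball (0::real^2) a)"
    by (rule measurable_measure_Diff) (use assms in auto)
  moreover have "measure lebesgue (ball (0::real^2) c) = pi * c\<^sup>2" if "0 \<le> c" for c
    using content_ball[OF that, of "0::real^2"] by (simp add: unit_ball_vol_2)
  moreover have "ball 0 b - ball (0::real^2) a \<subseteq> Omega"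
    using assms by (auto simp: Omega_def)
  ultimately show ?thesis
    using assms by (simp add: measure_restrict_space right_diff_distrib)
qed

text \<open>The supports are open intervals of radii, so the inner radius \<open>a\<close> belongs
  to the annulus and the outer one does not.\<close>

lemma radial_potential_diff:
  assumes "0 < a" "a < b"
  shows "radial_potential \<gamma> b x - radial_potential \<gamma> a x = (if a \<le> norm x \<and> norm x < b then \<gamma> else 0)"
  using assms by (auto simp: radial_potential_def indicator_def)

text \<open>The difference has modulus \<gamma> on an annulus of positive area, however thin; a
  smaller essential supremum would make the annulus a null set.\<close>

lemma Linf_norm_radial_potential_diff:
  assumes "0 < a" "a < b" "b < 1" "0 < \<gamma>"
  shows "Linf_norm (\<lambda>x. radial_potential \<gamma> a x - radial_potential \<gamma> b x) = ereal \<gamma>"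
proof -
  let ?f = "\<lambda>x. ereal \<bar>radial_potential \<gamma> a x - radial_potential \<gamma> b x\<bar>"
  let ?S = "{x \<in> Omega. a \<le> norm x \<and> norm x < b}"
  have f: "?f x = (if a \<le> norm x \<and> norm x < b then ereal \<gamma> else 0)" for x
    using radial_potential_diff[OF assms(1,2), of \<gamma> x] assms(4) by (subst abs_minus_commute) auto
  have meas: "?f \<in> borel_measurable (lebesgue_on Omega)"
    by (rule borel_measurable_lebesgue_onI) measurable
  have "esssup (lebesgue_on Omega) ?f \<le> ereal \<gamma>"
    by (rule esssup_I[OF meas]) (use assms in \<open>simp add: f\<close>)
  moreover have "\<not> esssup (lebesgue_on Omega) ?f < ereal \<gamma>"
  proof
    define E where "E = esssup (lebesgue_on Omega) ?f"
    assume "esssup (lebesgue_on Omega) ?f < ereal \<gamma>"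
    then have less: "E < ereal \<gamma>" by (simp only: E_def)
    have "AE x in lebesgue_on Omega. ?f x \<le> E"
      unfolding E_def by (rule esssup_AE)
    then have "AE x in lebesgue_on Omega. x \<notin> ?S"
      by eventually_elim (use less in \<open>auto simp: f not_le[symmetric] split: if_splits\<close>)
    moreover have "?S \<in> sets (lebesgue_on Omega)"
    proof -
      have "?S = ball 0 b - ball 0 a" using assms by (auto simp: Omega_def)
      then show ?thesis using assms by (auto simp: sets_restrict_space_iff Omega_def)
    qed
    ultimately have "measure (lebesgue_on Omega) ?S = 0"
      by (simp add: AE_iff_null_sets measure_eq_0_null_sets)
    moreover have "0 < pi * (b\<^sup>2 - a\<^sup>2)"
      using assms by (simp add: power_strict_mono)
    ultimately show False
      using measure_annulus[of a b] assms by simp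
  qed
  ultimately show ?thesis by (simp add: Linf_norm_def)
qed

lemma integral_fourier_mode_mult:
  "(\<integral>t. fourier_mode n t * fourier_mode k t \<partial>period) = (if n + k = 0 then 2 * pi else 0)"
  by (simp only: fourier_mode_mult integral_fourier_mode)

text \<open>Testing each mode of one potential against a mode of the other one cancels the gradient
  terms and expresses the difference of the eigenvalues by an integral over the annulus.\<close>

lemma eigenvalue_diff_le:
  assumes P: "disk_profile \<gamma> a G D" and Q: "disk_profile \<gamma> b G' D'" and "a < b"
  shows "\<bar>disk_profile.eigenvalue D n - disk_profile.eigenvalue D' n\<bar> \<le> 2 * (b\<^sup>2 - a\<^sup>2)"
proof -
  interpret P: disk_profile \<gamma> a G D by fact
  interpret Q: disk_profile \<gamma> b G' D' by fact
  let ?O = "lebesgue_on Omega" and ?S = "{x \<in> Omega. a \<le> norm x \<and> norm x < b}"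
  let ?qa = "radial_potential \<gamma> a" and ?qb = "radial_potential \<gamma> b"
  let ?u = "P.mode n" and ?v = "Q.mode (- n)"
  have P_energy: "energy ?qa ?u (P.mode_grad n) ?v (Q.mode_grad (- n)) = 2 * pi * P.eigenvalue n"
    by (simp add: P.mode_energy[OF Q.mode_trace] integral_fourier_mode_mult)
  \<comment> \<open>Symmetry exchanges the roles: now the mode of index -n is the solution, for the
    larger radius, and its eigenvalue is that of index n.\<close>
  have Q_energy: "energy ?qb ?u (P.mode_grad n) ?v (Q.mode_grad (- n)) = 2 * pi * Q.eigenvalue n"
    by (simp add: energy_sym[of ?qb ?u] Q.mode_energy[OF P.mode_trace] Q.eigenvalue_uminus integral_fourier_mode_mult)
  have int: "integrable ?O (\<lambda>x. ?u x * (of_real (radial_potential \<gamma> c x) * ?v x))" for c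
    by (intro L2_mult_integrable P.mode_L2 L2_mult_bounded[where B=1] Q.mode_L2)
       (auto simp: abs_radial_potential_le[OF P.\<gamma>])
  have "complex_of_real (2 * pi * (P.eigenvalue n - Q.eigenvalue n))
      = energy ?qa ?u (P.mode_grad n) ?v (Q.mode_grad (- n)) - energy ?qb ?u (P.mode_grad n) ?v (Q.mode_grad (- n))"
    unfolding P_energy Q_energy by (simp add: algebra_simps)
  also have "\<dots> = (\<integral>x. ?u x * (of_real (?qb x) * ?v x) \<partial>?O) - (\<integral>x. ?u x * (of_real (?qa x) * ?v x) \<partial>?O)"
    by (subst (1 2) energy_eq_integrals[where B=1])
       (auto simp: P.mode_L2 Q.mode_L2 abs_radial_potential_le[OF P.\<gamma>])
  also have "\<dots> = (\<integral>x. ?u x * (of_real (?qb x - ?qa x) * ?v x) \<partial>?O)"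
    by (subst Bochner_Integration.integral_diff[OF int int, symmetric]) (simp add: algebra_simps)
  finally have eq: "complex_of_real (2 * pi * (P.eigenvalue n - Q.eigenvalue n)) = (\<integral>x. ?u x * (of_real (?qb x - ?qa x) * ?v x) \<partial>?O)" .
  interpret O: finite_measure ?O by simp
  have S: "?S \<in> sets ?O"
  proof -
    have "?S = ball 0 b - ball 0 a" using P.b Q.b \<open>a < b\<close> by (auto simp: Omega_def)
    then show ?thesis using P.b Q.b by (auto simp: sets_restrict_space_iff Omega_def)
  qed
  \<comment> \<open>The 4 is the product of the bounds 2 on the two modes. With the annulus area,
    division by 2 pi leaves the constant 2.\<close>
  have "norm (complex_of_real (2 * pi * (P.eigenvalue n - Q.eigenvalue n))) \<le> (\<integral>x. 4 * indicator ?S x \<partial>?O)"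
    unfolding eq
  proof (rule order_trans[OF integral_norm_bound], rule integral_mono')
    show "integrable ?O (\<lambda>x. 4 * indicator ?S x :: real)"
      using S by (intro integrable_mult_right integrable_real_indicator) (auto simp: less_top[symmetric])
    fix x assume "x \<in> space ?O"
    then have x: "x \<in> Omega" "norm x \<le> 1" by (auto simp: Omega_def)
    have qd: "\<bar>?qb x - ?qa x\<bar> \<le> indicator ?S x"
      using radial_potential_diff[of a b \<gamma> x] P.b P.\<gamma> \<open>a < b\<close> x by (auto simp: indicator_def)
    have "norm (?u x * (of_real (?qb x - ?qa x) * ?v x)) \<le> 2 * (indicator ?S x * 2)"
      unfolding norm_mult norm_of_real
      by (intro mult_mono P.mode_bound Q.mode_bound x qd) auto
    then show "norm (?u x * (of_real (?qb x - ?qa x) * ?v x)) \<le> 4 * indicator ?S x" by simp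
  qed auto
  also have "\<dots> = 4 * (pi * (b\<^sup>2 - a\<^sup>2))"
  proof -
    have "?S \<inter> Omega = ?S" by auto
    then show ?thesis
      using S measure_annulus[of a b] P.b Q.b \<open>a < b\<close> by simp
  qed
  finally have "2 * pi * \<bar>P.eigenvalue n - Q.eigenvalue n\<bar> \<le> 2 * pi * (2 * (b\<^sup>2 - a\<^sup>2))"
    by (simp only: norm_of_real abs_mult) simp
  then show ?thesis by simp
qed

text \<open>The base 1 + n^2 is at least 1, so the weight of order -1/2 is at most that of order
  1/2, and any uniform bound on the multipliers is an admissible constant in the infimum.\<close>

lemma op_norm_multiplier_le:
  assumes C: "\<And>n. \<bar>\<mu> n\<bar> \<le> C" and T: "\<And>g n. g \<in> H_half \<Longrightarrow> T g n = of_real (\<mu> n) * fourier_coeff g n"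
  shows "op_norm T \<le> ennreal C"
  unfolding op_norm_def
proof (rule Inf_lower, clarsimp, intro exI[of _ C] conjI ballI refl)
  show C0: "0 \<le> C" using C[of 0] by linarith
  fix g assume g: "g \<in> H_half"
  let ?w = "\<lambda>n::int. (1 + (of_int n)\<^sup>2) powr (1/2) * (cmod (fourier_coeff g n))\<^sup>2"
  let ?t = "\<lambda>n::int. (1 + (of_int n)\<^sup>2) powr (- 1 / 2) * (cmod (T g n))\<^sup>2"
  have w: "?w summable_on UNIV"
    using g by (simp add: H_half_def H_per_def)
  have Cw: "(\<lambda>n. C\<^sup>2 * ?w n) summable_on UNIV"
    by (rule summable_on_cmult_right[OF w])
  have le: "?t n \<le> C\<^sup>2 * ?w n" for n
  proof -
    have "(cmod (T g n))\<^sup>2 \<le> C\<^sup>2 * (cmod (fourier_coeff g n))\<^sup>2"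
      using power_mono[OF C[of n], of 2] by (simp add: T[OF g] norm_mult power_mult_distrib mult_right_mono)
    moreover have "(1 + (of_int n)\<^sup>2) powr (- 1 / 2 :: real) \<le> (1 + (of_int n)\<^sup>2) powr (1/2)"
      by (rule powr_mono) auto
    ultimately have "?t n \<le> (1 + (of_int n)\<^sup>2) powr (1/2) * (C\<^sup>2 * (cmod (fourier_coeff g n))\<^sup>2)"
      by (intro mult_mono) auto
    then show ?thesis by (simp add: mult_ac)
  qed
  have t: "?t summable_on UNIV"
    by (rule summable_on_comparison_test[OF Cw]) (use le in auto)
  then show "T g \<in> H_per (- (1/2))"
    by (simp add: H_per_def)
  have "infsum ?t UNIV \<le> (\<Sum>\<^sub>\<infinity>n. C\<^sup>2 * ?w n)"
    by (rule infsum_mono[OF t Cw]) (rule le)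
  also have "\<dots> = C\<^sup>2 * infsum ?w UNIV"
    by (rule infsum_cmult_right')
  finally have "sqrt (infsum ?t UNIV) \<le> sqrt (C\<^sup>2 * infsum ?w UNIV)"
    by (rule real_sqrt_le_mono)
  then show "H_per_norm (- (1/2)) (T g) \<le> C * H_per_norm (1/2) (fourier_coeff g)"
    using C0 by (simp add: H_per_norm_def real_sqrt_mult)
qed

theorem theorem3:
  fixes b0 \<gamma> :: real and q0 :: "real^2 \<Rightarrow> real"
  assumes "b0 \<in> {0<..<1}" and "\<gamma> \<in> {0<..1}"
    and "q0 = radial_potential \<gamma> b0"
  shows "\<exists>q :: nat \<Rightarrow> real^2 \<Rightarrow> real.
           (\<forall>k\<ge>1. q k \<in> F) \<and>
           (\<forall>k\<ge>1. Linf_norm (\<lambda>x. q0 x - q k x) = ereal \<gamma> \<and> \<gamma> > 0) \<and>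
           (\<lambda>k. op_norm (\<lambda>g n. DtN q0 g n - DtN (q k) g n)) \<longlonglongrightarrow> 0"
proof -
  have \<gamma>: "\<gamma> \<in> {0..1}" "0 < \<gamma>" using assms(2) by auto
  have b0: "0 < b0" "b0 < 1" using assms(1) by auto
  \<comment> \<open>The offset 2 keeps the radius strictly below 1 already for k = 0. The radii tend
    to \<open>b0\<close> from outside.\<close>
  define b where "b k = b0 + (1 - b0) / real (k + 2)" for k :: nat
  have b: "b0 < b k" "b k < 1" for k
  proof -
    show "b0 < b k" using b0 by (simp add: b_def)
    have "(1 - b0) / real (k + 2) < (1 - b0) / 1"
      using b0 by (intro divide_strict_left_mono) auto
    then show "b k < 1" by (simp add: b_def)
  qed
  have b_pos: "0 < b k" for k using b(1)[of k] b0 by linarith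
  obtain G D where P: "disk_profile \<gamma> b0 G D"
    using disk_profile_exists[OF \<gamma>(1) b0] by blast
  have bound: "op_norm (\<lambda>g n. DtN q0 g n - DtN (radial_potential \<gamma> (b k)) g n) \<le> ennreal (2 * ((b k)\<^sup>2 - b0\<^sup>2))" for k
  proof -
    obtain G' D' where Q: "disk_profile \<gamma> (b k) G' D'"
      using disk_profile_exists[OF \<gamma>(1) b_pos b(2)] by blast
    show ?thesis
    proof (rule op_norm_multiplier_le)
      show "\<bar>disk_profile.eigenvalue D n - disk_profile.eigenvalue D' n\<bar> \<le> 2 * ((b k)\<^sup>2 - b0\<^sup>2)" for n
        by (rule eigenvalue_diff_le[OF P Q b(1)])
      show "DtN q0 g n - DtN (radial_potential \<gamma> (b k)) g n
          = of_real (disk_profile.eigenvalue D n - disk_profile.eigenvalue D' n) * fourier_coeff g n"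
        if "g \<in> H_half" for g n
        unfolding assms(3) disk_profile.DtN_eq[OF P that] disk_profile.DtN_eq[OF Q that]
        by (simp add: left_diff_distrib)
    qed
  qed
  have "(\<lambda>k. (1 - b0) / real (k + 2)) \<longlonglongrightarrow> 0"
    using LIMSEQ_ignore_initial_segment[OF lim_const_over_n[of "1 - b0"], of 2] by simp
  then have "(\<lambda>k. b0 + (1 - b0) / real (k + 2)) \<longlonglongrightarrow> b0 + 0"
    by (intro tendsto_add tendsto_const)
  then have "b \<longlonglongrightarrow> b0"
    by (simp add: b_def[abs_def])
  then have "(\<lambda>k. 2 * ((b k)\<^sup>2 - b0\<^sup>2)) \<longlonglongrightarrow> 2 * (b0\<^sup>2 - b0\<^sup>2)"
    by (intro tendsto_mult tendsto_const tendsto_diff tendsto_power)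
  then have lim: "(\<lambda>k. ennreal (2 * ((b k)\<^sup>2 - b0\<^sup>2))) \<longlonglongrightarrow> 0"
    using tendsto_ennrealI by fastforce
  show ?thesis
  proof (intro exI[of _ "\<lambda>k. radial_potential \<gamma> (b k)"] conjI allI impI)
    have "b k \<in> {0<..<1}" for k
      using b b_pos by simp
    then show "radial_potential \<gamma> (b k) \<in> F" for k
      using \<gamma>(1) unfolding F_def by blast
    show "Linf_norm (\<lambda>x. q0 x - radial_potential \<gamma> (b k) x) = ereal \<gamma>" for k
      unfolding assms(3) by (rule Linf_norm_radial_potential_diff[OF b0(1) b \<gamma>(2)])
    show "(\<lambda>k. op_norm (\<lambda>g n. DtN q0 g n - DtN (radial_potential \<gamma> (b k)) g n)) \<longlonglongrightarrow> 0"
      by (rule tendsto_sandwich[OF _ _ tendsto_const lim]) (use bound in auto)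
  qed (rule \<gamma>(2))
qed

end
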